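(* Let $1\le q<\frac{2+d}{d}$ and $0\le q'\le1$, let $\nu$ be defined by $\frac{1}{q-1}=\frac{\nu+d}{2}$ (with $q=1$ corresponding to $\nu\to+\infty$), and let the prior be $$p_0(\mathbf{w})=\frac{1}{Z_0}\left(1+\frac{q-1}{2-d(q-1)}\|\mathbf{w}\|_2^2\right)^{\frac{1}{1-q}},\qquad Z_0=\frac{\Gamma\!\left(\frac{2-d(q-1)}{2(q-1)}\right)\left(\frac{2-d(q-1)}{q-1}\pi\right)^{\frac d2}}{\Gamma\!\left(\frac1{q-1}\right)} .$$ Consider the problem $$\min_{p(\mathbf{w}),\,\mathbf{z}}\; D_q(p(\mathbf{w})\|p_0(\mathbf{w}))+C\sum_{i=1}^{m}\exp_{q'}(-z_i)$$ $$\text{s.t.}\quad z_i=\int y_i\,\mathbf{f}_i^T\mathbf{w}\;p^q(\mathbf{w})\,d\mathbf{w}\quad(i=1,\dots,m),\qquad \int p(\mathbf{w})\,d\mathbf{w}=1 .$$ Then the solution (posterior distribution) $p(\mathbf{w})$ can be expressed in terms of the prior and the vector $\boldsymbol{\beta}\in\mathbb{R}^m$ of Lagrange multipliers of the constraints on $z_1,\dots,z_m$ as $$p(\mathbf{w})=\frac{1}{Z_0c^{d/2}}\left(1+\frac{1}{\nu c}\|\mathbf{w}-\boldsymbol{\mu}\|_2^2\right)^{-\frac{\nu+d}{2}},$$ where $$\boldsymbol{\mu}=\frac{\nu}{\nu+d}Z_0^{-\frac{2}{\nu+d}}\mathbf{H}^T\boldsymbol{\beta},\qquad c=1-\frac1\nu\|\boldsymbol{\mu}\|_2^2,\qquad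 \mathbf{H}=(y_1\mathbf{f}_1,\dots,y_m\mathbf{f}_m)^T .$$ Moreover, the primal problem can be solved in the dual domain: its Lagrange dual problem is (up to sign and an additive constant in the objective) the problem $$\min_{\boldsymbol{\beta}}\;\ln_q\!\left(\exp_q^{r}\!\left(\frac r2 Z_0^{2(1-q)}\|\mathbf{H}^T\boldsymbol{\beta}\|_2^2\right)\right)+C\,D_{1/q'}\!\left(\boldsymbol{\beta}/C\,\|\,\mathbf{1}_m\right)\qquad\text{s.t.}\quad\boldsymbol{\beta}\ge\mathbf{0},$$ where $r=\frac{2+d(1-q)}{2}$. For $q=1$ it becomes the $\ell_2$-norm regularized problem $$\min_{\boldsymbol{\beta}}\;\frac12\|\mathbf{H}^T\boldsymbol{\beta}\|_2^2+C\,D_{1/q'}\!\left(\boldsymbol{\beta}/C\,\|\,\mathbf{1}_m\right)\qquad\text{s.t.}\quad\boldsymbol{\beta}\ge\mathbf{0}.$$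
   Context: Data: instance-label pairs $(\mathbf{x}_i,y_i)$, $i=1,\dots,m$, with $\mathbf{x}_i\in\mathbb{R}^n$, $y_i\in\{-1,+1\}$; fixed basis functions $\phi_1,\dots,\phi_d$ on $\mathbb{R}^n$; feature vectors $\mathbf{f}_i=(\phi_1(\mathbf{x}_i),\dots,\phi_d(\mathbf{x}_i))^T\in\mathbb{R}^d$. $C>0$ is a constant. The variable $\mathbf{w}\in\mathbb{R}^d$ is a continuous random vector with normalized probability density $p(\mathbf{w})$; $p^q(\mathbf{w})$ means $(p(\mathbf{w}))^q$. $\mathbf{z}=(z_1,\dots,z_m)^T\in\mathbb{R}^m$. $\Gamma$ is the Gamma function. In terms of $\nu>0$, the prior is the Student-t density $p_0(\mathbf{w})=\frac1{Z_0}\left(1+\frac1\nu\|\mathbf{w}\|_2^2\right)^{-\frac{\nu+d}{2}}$ with $\nu$ degrees of freedom and $Z_0=\frac{\Gamma(\nu/2)\nu^{d/2}\pi^{d/2}}{\Gamma((\nu+d)/2)}$; the case $q=1$ is understood as the limit $q\to1$, i.e. $\nu\to+\infty$ (Gaussian prior). $q$-exponential and $q$-logarithm: with $[x]_+=\max\{x,0\}$, $\exp_q x=[1+(1-q)x]_+^{\frac1{1-q}}$ and $\ln_q x=\frac{x^{1-q}-1}{1-q}$ for $q\ne1$; $\exp_1x=\exp x$, $\ln_1x=\ln x$. $\exp_q^r(x)$ means $(\exp_q x)^r$. Tsallis divergence between normalized densities: $D_q(p(\mathbf{w})\|p_0(\mathbf{w}))=\frac{\int p^q(\mathbf{w})p_0^{1-q}(\mathbf{w})\,d\mathbf{w}-1}{q-1}$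 for $q\neq1$, and $D_1(p(\mathbf{w})\|p_0(\mathbf{w}))=\int p(\mathbf{w})\ln\frac{p(\mathbf{w})}{p_0(\mathbf{w})}\,d\mathbf{w}$. Generalized Tsallis divergence between vectors $\mathbf{p},\mathbf{t}\in\mathbb{R}_+^m$ (nonnegative entries): $D_s(\mathbf{p}\|\mathbf{t})=\frac{\sum_{i=1}^m\left(p_i^s t_i^{1-s}-s\,p_i+(s-1)t_i\right)}{s-1}$ for $s\in\mathbb{R}\setminus\{1\}$, and $D_1(\mathbf{p}\|\mathbf{t})=\sum_{i=1}^m\left(p_i\ln\frac{p_i}{t_i}-p_i+t_i\right)$. $\mathbf{1}_m\in\mathbb{R}^m$ is the all-ones vector. For $q'=0$, $1/q'$ is read as $+\infty$, and $D_\infty(\mathbf{p}\|\mathbf{1}_m)=\lim_{s\to+\infty}D_s(\mathbf{p}\|\mathbf{1}_m)$, which equals $m-\sum_{i=1}^m p_i$ if $p_i\le 1$ for all $i$ and $+\infty$ otherwise.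
   Formalization: For q>1 the dual problem also carries the constraint 1+(1-q)(r/2)Z_0^{2(1-q)}||H^T β||^2 ≥ 0 (i.e. c ≥ 0), since otherwise exp_q is 0 to a negative power and the Lagrange dual function is −∞; on the boundary the first term is read as its limit 1/(q-1). *)

theory Defs
  imports "HOL-Analysis.Analysis" "HOL-Real_Asymp.Real_Asymp"
begin

text \<open>
  With \<^term>\<open>0 powr a = (0::real)\<close> for all \<open>a\<close>, the value below is 0 instead of \<open>+\<infinity>\<close> if
  \<open>q > 1\<close> and \<open>1 + (1 - q) * x \<le> 0\<close>; see \<open>dual_domain\<close> for the only place where \<open>q > 1\<close> occurs.
\<close>
definition exp_q :: "real \<Rightarrow> real \<Rightarrow> real" where
  "exp_q q x = (if q = 1 then exp x else (max (1 + (1 - q) * x) 0) powr (1 / (1 - q)))"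

definition ln_q :: "real \<Rightarrow> real \<Rightarrow> real" where
  "ln_q q x = (if q = 1 then ln x else (x powr (1 - q) - 1) / (1 - q))"

text \<open>
  For \<open>q \<ge> 1\<close> and an integrable function \<open>p0 > 0\<close>, the integrand is bounded from below by an
  integrable function (\<open>p * ln (p / p0) \<ge> p - p0\<close> if \<open>q = 1\<close>), so that its integral always exists
  in \<open>(-\<infinity>, +\<infinity>]\<close> and equals \<open>+\<infinity>\<close> precisely if the integrand is not integrable.
\<close>
definition tsallis_div :: "real \<Rightarrow> (real^'d \<Rightarrow> real) \<Rightarrow> (real^'d \<Rightarrow> real) \<Rightarrow> ereal" where
  "tsallis_div q p p0 =
    (if q = 1
     then (if integrable lborel (\<lambda>w. p w * ln (p w / p0 w))
           then ereal (\<integral>w. p w * ln (p w / p0 w) \<partial>lborel) else \<infinity>)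
     else (if integrable lborel (\<lambda>w. p w powr q * p0 w powr (1 - q))
           then ereal (((\<integral>w. p w powr q * p0 w powr (1 - q) \<partial>lborel) - 1) / (q - 1)) else \<infinity>))"

definition vec_tsallis_div_real :: "real \<Rightarrow> real^'m \<Rightarrow> real^'m \<Rightarrow> real" where
  "vec_tsallis_div_real s p t =
    (if s = 1 then (\<Sum>i\<in>UNIV. p $ i * ln (p $ i / t $ i) - p $ i + t $ i)
     else (\<Sum>i\<in>UNIV. p $ i powr s * t $ i powr (1 - s) - s * p $ i + (s - 1) * t $ i) / (s - 1))"

definition vec_tsallis_div :: "ereal \<Rightarrow> real^'m \<Rightarrow> real^'m \<Rightarrow> ereal" where
  "vec_tsallis_div s p t =
    (if s = \<infinity> then Lim at_top (\<lambda>s'. ereal (vec_tsallis_div_real s' p t))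
     else ereal (vec_tsallis_div_real (real_of_ereal s) p t))"

definition feature :: "('d::finite \<Rightarrow> real^'n \<Rightarrow> real) \<Rightarrow> real^'n \<Rightarrow> real^'d" where
  "feature \<phi> u = (\<chi> j. \<phi> j u)"

definition H_matrix ::
    "('d::finite \<Rightarrow> real^'n \<Rightarrow> real) \<Rightarrow> ('m::finite \<Rightarrow> real^'n) \<Rightarrow> ('m \<Rightarrow> real) \<Rightarrow> real^'d^'m" where
  "H_matrix \<phi> x y = (\<chi> i. y i *\<^sub>R feature \<phi> (x i))"

definition nu :: "nat \<Rightarrow> real \<Rightarrow> real" where
  "nu d q = 2 / (q - 1) - real d"

text \<open>
  In the following definitions the case \<open>q = 1\<close> is the limit \<open>q \<rightarrow> 1\<close> from above of the case
  \<open>q > 1\<close>; this is proved in \<open>Z0_tendsto\<close>, \<open>prior_tendsto\<close>, \<open>post_mean_tendsto\<close>,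
  \<open>post_scale_tendsto\<close>, \<open>posterior_tendsto\<close> below.
\<close>
definition Z0 :: "nat \<Rightarrow> real \<Rightarrow> real" where
  "Z0 d q =
    (if q = 1 then (2 * pi) powr (real d / 2)
     else Gamma ((2 - real d * (q - 1)) / (2 * (q - 1)))
            * ((2 - real d * (q - 1)) / (q - 1) * pi) powr (real d / 2)
          / Gamma (1 / (q - 1)))"

definition prior :: "real \<Rightarrow> real^'d \<Rightarrow> real" where
  "prior q w =
    (if q = 1 then 1 / Z0 CARD('d) q * exp (- ((norm w)\<^sup>2 / 2))
     else 1 / Z0 CARD('d) q *
       (1 + (q - 1) / (2 - real CARD('d) * (q - 1)) * (norm w)\<^sup>2) powr (1 / (1 - q)))"

definition post_mean :: "real \<Rightarrow> real^'d^'m \<Rightarrow> real^'m \<Rightarrow> real^'d" where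
  "post_mean q H \<beta> =
    (if q = 1 then transpose H *v \<beta>
     else (nu CARD('d) q / (nu CARD('d) q + CARD('d))
            * Z0 CARD('d) q powr (- (2 / (nu CARD('d) q + CARD('d))))) *\<^sub>R (transpose H *v \<beta>))"

definition post_scale :: "real \<Rightarrow> real^'d^'m \<Rightarrow> real^'m \<Rightarrow> real" where
  "post_scale q H \<beta> =
    (if q = 1 then 1 else 1 - 1 / nu CARD('d) q * (norm (post_mean q H \<beta>))\<^sup>2)"

definition posterior :: "real \<Rightarrow> real^'d^'m \<Rightarrow> real^'m \<Rightarrow> real^'d \<Rightarrow> real" where
  "posterior q H \<beta> w =
    (let \<nu> = nu CARD('d) q; \<mu> = post_mean q H \<beta>; c = post_scale q H \<beta> in
     1 / (Z0 CARD('d) q * c powr (CARD('d) / 2)) *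
     (if q = 1 then exp (- ((norm (w - \<mu>))\<^sup>2 / 2))
      else (1 + 1 / (\<nu> * c) * (norm (w - \<mu>))\<^sup>2) powr (- ((\<nu> + CARD('d)) / 2))))"

definition moment_integrand :: "real \<Rightarrow> ('d::finite \<Rightarrow> real^'n \<Rightarrow> real) \<Rightarrow> ('m::finite \<Rightarrow> real^'n) \<Rightarrow> ('m \<Rightarrow> real)
    \<Rightarrow> (real^'d \<Rightarrow> real) \<Rightarrow> 'm \<Rightarrow> real^'d \<Rightarrow> real" where
  "moment_integrand q \<phi> x y p i w = y i * (feature \<phi> (x i) \<bullet> w) * p w powr q"

definition moments :: "real \<Rightarrow> ('d::finite \<Rightarrow> real^'n \<Rightarrow> real) \<Rightarrow> ('m::finite \<Rightarrow> real^'n) \<Rightarrow> ('m \<Rightarrow> real)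
    \<Rightarrow> (real^'d \<Rightarrow> real) \<Rightarrow> real^'m" where
  "moments q \<phi> x y p = (\<chi> i. \<integral>w. moment_integrand q \<phi> x y p i w \<partial>lborel)"

text \<open>
  The domain of the variable \<open>p\<close>: nonnegative functions for which the integrals in the
  constraints exist. The normalization of \<open>p\<close> is not part of it but a constraint.
\<close>
definition admissible :: "real \<Rightarrow> ('d::finite \<Rightarrow> real^'n \<Rightarrow> real) \<Rightarrow> ('m::finite \<Rightarrow> real^'n) \<Rightarrow> ('m \<Rightarrow> real)
    \<Rightarrow> (real^'d \<Rightarrow> real) set" where
  "admissible q \<phi> x y =
    {p. (\<forall>w. 0 \<le> p w) \<and> integrable lborel p \<and>
        (\<forall>i. integrable lborel (moment_integrand q \<phi> x y p i))}"

definition primal_feasible :: "real \<Rightarrow> ('d::finite \<Rightarrow> real^'n \<Rightarrow> real) \<Rightarrow> ('m::finite \<Rightarrow> real^'n) \<Rightarrow> ('m \<Rightarrow> real)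
    \<Rightarrow> ((real^'d \<Rightarrow> real) \<times> (real^'m)) set" where
  "primal_feasible q \<phi> x y =
    {(p, z). p \<in> admissible q \<phi> x y \<and>
             (\<forall>i. z $ i = (\<integral>w. y i * (feature \<phi> (x i) \<bullet> w) * p w powr q \<partial>lborel)) \<and>
             (\<integral>w. p w \<partial>lborel) = 1}"

definition primal_objective ::
    "real \<Rightarrow> real \<Rightarrow> real \<Rightarrow> (real^'d \<Rightarrow> real) \<Rightarrow> real^'m \<Rightarrow> ereal" where
  "primal_objective q q' C p z =
    tsallis_div q p (prior q) + ereal (C * (\<Sum>i\<in>UNIV. exp_q q' (- (z $ i))))"

definition primal_solution :: "real \<Rightarrow> real \<Rightarrow> real \<Rightarrow> ('d::finite \<Rightarrow> real^'n \<Rightarrow> real) \<Rightarrow> ('m::finite \<Rightarrow> real^'n)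
    \<Rightarrow> ('m \<Rightarrow> real) \<Rightarrow> (real^'d \<Rightarrow> real) \<Rightarrow> real^'m \<Rightarrow> bool" where
  "primal_solution q q' C \<phi> x y p z \<longleftrightarrow>
    (p, z) \<in> primal_feasible q \<phi> x y \<and>
    (\<forall>(p', z') \<in> primal_feasible q \<phi> x y.
       primal_objective q q' C p z \<le> primal_objective q q' C p' z')"

definition lagrangian :: "real \<Rightarrow> real \<Rightarrow> real \<Rightarrow> ('d::finite \<Rightarrow> real^'n \<Rightarrow> real) \<Rightarrow> ('m::finite \<Rightarrow> real^'n)
    \<Rightarrow> ('m \<Rightarrow> real) \<Rightarrow> (real^'d \<Rightarrow> real) \<Rightarrow> real^'m \<Rightarrow> real^'m \<Rightarrow> real \<Rightarrow> ereal" where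
  "lagrangian q q' C \<phi> x y p z \<beta> \<kappa> =
    primal_objective q q' C p z +
    ereal (\<beta> \<bullet> (z - moments q \<phi> x y p) + \<kappa> * (1 - (\<integral>w. p w \<partial>lborel)))"

text \<open>\<open>\<kappa>\<close> is the multiplier of the normalization constraint.\<close>
definition lagrange_multiplier :: "real \<Rightarrow> real \<Rightarrow> real \<Rightarrow> ('d::finite \<Rightarrow> real^'n \<Rightarrow> real) \<Rightarrow> ('m::finite \<Rightarrow> real^'n)
    \<Rightarrow> ('m \<Rightarrow> real) \<Rightarrow> (real^'d \<Rightarrow> real) \<Rightarrow> real^'m \<Rightarrow> real^'m \<Rightarrow> bool" where
  "lagrange_multiplier q q' C \<phi> x y p z \<beta> \<longleftrightarrow>
    (\<exists>\<kappa>. \<forall>p' \<in> admissible q \<phi> x y. \<forall>z'.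
       lagrangian q q' C \<phi> x y p z \<beta> \<kappa> \<le> lagrangian q q' C \<phi> x y p' z' \<beta> \<kappa>)"

definition lagrange_dual :: "real \<Rightarrow> real \<Rightarrow> real \<Rightarrow> ('d::finite \<Rightarrow> real^'n \<Rightarrow> real) \<Rightarrow> ('m::finite \<Rightarrow> real^'n)
    \<Rightarrow> ('m \<Rightarrow> real) \<Rightarrow> real^'m \<Rightarrow> real \<Rightarrow> ereal" where
  "lagrange_dual q q' C \<phi> x y \<beta> \<kappa> =
    (INF p \<in> admissible q \<phi> x y. INF z. lagrangian q q' C \<phi> x y p z \<beta> \<kappa>)"

definition dual_exponent :: "nat \<Rightarrow> real \<Rightarrow> real" where
  "dual_exponent d q = (2 + real d * (1 - q)) / 2"

definition dual_arg :: "real \<Rightarrow> real^'d^'m \<Rightarrow> real^'m \<Rightarrow> real" where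
  "dual_arg q H \<beta> =
    dual_exponent CARD('d) q / 2 * Z0 CARD('d) q powr (2 * (1 - q)) * (norm (transpose H *v \<beta>))\<^sup>2"

definition dual_loss :: "real \<Rightarrow> real \<Rightarrow> real^'m \<Rightarrow> ereal" where
  "dual_loss q' C \<beta> = ereal C * vec_tsallis_div (1 / ereal q') (\<beta> /\<^sub>R C) (\<chi> i. 1)"

definition dual_objective :: "real \<Rightarrow> real \<Rightarrow> real \<Rightarrow> real^'d^'m \<Rightarrow> real^'m \<Rightarrow> ereal" where
  "dual_objective q q' C H \<beta> =
    ereal (ln_q q (exp_q q (dual_arg q H \<beta>) powr dual_exponent CARD('d) q)) + dual_loss q' C \<beta>"

text \<open>
  The truncation in the q-exponential must not be active: for \<open>q > 1\<close> it would stand for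
  \<open>0 powr (1 / (1 - q)) = +\<infinity>\<close>, where the objective has no meaning (and the Lagrange dual function
  is \<open>-\<infinity>\<close>). On the boundary \<open>1 + (1 - q) * dual_arg q H \<beta> = 0\<close>, the first term of the objective
  is \<open>1 / (q - 1)\<close>, which is its limit from the interior. For \<open>q = 1\<close> the condition is void.
\<close>
definition dual_domain :: "real \<Rightarrow> real^'d^'m \<Rightarrow> (real^'m) set" where
  "dual_domain q H = {\<beta>. (\<forall>i. 0 \<le> \<beta> $ i) \<and> 0 \<le> 1 + (1 - q) * dual_arg q H \<beta>}"

definition dual_solution :: "real \<Rightarrow> real \<Rightarrow> real \<Rightarrow> real^'d^'m \<Rightarrow> real^'m \<Rightarrow> bool" where
  "dual_solution q q' C H \<beta> \<longleftrightarrow>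
    \<beta> \<in> dual_domain q H \<and>
    (\<forall>\<beta>' \<in> dual_domain q H. dual_objective q q' C H \<beta> \<le> dual_objective q q' C H \<beta>')"

lemma Gamma_half_step:
  "((\<lambda>x::real. Gamma (x + 1/2) / (Gamma x * x powr (1/2))) \<longlongrightarrow> 1) at_top"
proof (rule tendsto_sandwich)
  have lc: "Gamma ((a + b) / 2) \<le> sqrt (Gamma a * Gamma b)" if "a > 0" "b > 0" for a b :: real
  proof -
    have "(ln \<circ> Gamma) ((1 - 1/2) *\<^sub>R a + (1/2) *\<^sub>R b) \<le> (1 - 1/2) * (ln \<circ> Gamma) a + (1/2) * (ln \<circ> Gamma) b"
      using convex_onD[OF log_convex_Gamma_real, of "1/2" a b] that by simp
    hence "ln (Gamma ((a + b) / 2)) \<le> (ln (Gamma a) + ln (Gamma b)) / 2"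
      by (simp add: add_divide_distrib)
    also have "\<dots> = ln (sqrt (Gamma a * Gamma b))"
      using Gamma_real_pos[OF that(1)] Gamma_real_pos[OF that(2)] by (simp add: ln_sqrt ln_mult_pos)
    finally show ?thesis
      using that Gamma_real_pos[of a] Gamma_real_pos[of b] Gamma_real_pos[of "(a + b) / 2"]
      by (subst (asm) ln_le_cancel_iff) auto
  qed
  show "\<forall>\<^sub>F x::real in at_top. x powr (1/2) / sqrt (x + 1/2) \<le> Gamma (x + 1/2) / (Gamma x * x powr (1/2))"
    using eventually_gt_at_top[of 0]
  proof eventually_elim
    case (elim x)
    have G: "Gamma x > 0" "Gamma (x + 1/2) > 0" using elim by (auto intro!: Gamma_real_pos)
    have np: "x \<notin> \<int>\<^sub>\<le>\<^sub>0" "x + 1/2 \<notin> \<int>\<^sub>\<le>\<^sub>0" using elim by (auto elim!: nonpos_Ints_cases)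
    have "Gamma (x + 1) \<le> sqrt (Gamma (x + 1/2) * Gamma (x + 3/2))"
      using lc[of "x + 1/2" "x + 3/2"] elim by (simp add: add_divide_distrib)
    also have "Gamma (x + 3/2) = (x + 1/2) * Gamma (x + 1/2)"
      using Gamma_plus1[OF np(2)] by (simp add: add.assoc)
    also have "Gamma (x + 1/2) * ((x + 1/2) * Gamma (x + 1/2)) = (Gamma (x + 1/2))\<^sup>2 * (x + 1/2)"
      by (simp add: power2_eq_square)
    also have "sqrt \<dots> = Gamma (x + 1/2) * sqrt (x + 1/2)"
      using G by (simp add: real_sqrt_mult)
    also have "Gamma (x + 1) = x powr (1/2) * x powr (1/2) * Gamma x"
      using Gamma_plus1[OF np(1)] elim by (simp flip: powr_add)
    finally show ?case using elim G by (simp add: field_simps)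
  qed
  show "\<forall>\<^sub>F x::real in at_top. Gamma (x + 1/2) / (Gamma x * x powr (1/2)) \<le> 1"
    using eventually_gt_at_top[of 0]
  proof eventually_elim
    case (elim x)
    have G: "Gamma x > 0" using elim by (auto intro!: Gamma_real_pos)
    have np: "x \<notin> \<int>\<^sub>\<le>\<^sub>0" using elim by (auto elim!: nonpos_Ints_cases)
    have "Gamma (x + 1/2) \<le> sqrt (Gamma x * Gamma (x + 1))"
      using lc[of x "x + 1"] elim by (simp add: add_divide_distrib)
    also have "Gamma x * Gamma (x + 1) = (Gamma x)\<^sup>2 * x"
      using Gamma_plus1[OF np] by (simp add: power2_eq_square)
    also have "sqrt \<dots> = Gamma x * x powr (1/2)"
      using G elim by (simp add: real_sqrt_mult powr_half_sqrt)
    finally show ?case using G elim by simp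
  qed
  show "((\<lambda>x::real. x powr (1/2) / sqrt (x + 1/2)) \<longlongrightarrow> 1) at_top" by real_asymp
qed auto

lemma Gamma_ratio:
  "((\<lambda>x::real. Gamma (x - real n / 2) * x powr (real n / 2) / Gamma x) \<longlongrightarrow> 1) at_top"
proof (induction n)
  case 0
  have "\<forall>\<^sub>F x::real in at_top. Gamma x * x powr 0 / Gamma x = 1"
    using eventually_gt_at_top[of 0]
  proof eventually_elim
    case (elim x)
    have "Gamma x \<noteq> 0" using Gamma_real_pos[OF elim] by linarith
    thus ?case using elim by simp
  qed
  thus ?case by (simp add: tendsto_eventually)
next
  case (Suc n)
  define g :: "real \<Rightarrow> real" where "g x = Gamma (x + 1/2) / (Gamma x * x powr (1/2))" for x
  let ?s = "\<lambda>x::real. x - real (Suc n) / 2"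
  have "filterlim ?s at_top at_top" by real_asymp
  from filterlim_compose[OF Gamma_half_step[folded g_def] this]
  have 1: "((\<lambda>x. g (?s x)) \<longlongrightarrow> 1) at_top" .
  have 2: "((\<lambda>x::real. (x / ?s x) powr (1/2)) \<longlongrightarrow> 1) at_top" by real_asymp
  have "((\<lambda>x. (Gamma (x - real n / 2) * x powr (real n / 2) / Gamma x) *
              (x / ?s x) powr (1/2) / g (?s x)) \<longlongrightarrow> 1 * 1 / 1) at_top"
    by (intro tendsto_intros Suc.IH 1 2) simp
  moreover have "\<forall>\<^sub>F x in at_top. (Gamma (x - real n / 2) * x powr (real n / 2) / Gamma x) *
              (x / ?s x) powr (1/2) / g (?s x) =
            Gamma (x - real (Suc n) / 2) * x powr (real (Suc n) / 2) / Gamma x"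
    using eventually_gt_at_top[of "real (Suc n) / 2"]
  proof eventually_elim
    case (elim x)
    have x: "x > 0" "?s x > 0" using elim by auto
    have e: "?s x + 1/2 = x - real n / 2" by (simp add: field_simps)
    have G: "Gamma x > 0" "Gamma (?s x) > 0" "Gamma (x - real n / 2) > 0"
      using elim x by (auto intro!: Gamma_real_pos simp: field_simps)
    have p: "x powr (real (Suc n) / 2) = x powr (real n / 2) * x powr (1/2)"
      by (simp add: add_divide_distrib flip: powr_add) (simp add: algebra_simps)
    have q: "(x / ?s x) powr (1/2) = x powr (1/2) / ?s x powr (1/2)"
      using x by (simp add: powr_divide)
    have "Gamma x \<noteq> 0" "Gamma (?s x) \<noteq> 0" "Gamma (x - real n / 2) \<noteq> 0" "?s x powr (1/2) \<noteq> 0"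
      using G x by (linarith | simp)+
    thus ?case unfolding g_def e p q by simp
  qed
  ultimately show ?case by (simp add: tendsto_cong)
qed

lemma nu_at_top: "filterlim (nu d) at_top (at_right 1)"
  unfolding nu_def by real_asymp

lemma Z0_tendsto: "(Z0 d \<longlongrightarrow> Z0 d 1) (at_right 1)"
proof -
  have lim: "filterlim (\<lambda>q::real. 1 / (q - 1)) at_top (at_right 1)" by real_asymp
  have "((\<lambda>x::real. ((2 - real d / x) * pi) powr (real d / 2)) \<longlongrightarrow> (2 * pi) powr (real d / 2)) at_top"
  proof -
    have "((\<lambda>x::real. (2 - real d / x) * pi) \<longlongrightarrow> 2 * pi) at_top" by real_asymp
    from tendsto_powr[OF this tendsto_const] show ?thesis by simp
  qed
  hence "((\<lambda>x. (Gamma (x - real d / 2) * x powr (real d / 2) / Gamma x) *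
            ((2 - real d / x) * pi) powr (real d / 2)) \<longlongrightarrow> 1 * (2 * pi) powr (real d / 2)) at_top"
    by (intro tendsto_mult Gamma_ratio)
  from filterlim_compose[OF this lim]
  have "((\<lambda>q. (Gamma (1 / (q - 1) - real d / 2) * (1 / (q - 1)) powr (real d / 2) / Gamma (1 / (q - 1))) *
            ((2 - real d / (1 / (q - 1))) * pi) powr (real d / 2)) \<longlongrightarrow> Z0 d 1) (at_right 1)"
    by (simp add: Z0_def)
  moreover have "\<forall>\<^sub>F q in at_right 1.
      (Gamma (1 / (q - 1) - real d / 2) * (1 / (q - 1)) powr (real d / 2) / Gamma (1 / (q - 1))) *
            ((2 - real d / (1 / (q - 1))) * pi) powr (real d / 2) = Z0 d q"
  proof -
    have "\<forall>\<^sub>F q::real in at_right 1. q > 1 \<and> nu d q > 0"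
      using nu_at_top[of d] unfolding filterlim_at_top_dense
      by (intro eventually_conj eventually_at_right_less) auto
    thus ?thesis
    proof eventually_elim
      case (elim q)
      have n: "nu d q = (2 - real d * (q - 1)) / (q - 1)"
        using elim by (simp add: nu_def field_simps)
      have pos: "2 - real d * (q - 1) > 0"
        using elim unfolding n by (auto simp: zero_less_divide_iff)
      have 1: "(2 - real d * (q - 1)) / (2 * (q - 1)) = 1 / (q - 1) - real d / 2"
        using elim by (simp add: field_simps)
      have 2: "((2 - real d * (q - 1)) / (q - 1) * pi) powr (real d / 2) =
               (1 / (q - 1)) powr (real d / 2) * ((2 - real d * (q - 1)) * pi) powr (real d / 2)"
        using elim pos by (subst powr_mult [symmetric]) auto
      show ?case using elim unfolding Z0_def 1 2 by simp
    qed
  qed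
  ultimately show ?thesis by (simp add: tendsto_cong)
qed

lemma Z0_1_pos: "Z0 d 1 > 0"
  by (simp add: Z0_def)

lemma student_tendsto:
  assumes "(a \<longlongrightarrow> (a0::real)) F" "filterlim (v :: real \<Rightarrow> real) at_top F"
  shows "((\<lambda>q. (1 + a q / v q) powr (- ((v q + d) / 2))) \<longlongrightarrow> exp (- (a0 / 2))) F"
proof -
  define g where "g h = (if h = 0 then 1 else ln (1 + h) / h)" for h :: real
  have "((\<lambda>h::real. ln (1 + h) / h) \<longlongrightarrow> 1) (at 0)"
    by real_asymp
  hence "isCont g 0" unfolding isCont_def g_def
    by (subst tendsto_cong[where g = "\<lambda>h::real. ln (1 + h) / h"]) (auto simp: eventually_at_filter)
  have inv: "((\<lambda>q. inverse (v q)) \<longlongrightarrow> 0) F"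
    using tendsto_inverse_0_at_top[OF assms(2)] .
  have h0: "((\<lambda>q. a q / v q) \<longlongrightarrow> 0) F"
    using tendsto_mult[OF assms(1) inv] by (simp add: divide_inverse)
  have "((\<lambda>q. g (a q / v q)) \<longlongrightarrow> g 0) F"
    using isCont_tendsto_compose[OF \<open>isCont g 0\<close> h0] .
  hence g1: "((\<lambda>q. g (a q / v q)) \<longlongrightarrow> 1) F" by (simp add: g_def)
  have "((\<lambda>q. exp (- ((1 + d * inverse (v q)) / 2 * (a q * g (a q / v q))))) \<longlongrightarrow>
          exp (- ((1 + d * 0) / 2 * (a0 * 1)))) F"
    by (intro tendsto_intros assms inv g1) auto
  moreover have "\<forall>\<^sub>F q in F. exp (- ((1 + d * inverse (v q)) / 2 * (a q * g (a q / v q)))) =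
                   (1 + a q / v q) powr (- ((v q + d) / 2))"
  proof -
    have "\<forall>\<^sub>F q in F. v q > 0" using assms(2) unfolding filterlim_at_top_dense by auto
    moreover have "\<forall>\<^sub>F q in F. a q / v q > -1" using order_tendstoD(1)[OF h0, of "-1"] by simp
    ultimately show ?thesis
    proof eventually_elim
      case (elim q)
      have "a q * g (a q / v q) = v q * ln (1 + a q / v q)"
        using elim by (simp add: g_def)
      moreover have "(1 + d * inverse (v q)) / 2 * (v q * L) = (v q + d) / 2 * L" for L
        using elim by (simp add: field_simps)
      ultimately show ?case using elim by (simp add: powr_def)
    qed
  qed
  ultimately show ?thesis by (simp add: tendsto_cong)
qed

lemma prior_tendsto: "((\<lambda>q. prior q w) \<longlongrightarrow> prior 1 (w :: real^'d)) (at_right 1)"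
proof -
  let ?d = "CARD('d)"
  have "((\<lambda>q. 1 / Z0 ?d q * (1 + (norm w)\<^sup>2 / nu ?d q) powr (- ((nu ?d q + real ?d) / 2))) \<longlongrightarrow>
         1 / Z0 ?d 1 * exp (- ((norm w)\<^sup>2 / 2))) (at_right 1)"
    using Z0_1_pos[of ?d] by (intro tendsto_intros Z0_tendsto student_tendsto nu_at_top) auto
  moreover have "\<forall>\<^sub>F q in at_right 1.
      1 / Z0 ?d q * (1 + (norm w)\<^sup>2 / nu ?d q) powr (- ((nu ?d q + real ?d) / 2)) = prior q w"
    using eventually_at_right_less[of "1::real"]
  proof eventually_elim
    case (elim q)
    have 1: "(norm w)\<^sup>2 / nu ?d q = (q - 1) / (2 - real ?d * (q - 1)) * (norm w)\<^sup>2"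
    proof -
      have "nu ?d q = (2 - real ?d * (q - 1)) / (q - 1)" using elim by (simp add: nu_def field_simps)
      thus ?thesis by simp
    qed
    have 2: "- ((nu ?d q + real ?d) / 2) = 1 / (1 - q)"
      using elim by (simp add: nu_def field_simps)
    show ?case unfolding 1 2 using elim by (simp add: prior_def)
  qed
  ultimately show ?thesis by (simp add: tendsto_cong prior_def)
qed

lemma post_mean_tendsto: "((\<lambda>q. post_mean q H \<beta>) \<longlongrightarrow> post_mean 1 H \<beta>) (at_right 1)"
  for H :: "real^'d^'m"
proof -
  let ?d = "CARD('d)"
  have 1: "((\<lambda>q. nu ?d q / (nu ?d q + real ?d)) \<longlongrightarrow> 1) (at_right 1)"
    unfolding nu_def by real_asymp
  have 2: "((\<lambda>q. - (2 / (nu ?d q + real ?d))) \<longlongrightarrow> 0) (at_right 1)"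
    unfolding nu_def by real_asymp
  have "((\<lambda>q. Z0 ?d q powr (- (2 / (nu ?d q + real ?d)))) \<longlongrightarrow> Z0 ?d 1 powr 0) (at_right 1)"
    using tendsto_powr[OF Z0_tendsto 2] Z0_1_pos[of ?d] by simp
  hence "((\<lambda>q. (nu ?d q / (nu ?d q + real ?d) * Z0 ?d q powr (- (2 / (nu ?d q + real ?d))))
            *\<^sub>R (transpose H *v \<beta>)) \<longlongrightarrow> (1 * Z0 ?d 1 powr 0) *\<^sub>R (transpose H *v \<beta>)) (at_right 1)"
    by (intro tendsto_scaleR tendsto_mult tendsto_const 1)
  moreover have "\<forall>\<^sub>F q in at_right 1.
      (nu ?d q / (nu ?d q + real ?d) * Z0 ?d q powr (- (2 / (nu ?d q + real ?d))))
            *\<^sub>R (transpose H *v \<beta>) = post_mean q H \<beta>"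
    using eventually_at_right_less[of "1::real"] by eventually_elim (simp add: post_mean_def)
  ultimately show ?thesis
    using Z0_1_pos[of ?d] by (simp add: tendsto_cong post_mean_def)
qed

lemma post_scale_tendsto: "((\<lambda>q. post_scale q H \<beta>) \<longlongrightarrow> post_scale 1 H \<beta>) (at_right 1)"
  for H :: "real^'d^'m"
proof -
  let ?d = "CARD('d)"
  have "((\<lambda>q. 1 - inverse (nu ?d q) * (norm (post_mean q H \<beta>))\<^sup>2) \<longlongrightarrow>
          1 - 0 * (norm (post_mean 1 H \<beta>))\<^sup>2) (at_right 1)"
    by (intro tendsto_intros post_mean_tendsto tendsto_inverse_0_at_top nu_at_top)
  moreover have "\<forall>\<^sub>F q in at_right 1.
      1 - inverse (nu ?d q) * (norm (post_mean q H \<beta>))\<^sup>2 = post_scale q H \<beta>"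
    using eventually_at_right_less[of "1::real"]
    by eventually_elim (simp add: post_scale_def divide_inverse)
  ultimately show ?thesis by (simp add: tendsto_cong post_scale_def)
qed

lemma posterior_tendsto: "((\<lambda>q. posterior q H \<beta> w) \<longlongrightarrow> posterior 1 H \<beta> w) (at_right 1)"
  for H :: "real^'d^'m"
proof -
  let ?d = "CARD('d)"
  let ?m = "\<lambda>q. post_mean q H \<beta>" and ?c = "\<lambda>q. post_scale q H \<beta>"
  have c1: "?c 1 = 1" by (simp add: post_scale_def)
  have "((\<lambda>q. (norm (w - ?m q))\<^sup>2 / ?c q) \<longlongrightarrow> (norm (w - ?m 1))\<^sup>2 / ?c 1) (at_right 1)"
    by (intro tendsto_intros post_mean_tendsto post_scale_tendsto) (simp add: c1)
  hence s: "((\<lambda>q. (1 + ((norm (w - ?m q))\<^sup>2 / ?c q) / nu ?d q) powr (- ((nu ?d q + real ?d) / 2))) \<longlongrightarrow>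
           exp (- ((norm (w - ?m 1))\<^sup>2 / 2))) (at_right 1)"
    unfolding c1 by (intro student_tendsto nu_at_top) simp
  have "((\<lambda>q. 1 / (Z0 ?d q * ?c q powr (real ?d / 2)) *
           (1 + ((norm (w - ?m q))\<^sup>2 / ?c q) / nu ?d q) powr (- ((nu ?d q + real ?d) / 2))) \<longlongrightarrow>
         1 / (Z0 ?d 1 * ?c 1 powr (real ?d / 2)) * exp (- ((norm (w - ?m 1))\<^sup>2 / 2))) (at_right 1)"
    using Z0_1_pos[of ?d] by (intro tendsto_intros Z0_tendsto post_scale_tendsto s) (auto simp: c1)
  moreover have "\<forall>\<^sub>F q in at_right 1. 1 / (Z0 ?d q * ?c q powr (real ?d / 2)) *
           (1 + ((norm (w - ?m q))\<^sup>2 / ?c q) / nu ?d q) powr (- ((nu ?d q + real ?d) / 2)) =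
         posterior q H \<beta> w"
    using eventually_at_right_less[of "1::real"]
    by eventually_elim (simp add: posterior_def Let_def mult.commute)
  ultimately have "((\<lambda>q. posterior q H \<beta> w) \<longlongrightarrow>
      1 / (Z0 ?d 1 * ?c 1 powr (real ?d / 2)) * exp (- ((norm (w - ?m 1))\<^sup>2 / 2))) (at_right 1)"
    by (rule Lim_transform_eventually)
  thus ?thesis by (simp add: posterior_def Let_def)
qed

end

theory Submission
  imports Defs "HOL-Probability.Distributions"
begin

text \<open>
  The Lagrangian is the sum of a function of the density \<open>p\<close> and a function of \<open>z\<close>. With
  \<open>h = H\<^sup>T \<beta>\<close>, completing the square turns \<open>prior powr (1 - q) - (q - 1) * (h \<bullet> w)\<close> into
  \<open>c powr r * posterior powr (1 - q)\<close> if \<open>c > 0\<close>. Hence, for a suitable \<open>\<kappa>\<close>, the density part is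
  its dual value plus a positive multiple of a Bregman divergence between \<open>p\<close> and the posterior,
  which is nonnegative and vanishes only for \<open>p = posterior\<close>. If \<open>c < 0\<close>, or \<open>c = 0\<close> and \<open>\<kappa> > 0\<close>, then
  multiples of indicators of balls around \<open>\<mu>\<close> make it tend to \<open>-\<infinity>\<close>. The infimum over \<open>z\<close> is the
  conjugate of the loss, computed by Young's inequality.

  The dual function attains its maximum by compactness, necessarily with \<open>c > 0\<close>. Since minus the
  moments \<open>z\<close> of the posterior form a supergradient of the density part of the dual, which is
  differentiable along lines, maximality of \<open>\<beta>\<close> makes \<open>z\<close> a subgradient of the loss conjugate; so
  \<open>(posterior, z)\<close> minimizes the Lagrangian and all claims follow from this saddle point.
\<close>

subsection \<open>Gaussian and Student-t integrals\<close>

text \<open>Since the moments contain \<open>p powr q\<close>, the equality constraints are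
  nonlinear in p and the feasible set need not be convex; no general strong duality is invoked, and
  the saddle point is built by hand. This is possible because the same power occurs in the
  divergence: for q > 1 both combine into one integral of \<open>p powr q\<close> against a weight
  quadratic in w, a positive multiple of c + |w - \<mu>|^2 / \<nu>. So the sign of c decides
  everything: for c > 0 the weight is positive, for c = 0 it vanishes only at \<mu>, for c < 0 it is
  negative near \<mu>. For q = 1, c is constantly 1 and only the first case occurs. The delicate
  case is c = 0. It belongs to the dual domain and the dual value there is finite, although the
  formula of the posterior degenerates. It has to be evaluated separately, and then excluded both
  for maximizers and for multipliers of a solution. On the loss side, the infimum over z may not be
  attained (q' = 1 and a zero multiplier), and its value, as a function of the multiplier, lives on
  a set with boundary. Hence the \<epsilon>-arguments and the one-sided difference
  quotients.\<close>

lemma nn_integral_gaussian: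
  fixes t :: real
  assumes "t > 0"
  shows "(\<integral>\<^sup>+w. ennreal (exp (- (t * (norm (w :: 'a :: euclidean_space))\<^sup>2))) \<partial>lborel) =
    ennreal ((pi / t) powr (DIM('a) / 2))"
proof -
  have one: "(\<integral>\<^sup>+x. ennreal (exp (- (t * (x::real)\<^sup>2))) \<partial>lborel) = ennreal (sqrt (pi / t))"
  proof -
    define \<sigma> where "\<sigma> = sqrt (1 / (2 * t))"
    have s: "\<sigma> > 0" "\<sigma>\<^sup>2 = 1 / (2 * t)" using assms by (auto simp: \<sigma>_def)
    have "exp (- (t * x\<^sup>2)) = sqrt (pi / t) * normal_density 0 \<sigma> x" for x
      using assms by (simp add: normal_density_def s real_sqrt_divide real_sqrt_mult field_simps)
    moreover have "(\<integral>\<^sup>+x. ennreal (normal_density 0 \<sigma> x) \<partial>lborel) = 1"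
      using s by (subst nn_integral_eq_integral) auto
    ultimately show ?thesis
      using assms s by (simp add: ennreal_mult nn_integral_cmult)
  qed
  have "(\<integral>\<^sup>+(w::'a). ennreal (exp (- (t * (norm w)\<^sup>2))) \<partial>lborel) =
        (\<integral>\<^sup>+(w::'a). (\<Prod>b\<in>Basis. ennreal (exp (- (t * (w \<bullet> b)\<^sup>2)))) \<partial>lborel)"
  proof (intro nn_integral_cong)
    fix w :: 'a
    have "(norm w)\<^sup>2 = (\<Sum>b\<in>Basis. (w \<bullet> b)\<^sup>2)"
      unfolding power2_norm_eq_inner by (subst euclidean_inner) (simp add: power2_eq_square)
    thus "ennreal (exp (- (t * (norm w)\<^sup>2))) = (\<Prod>b\<in>Basis. ennreal (exp (- (t * (w \<bullet> b)\<^sup>2))))"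
      by (simp add: prod_ennreal sum_distrib_left exp_sum flip: sum_negf)
  qed
  also have "\<dots> = ennreal (sqrt (pi / t)) ^ DIM('a)"
    by (subst nn_integral_lborel_prod) (auto simp: one)
  also have "\<dots> = ennreal ((pi / t) powr (DIM('a) / 2))"
    using assms by (simp add: ennreal_power powr_half_sqrt [symmetric] powr_power)
  finally show ?thesis .
qed

text \<open>
  The Student-t density is a Gamma mixture of Gaussians, as
  \<open>\<Gamma>(a) * x powr -a = \<integral>t. t powr (a - 1) * exp (- t * x)\<close>.
\<close>
lemma nn_integral_student:
  fixes \<nu> a :: real
  assumes \<nu>: "\<nu> > 0" and a: "a > DIM('a) / 2"
  shows "(\<integral>\<^sup>+w. ennreal ((1 + (norm (w :: 'a :: euclidean_space))\<^sup>2 / \<nu>) powr (- a)) \<partial>lborel) =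
    ennreal (Gamma (a - DIM('a) / 2) * (pi * \<nu>) powr (DIM('a) / 2) / Gamma a)"
proof -
  have a0: "a > 0" using a by (smt (verit) divide_nonneg_nonneg of_nat_0_le_iff)
  have Ga: "Gamma a > 0" using a0 by (rule Gamma_real_pos)
  let ?g = "\<lambda>t. indicator {0<..} t * t powr (a - 1)"
  \<comment> \<open>The Gamma integral with x * t substituted for t. At t = 0 the factor
    \<open>t powr (s - 1)\<close> is 0 by convention, so the open and the closed half line give the
    same integrand.\<close>
  have gam: "(\<integral>\<^sup>+t. ennreal (indicator {0<..} t * t powr (s - 1) * exp (- (t * x))) \<partial>lborel) = ennreal (Gamma s * x powr (- s))"
    if s: "s > 0" and x: "x > 0" for s x :: real
  proof -
    have "(\<integral>\<^sup>+t. ennreal (indicator {0..} t * t powr (s - 1) / exp t) \<partial>lborel) =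
          ennreal x * (\<integral>\<^sup>+t. ennreal (indicator {0..} (x * t) * (x * t) powr (s - 1) / exp (x * t)) \<partial>lborel)"
      using nn_integral_real_affine[of "\<lambda>t. ennreal (indicator {0..} t * t powr (s - 1) / exp t)" x 0] x
      by simp
    also have "(\<integral>\<^sup>+t. ennreal (indicator {0..} (x * t) * (x * t) powr (s - 1) / exp (x * t)) \<partial>lborel) =
       (\<integral>\<^sup>+t. ennreal (x powr (s - 1)) * ennreal (indicator {0<..} t * t powr (s - 1) * exp (- (t * x))) \<partial>lborel)"
    proof (intro nn_integral_cong)
      fix t :: real
      show "ennreal (indicator {0..} (x * t) * (x * t) powr (s - 1) / exp (x * t)) =
        ennreal (x powr (s - 1)) * ennreal (indicator {0<..} t * t powr (s - 1) * exp (- (t * x)))"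
        using x by (cases "t = 0"; cases "t > 0")
          (auto simp: powr_mult exp_minus field_simps zero_le_mult_iff simp flip: ennreal_mult')
    qed
    also have "\<dots> = ennreal (x powr (s - 1)) * (\<integral>\<^sup>+t. ennreal (indicator {0<..} t * t powr (s - 1) * exp (- (t * x))) \<partial>lborel)"
      by (rule nn_integral_cmult) simp
    finally have *: "ennreal (Gamma s) = ennreal (x powr s) *
        (\<integral>\<^sup>+t. ennreal (indicator {0<..} t * t powr (s - 1) * exp (- (t * x))) \<partial>lborel)"
      using x by (simp add: Gamma_conv_nn_integral_real[OF s] mult.assoc[symmetric]
          ennreal_mult'[symmetric] powr_diff)
    have "ennreal (x powr (- s)) * ennreal (Gamma s) =
       (\<integral>\<^sup>+t. ennreal (indicator {0<..} t * t powr (s - 1) * exp (- (t * x))) \<partial>lborel)"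
      unfolding * using x by (simp add: mult.assoc[symmetric] ennreal_mult'[symmetric] powr_minus)
    thus ?thesis using Gamma_real_pos[OF s] by (simp add: ennreal_mult'[symmetric] mult.commute)
  qed
  have pos: "1 + (norm (w::'a))\<^sup>2 / \<nu> > 0" for w
    using \<nu> by (intro add_pos_nonneg) auto
  have "ennreal (Gamma a) * (\<integral>\<^sup>+(w::'a). ennreal ((1 + (norm w)\<^sup>2 / \<nu>) powr (- a)) \<partial>lborel) =
        (\<integral>\<^sup>+(w::'a). \<integral>\<^sup>+t. ennreal (?g t * exp (- (t * (1 + (norm w)\<^sup>2 / \<nu>)))) \<partial>lborel \<partial>lborel)"
    using Ga by (subst nn_integral_cmult[symmetric])
      (auto intro!: nn_integral_cong simp: gam[OF a0 pos] simp flip: ennreal_mult')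
  also have "\<dots> = (\<integral>\<^sup>+t. \<integral>\<^sup>+(w::'a). ennreal (?g t * exp (- (t * (1 + (norm w)\<^sup>2 / \<nu>)))) \<partial>lborel \<partial>lborel)"
    by (rule lborel_pair.Fubini') measurable
  also have "\<dots> = (\<integral>\<^sup>+t. ennreal ((pi * \<nu>) powr (DIM('a) / 2)) *
      ennreal (indicator {0<..} t * t powr ((a - DIM('a) / 2) - 1) * exp (- (t * 1))) \<partial>lborel)"
  proof (intro nn_integral_cong)
    fix t :: real
    show "(\<integral>\<^sup>+(w::'a). ennreal (?g t * exp (- (t * (1 + (norm w)\<^sup>2 / \<nu>)))) \<partial>lborel) =
      ennreal ((pi * \<nu>) powr (DIM('a) / 2)) *
      ennreal (indicator {0<..} t * t powr ((a - DIM('a) / 2) - 1) * exp (- (t * 1)))"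
    proof (cases "t > 0")
      case True
      have "(\<integral>\<^sup>+(w::'a). ennreal (?g t * exp (- (t * (1 + (norm w)\<^sup>2 / \<nu>)))) \<partial>lborel) =
            (\<integral>\<^sup>+(w::'a). ennreal (t powr (a - 1) * exp (- t)) * ennreal (exp (- ((t / \<nu>) * (norm w)\<^sup>2))) \<partial>lborel)"
      proof (intro nn_integral_cong)
        fix w :: 'a
        have "exp (- (t * (1 + (norm w)\<^sup>2 / \<nu>))) = exp (- t) * exp (- ((t / \<nu>) * (norm w)\<^sup>2))"
          by (simp add: mult_exp_exp distrib_left)
        thus "ennreal (?g t * exp (- (t * (1 + (norm w)\<^sup>2 / \<nu>)))) =
              ennreal (t powr (a - 1) * exp (- t)) * ennreal (exp (- ((t / \<nu>) * (norm w)\<^sup>2)))"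
          using True by (simp only: ennreal_mult'[symmetric] exp_ge_zero powr_ge_zero mult_nonneg_nonneg) simp
      qed
      also have "\<dots> = ennreal (t powr (a - 1) * exp (- t)) * ennreal ((pi / (t / \<nu>)) powr (DIM('a) / 2))"
        by (subst nn_integral_cmult, measurable) (subst nn_integral_gaussian, use True \<nu> in simp_all)
      \<comment> \<open>The Gaussian integral contributes \<open>t powr (- (DIM('a) / 2))\<close>,
        which lowers the Gamma parameter from a to \<open>a - DIM('a) / 2\<close>; the hypothesis on
        a keeps it positive.\<close>
      also have "(pi / (t / \<nu>)) powr (DIM('a) / 2) = (pi * \<nu>) powr (DIM('a) / 2) * t powr (- (DIM('a) / 2))"
        using True \<nu> by (simp add: powr_divide powr_minus field_simps)
      also have "ennreal (t powr (a - 1) * exp (- t)) * ennreal ((pi * \<nu>) powr (DIM('a) / 2) * t powr (- (DIM('a) / 2)))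
        = ennreal ((pi * \<nu>) powr (DIM('a) / 2) * ((t powr (a - 1) * t powr (- (DIM('a) / 2))) * exp (- t)))"
        by (simp only: ennreal_mult'[symmetric] exp_ge_zero powr_ge_zero mult_nonneg_nonneg mult_ac)
      also have "t powr (a - 1) * t powr (- (DIM('a) / 2)) = t powr ((a - DIM('a) / 2) - 1)"
        by (simp only: powr_add[symmetric]) (simp add: algebra_simps)
      finally show ?thesis using True by (simp add: ennreal_mult'[symmetric])
    qed auto
  qed
  also have "\<dots> = ennreal ((pi * \<nu>) powr (DIM('a) / 2)) * ennreal (Gamma (a - DIM('a) / 2))"
    using gam[of "a - DIM('a) / 2" 1] a by (subst nn_integral_cmult) auto
  finally have *: "ennreal (Gamma a) * (\<integral>\<^sup>+(w::'a). ennreal ((1 + (norm w)\<^sup>2 / \<nu>) powr (- a)) \<partial>lborel) =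
    ennreal ((pi * \<nu>) powr (DIM('a) / 2)) * ennreal (Gamma (a - DIM('a) / 2))" .
  have "(\<integral>\<^sup>+(w::'a). ennreal ((1 + (norm w)\<^sup>2 / \<nu>) powr (- a)) \<partial>lborel) =
     ennreal (inverse (Gamma a)) * (ennreal (Gamma a) * (\<integral>\<^sup>+(w::'a). ennreal ((1 + (norm w)\<^sup>2 / \<nu>) powr (- a)) \<partial>lborel))"
    using Ga by (simp add: mult.assoc[symmetric] ennreal_mult'[symmetric])
  also note *
  also have "ennreal (inverse (Gamma a)) * (ennreal ((pi * \<nu>) powr (DIM('a) / 2)) * ennreal (Gamma (a - DIM('a) / 2))) =
     ennreal (Gamma (a - DIM('a) / 2) * (pi * \<nu>) powr (DIM('a) / 2) / Gamma a)"
    using Ga by (simp add: ennreal_mult'[symmetric] field_simps)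
  finally show ?thesis .
qed

lemma nn_integral_lborel_shift_scale:
  fixes f :: "'a :: euclidean_space \<Rightarrow> ennreal"
  assumes [measurable]: "f \<in> borel_measurable borel" and s: "s > 0"
  shows "(\<integral>\<^sup>+w. f ((w - \<mu>) /\<^sub>R s) \<partial>lborel) = ennreal (s ^ DIM('a)) * (\<integral>\<^sup>+w. f w \<partial>lborel)"
proof -
  have "(\<integral>\<^sup>+w. f ((w - \<mu>) /\<^sub>R s) \<partial>lborel) =
    (\<integral>\<^sup>+w. f ((w - \<mu>) /\<^sub>R s) \<partial>density (distr lborel borel (\<lambda>x. \<mu> + s *\<^sub>R x)) (\<lambda>_. ennreal (\<bar>s\<bar> ^ DIM('a))))"
    using s by (subst lborel_affine[of s \<mu>]) auto
  also have "\<dots> = ennreal (s ^ DIM('a)) * (\<integral>\<^sup>+w. f w \<partial>lborel)"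
    using s by (simp add: nn_integral_density nn_integral_distr nn_integral_cmult)
  finally show ?thesis .
qed

subsection \<open>Pointwise divergence, prior and posterior\<close>

text \<open>The gap at p between the convex function
  \<open>p powr q * t powr (1 - q) / (q - 1)\<close> of p and its tangent at t; for q = 1 the
  function is \<open>p * ln (p / t)\<close>. It is used both between densities and, with t = 1 and
  order 1 / q', as a summand of the dual loss.\<close>

definition bregman :: "real \<Rightarrow> real \<Rightarrow> real \<Rightarrow> real" where
  "bregman q p t =
    (if q = 1 then p * ln (p / t) - p + t
     else (p powr q * t powr (1 - q) - q * p + (q - 1) * t) / (q - 1))"

text \<open>Everything rests on ln u < u - 1 for u \<noteq> 1: it gives
  \<open>p * ln (p / t) > p - t\<close>, and for q > 1 the bound exp s \<ge> 1 + s at s = (q - 1) *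
  ln (p / t) carries this over. At p = 0 the value is t, because \<open>0 * ln 0\<close> and
  \<open>0 powr q\<close> are 0.\<close>

lemma bregman_nonneg_eq_0_iff:
  assumes q: "q \<ge> 1" and p: "p \<ge> 0" and t: "t > 0"
  shows "bregman q p t \<ge> 0" and "bregman q p t = 0 \<longleftrightarrow> p = t"
proof -
  have "bregman q p t > 0" if "p \<noteq> t"
  proof (cases "p = 0")
    case True
    thus ?thesis using q t by (auto simp: bregman_def)
  next
    case False
    hence p: "p > 0" using p by simp
    have ln: "p * ln (p / t) > p - t"
    proof -
      have "ln (t / p) \<le> t / p - 1" "ln (t / p) = t / p - 1 \<longrightarrow> t / p = 1"
        using p t ln_le_minus_one[of "t / p"] ln_eq_minus_one[of "t / p"] by auto
      hence "ln (t / p) < t / p - 1" using that p by fastforce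
      hence "p * ln (t / p) < p * (t / p - 1)" using p by (simp only: mult_less_cancel_left_pos)
      thus ?thesis using p t by (simp add: ln_div algebra_simps)
    qed
    show ?thesis
    proof (cases "q = 1")
      case True
      thus ?thesis using ln by (simp add: bregman_def)
    next
      case False
      have "p + (q - 1) * (p - t) < p * (1 + (q - 1) * ln (p / t))"
        using ln False q mult_strict_left_mono[OF ln, of "q - 1"] by (simp add: algebra_simps)
      also have "\<dots> \<le> p * exp ((q - 1) * ln (p / t))"
        using p by (intro mult_left_mono exp_ge_add_one_self) auto
      also have "\<dots> = p powr q * t powr (1 - q)"
        using p t by (simp add: powr_def ln_div algebra_simps flip: exp_add)
          (simp add: exp_diff exp_add algebra_simps exp_minus divide_simps)
      finally show ?thesis using False q by (simp add: bregman_def algebra_simps)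
    qed
  qed
  moreover have "bregman q t t = 0"
  proof -
    have "t powr q * t powr (1 - q) = t" using t by (simp flip: powr_add)
    thus ?thesis using t by (simp add: bregman_def algebra_simps)
  qed
  ultimately show "bregman q p t \<ge> 0" "bregman q p t = 0 \<longleftrightarrow> p = t"
    by (metis less_eq_real_def, metis less_irrefl)
qed

text \<open>The upper bound on q says d * (q - 1) < 2. It is what makes the Student-t kernel
  integrable: \<open>Z0\<close> evaluates Gamma at \<nu> / 2.\<close>

lemma nu_pos:
  assumes "1 < q" "q < (2 + real d) / real d" "d > 0"
  shows "nu d q > 0"
proof -
  have "real d * (q - 1) < 2" using assms by (simp add: field_simps)
  thus ?thesis using assms by (simp add: nu_def field_simps)
qed

lemma nu_eq:
  assumes "1 < q"
  shows "(nu d q + real d) / 2 = 1 / (q - 1)" "nu d q = (2 - real d * (q - 1)) / (q - 1)"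
    "nu d q / 2 = 1 / (q - 1) - real d / 2" "nu d q + real d = 2 / (q - 1)"
  using assms by (simp_all add: nu_def field_simps)

lemma Z0_eq:
  assumes "1 < q"
  shows "Z0 d q = Gamma (1 / (q - 1) - real d / 2) * (pi * nu d q) powr (real d / 2) / Gamma (1 / (q - 1))"
proof -
  have "(2 - real d * (q - 1)) / (2 * (q - 1)) = 1 / (q - 1) - real d / 2"
    using assms by (simp add: field_simps)
  thus ?thesis using assms by (simp add: Z0_def nu_eq(2) mult.commute)
qed

lemma Z0_pos:
  assumes "1 \<le> q" "q < (2 + real d) / real d" "d > 0"
  shows "Z0 d q > 0"
proof (cases "q = 1")
  case False
  with assms have "q > 1" by simp
  with nu_pos[OF this assms(2,3)] show ?thesis
    by (auto simp: Z0_eq nu_eq(3)[symmetric] intro!: divide_pos_pos mult_pos_pos Gamma_real_pos)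
qed (simp add: Z0_1_pos)

text \<open>r > 0 makes \<open>c powr r\<close> continuous down to c = 0, which is needed for the
  existence of a dual maximum; r < 1 gives it infinite slope there, which keeps the maximum away
  from c = 0.\<close>

lemma dual_exponent_bounds:
  assumes "1 < q" "q < (2 + real d) / real d" "d > 0"
  shows "0 < dual_exponent d q" "dual_exponent d q < 1"
proof -
  have "real d * (q - 1) < 2" "real d * (q - 1) > 0" using assms by (simp_all add: field_simps)
  thus "0 < dual_exponent d q" "dual_exponent d q < 1"
    by (simp_all add: dual_exponent_def algebra_simps)
qed

lemma posterior_alt:
  fixes H :: "real^'d^'m"
  assumes "q > 1"
  shows "posterior q H \<beta> w = 1 / (Z0 CARD('d) q * post_scale q H \<beta> powr (CARD('d) / 2)) *
    (1 + (norm (w - post_mean q H \<beta>))\<^sup>2 / (nu CARD('d) q * post_scale q H \<beta>)) powr (- (1 / (q - 1)))"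
  using assms unfolding posterior_def Let_def nu_eq(1)[OF assms] by simp

lemma prior_alt:
  assumes "q > 1"
  shows "prior q (w :: real^'d) =
    1 / Z0 CARD('d) q * (1 + (norm w)\<^sup>2 / nu CARD('d) q) powr (- (1 / (q - 1)))"
proof -
  have "(q - 1) / (2 - real CARD('d) * (q - 1)) * (norm w)\<^sup>2 = (norm w)\<^sup>2 / nu CARD('d) q"
    by (simp add: nu_eq(2)[OF assms])
  moreover have "1 / (1 - q) = - (1 / (q - 1))" using assms by (simp add: field_simps)
  ultimately show ?thesis using assms by (simp add: prior_def)
qed

lemma posterior_1: "posterior 1 (H :: real^'d^'m) \<beta> w =
    1 / Z0 CARD('d) 1 * exp (- ((norm (w - transpose H *v \<beta>))\<^sup>2 / 2))"
  by (simp add: posterior_def Let_def post_scale_def post_mean_def)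

lemma posterior_measurable [measurable]: "posterior q (H :: real^'d^'m) \<beta> \<in> borel_measurable borel"
  unfolding posterior_def Let_def by measurable

lemma prior_measurable [measurable]: "(prior q :: real^'d \<Rightarrow> real) \<in> borel_measurable borel"
  unfolding prior_def by measurable

lemma has_bochner_integral_shifted_gaussian:
  "has_bochner_integral lborel (\<lambda>w. exp (- ((norm (w - \<mu> :: 'a :: euclidean_space))\<^sup>2 / 2)))
     ((2 * pi) powr (DIM('a) / 2))"
proof (rule has_bochner_integral_nn_integral)
  have "(\<integral>\<^sup>+(w::'a). ennreal (exp (- ((norm (w - \<mu>))\<^sup>2 / 2))) \<partial>lborel) =
        (\<integral>\<^sup>+(w::'a). ennreal (exp (- (1 / 2 * (norm w)\<^sup>2))) \<partial>lborel)"
    using nn_integral_lborel_shift_scale[of "\<lambda>w::'a. ennreal (exp (- (1 / 2 * (norm w)\<^sup>2)))" 1 \<mu>] by simp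
  also have "\<dots> = ennreal ((2 * pi) powr (DIM('a) / 2))"
    by (subst nn_integral_gaussian) (simp_all add: mult.commute)
  finally show "(\<integral>\<^sup>+(w::'a). ennreal (exp (- ((norm (w - \<mu>))\<^sup>2 / 2))) \<partial>lborel) = ennreal ((2 * pi) powr (DIM('a) / 2))" .
qed auto

context
  fixes q :: real and H :: "real^'d^'m" and \<beta> :: "real^'m"
  assumes q: "1 \<le> q" "q < (2 + real CARD('d)) / real CARD('d)"
begin

lemma prior_pos: "prior q (w :: real^'d) > 0"
proof (cases "q = 1")
  case False
  hence q1: "q > 1" using q by simp
  have "1 + (norm w)\<^sup>2 / nu CARD('d) q > 0"
    using nu_pos[OF q1 q(2)] by (intro add_pos_nonneg) auto
  thus ?thesis using Z0_pos[OF q] by (simp add: prior_alt[OF q1])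
qed (simp add: prior_def Z0_1_pos)

lemma posterior_pos:
  assumes c: "post_scale q H \<beta> > 0"
  shows "posterior q H \<beta> w > 0"
proof (cases "q = 1")
  case False
  hence q1: "q > 1" using q by simp
  have "1 + (norm (w - post_mean q H \<beta>))\<^sup>2 / (nu CARD('d) q * post_scale q H \<beta>) > 0"
    using nu_pos[OF q1 q(2)] c by (intro add_pos_nonneg) auto
  thus ?thesis using q1 Z0_pos[OF q] c by (simp add: posterior_alt)
qed (simp add: posterior_1 Z0_1_pos)

text \<open>Shifting by \<mu> and scaling by sqrt c reduces the integral to the kernel of the prior:
  \<open>c powr (d / 2)\<close> is the Jacobian, and \<open>Z0\<close> is the value of
  \<open>nn_integral_student\<close> at a = 1 / (q - 1), where a - d / 2 = \<nu> / 2.\<close>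

lemma posterior_has_integral:
  assumes c: "post_scale q H \<beta> > 0"
  shows "has_bochner_integral lborel (posterior q H \<beta>) 1"
proof (cases "q = 1")
  case True
  show ?thesis
    using has_bochner_integral_divide_zero[OF has_bochner_integral_shifted_gaussian[of "transpose H *v \<beta>"],
        of "Z0 CARD('d) 1"] Z0_1_pos[of "CARD('d)"]
    unfolding True by (simp add: posterior_1[abs_def] Z0_def)
next
  case False
  hence q1: "q > 1" using q by simp
  note Z = Z0_pos[OF q] and \<nu> = nu_pos[OF q1 q(2)]
  let ?\<nu> = "nu CARD('d) q" and ?c = "post_scale q H \<beta>" and ?a = "1 / (q - 1)" and ?d = "CARD('d)"
  let ?f = "\<lambda>u::real^'d. ennreal ((1 + (norm u)\<^sup>2 / ?\<nu>) powr (- ?a))"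
  let ?K = "1 / (Z0 ?d q * ?c powr (?d / 2))"
  have K: "?K > 0" using Z c by simp
  have "(\<integral>\<^sup>+w. ennreal (posterior q H \<beta> w) \<partial>lborel) =
        (\<integral>\<^sup>+w. ennreal ?K * ?f ((w - post_mean q H \<beta>) /\<^sub>R sqrt ?c) \<partial>lborel)"
  proof (intro nn_integral_cong)
    fix w :: "real^'d"
    have "(norm (w - post_mean q H \<beta>))\<^sup>2 / (?\<nu> * ?c) = (norm ((w - post_mean q H \<beta>) /\<^sub>R sqrt ?c))\<^sup>2 / ?\<nu>"
      unfolding norm_scaleR power_mult_distrib using c by (simp add: power_inverse field_simps)
    thus "ennreal (posterior q H \<beta> w) = ennreal ?K * ?f ((w - post_mean q H \<beta>) /\<^sub>R sqrt ?c)"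
      using K by (simp only: posterior_alt[OF q1] ennreal_mult')
  qed
  also have "\<dots> = ennreal ?K * (\<integral>\<^sup>+w. ?f ((w - post_mean q H \<beta>) /\<^sub>R sqrt ?c) \<partial>lborel)"
    by (rule nn_integral_cmult) measurable
  also have "\<dots> = ennreal ?K * (ennreal (sqrt ?c ^ ?d) * (\<integral>\<^sup>+w. ?f w \<partial>lborel))"
    using nn_integral_lborel_shift_scale[of ?f "sqrt ?c" "post_mean q H \<beta>"] c by simp
  also have "(\<integral>\<^sup>+w. ?f w \<partial>lborel) = ennreal (Z0 ?d q)"
    using nn_integral_student[of ?\<nu> ?a, where 'a = "real^'d"] \<nu> nu_eq(3)[OF q1, of ?d]
    by (simp add: Z0_eq[OF q1])
  also have "ennreal ?K * (ennreal (sqrt ?c ^ ?d) * ennreal (Z0 ?d q)) = ennreal (?K * (sqrt ?c ^ ?d * Z0 ?d q))"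
    using K Z c by (simp only: ennreal_mult' less_imp_le zero_le_power real_sqrt_ge_zero)
  also have "sqrt ?c ^ ?d = ?c powr (?d / 2)"
    using c by (simp add: powr_half_sqrt [symmetric] powr_power)
  also have "?K * (?c powr (?d / 2) * Z0 ?d q) = 1" using c Z by simp
  finally show ?thesis
    using posterior_pos[OF c] by (intro has_bochner_integral_nn_integral) (auto intro: less_imp_le)
qed

end

subsection \<open>The divergence to the prior in terms of the posterior\<close>

text \<open>The dual value of the density part: minus the \<open>ln_q\<close> term of the dual
  objective, written in terms of c so that c = 0 is covered.\<close>

definition prior_dual :: "real \<Rightarrow> real^'d^'m \<Rightarrow> real^'m \<Rightarrow> real" where
  "prior_dual q H \<beta> =
    (if q = 1 then - ((norm (transpose H *v \<beta>))\<^sup>2 / 2)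
     else (post_scale q H \<beta> powr dual_exponent CARD('d) q - 1) / (q - 1))"

text \<open>An infinite divergence is sent to 0 by \<open>real_of_ereal\<close>; bounds on this
  number are therefore stated for finite divergence.\<close>

abbreviation tsallis_val :: "real \<Rightarrow> (real^'d \<Rightarrow> real) \<Rightarrow> real" where
  "tsallis_val q p \<equiv> real_of_ereal (tsallis_div q p (prior q))"

text \<open>Dominates linear functions of w by the quadratic weight belonging to the posterior. In K
  the first summand absorbs the constants into c, the second one the factor 1 / \<nu>.\<close>

lemma norm_sq_le_shifted:
  fixes \<mu> :: "'a :: real_inner" and \<nu> c :: real
  assumes "\<nu> > 0" "c > 0"
  obtains K where "K > 0" "\<And>w. 1 + (norm w)\<^sup>2 \<le> K * (c + (norm (w - \<mu>))\<^sup>2 / \<nu>)"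
proof
  define K where "K = (1 + 2 * (norm \<mu>)\<^sup>2) / c + 2 * \<nu>"
  have K: "K \<ge> (1 + 2 * (norm \<mu>)\<^sup>2) / c" "K \<ge> 2 * \<nu>" using assms by (auto simp: K_def)
  show "K > 0" using K assms by linarith
  fix w :: 'a
  have "norm w \<le> norm (w - \<mu>) + norm \<mu>" using norm_triangle_ineq[of "w - \<mu>" \<mu>] by simp
  hence "(norm w)\<^sup>2 \<le> (norm (w - \<mu>) + norm \<mu>)\<^sup>2" by (intro power_mono) auto
  also have "\<dots> \<le> 2 * (norm (w - \<mu>))\<^sup>2 + 2 * (norm \<mu>)\<^sup>2"
    using zero_le_power2[of "norm (w - \<mu>) - norm \<mu>"] by (simp add: power2_eq_square algebra_simps)
  finally have "1 + (norm w)\<^sup>2 \<le> (1 + 2 * (norm \<mu>)\<^sup>2) / c * c + 2 * \<nu> * ((norm (w - \<mu>))\<^sup>2 / \<nu>)"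
    using assms by simp
  also have "\<dots> \<le> K * c + K * ((norm (w - \<mu>))\<^sup>2 / \<nu>)"
    using assms K by (intro add_mono mult_right_mono) auto
  finally show "1 + (norm w)\<^sup>2 \<le> K * (c + (norm (w - \<mu>))\<^sup>2 / \<nu>)" by (simp add: distrib_left)
qed

lemma post_mean_alt:
  fixes H :: "real^'d^'m"
  assumes "q > 1"
  shows "post_mean q H \<beta> =
    (nu CARD('d) q * (q - 1) / 2 * Z0 CARD('d) q powr (1 - q)) *\<^sub>R (transpose H *v \<beta>)"
proof -
  have *: "2 / (nu CARD('d) q + real CARD('d)) = q - 1" "nu CARD('d) q / (nu CARD('d) q + real CARD('d)) = nu CARD('d) q * (q - 1) / 2"
    unfolding nu_eq(4)[OF assms] using assms by simp_all
  show ?thesis using assms unfolding post_mean_def * by simp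
qed

lemma post_scale_nonpos_imp:
  assumes "1 \<le> q" "post_scale q H \<beta> \<le> 0"
  shows "q > 1"
  using assms by (cases "q = 1") (auto simp: post_scale_def)

text \<open>|s| \<le> exp s + exp (- s), and a Gaussian multiplied by the exponential of a linear
  function is a multiple of a shifted Gaussian.\<close>

lemma inner_gaussian_integrable:
  fixes v \<mu> :: "'a :: euclidean_space"
  shows "integrable lborel (\<lambda>w. (v \<bullet> w) * exp (- ((norm (w - \<mu>))\<^sup>2 / 2)))"
proof (rule Bochner_Integration.integrable_bound)
  have tilt: "exp (u \<bullet> w) * exp (- ((norm (w - \<mu>))\<^sup>2 / 2)) =
      exp (u \<bullet> \<mu> + (norm u)\<^sup>2 / 2) * exp (- ((norm (w - (\<mu> + u)))\<^sup>2 / 2))" for u w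
    unfolding mult_exp_exp power2_norm_eq_inner
    by (rule arg_cong[where f = exp]) (simp add: algebra_simps inner_commute field_simps)
  have int: "integrable lborel (\<lambda>w. exp (u \<bullet> w) * exp (- ((norm (w - \<mu>))\<^sup>2 / 2)))" for u
    unfolding tilt using has_bochner_integral_shifted_gaussian[of "\<mu> + u"]
    by (intro integrable_mult_right) (auto simp: has_bochner_integral_iff)
  show "integrable lborel (\<lambda>w. exp (v \<bullet> w) * exp (- ((norm (w - \<mu>))\<^sup>2 / 2)) +
      exp ((- v) \<bullet> w) * exp (- ((norm (w - \<mu>))\<^sup>2 / 2)))"
    by (intro Bochner_Integration.integrable_add int)
  show "AE w in lborel. norm ((v \<bullet> w) * exp (- ((norm (w - \<mu>))\<^sup>2 / 2))) \<le>
    norm (exp (v \<bullet> w) * exp (- ((norm (w - \<mu>))\<^sup>2 / 2)) + exp ((- v) \<bullet> w) * exp (- ((norm (w - \<mu>))\<^sup>2 / 2)))"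
  proof (rule AE_I2)
    fix w
    have "\<bar>v \<bullet> w\<bar> \<le> exp (v \<bullet> w) + exp ((- v) \<bullet> w)"
      using exp_ge_add_one_self[of "v \<bullet> w"] exp_ge_add_one_self[of "- (v \<bullet> w)"]
        exp_ge_zero[of "v \<bullet> w"] exp_ge_zero[of "- (v \<bullet> w)"]
      unfolding inner_minus_left by linarith
    hence "\<bar>v \<bullet> w\<bar> * exp (- ((norm (w - \<mu>))\<^sup>2 / 2)) \<le>
        (exp (v \<bullet> w) + exp ((- v) \<bullet> w)) * exp (- ((norm (w - \<mu>))\<^sup>2 / 2))"
      by (rule mult_right_mono) simp
    thus "norm ((v \<bullet> w) * exp (- ((norm (w - \<mu>))\<^sup>2 / 2))) \<le>
      norm (exp (v \<bullet> w) * exp (- ((norm (w - \<mu>))\<^sup>2 / 2)) + exp ((- v) \<bullet> w) * exp (- ((norm (w - \<mu>))\<^sup>2 / 2)))"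
      unfolding real_norm_def abs_mult abs_exp_cancel distrib_right[symmetric]
      by (subst (2) abs_of_nonneg) auto
  qed
qed measurable

context
  fixes q :: real and H :: "real^'d^'m" and \<beta> :: "real^'m"
  assumes q: "1 \<le> q" "q < (2 + real CARD('d)) / real CARD('d)"
begin

text \<open>With r = \<nu> * (q - 1) / 2, the quantity |\<mu>|^2 / \<nu> is (q - 1) times
  \<open>dual_arg\<close>. Thus the condition in \<open>dual_domain\<close> that the truncation be
  inactive reads c \<ge> 0.\<close>

lemma post_scale_eq_dual_arg: "1 + (1 - q) * dual_arg q H \<beta> = post_scale q H \<beta>"
proof (cases "q = 1")
  case False
  hence q1: "q > 1" using q by simp
  let ?\<nu> = "nu CARD('d) q" and ?Z = "Z0 CARD('d) q"
  have r: "dual_exponent CARD('d) q = ?\<nu> * (q - 1) / 2"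
    using q1 by (simp add: dual_exponent_def nu_def field_simps)
  have "(?Z powr (1 - q))\<^sup>2 = ?Z powr (2 * (1 - q))"
    by (simp add: power2_eq_square flip: powr_add)
  thus ?thesis using q1 nu_pos[OF q1 q(2)]
    unfolding dual_arg_def post_scale_def post_mean_alt[OF q1] r norm_scaleR power_mult_distrib power2_abs
    by (simp add: field_simps power2_eq_square)
qed (simp add: post_scale_def)

text \<open>For q > 1 and c > 0 the exponents simply multiply. At c = 0 every power is
  \<open>0 powr _ = 0\<close>, and both sides are 1 / (q - 1), the limit from the interior.\<close>

lemma ln_q_exp_q_dual_arg:
  assumes c: "post_scale q H \<beta> \<ge> 0"
  shows "ln_q q (exp_q q (dual_arg q H \<beta>) powr dual_exponent CARD('d) q) = - prior_dual q H \<beta>"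
proof (cases "q = 1")
  case True
  show ?thesis unfolding True
    using Z0_1_pos[of "CARD('d)"]
    by (simp add: ln_q_def exp_q_def prior_dual_def dual_arg_def dual_exponent_def)
next
  case False
  hence q1: "q > 1" using q by simp
  have "exp_q q (dual_arg q H \<beta>) = post_scale q H \<beta> powr (1 / (1 - q))"
    using False c unfolding exp_q_def post_scale_eq_dual_arg by simp
  hence "(exp_q q (dual_arg q H \<beta>) powr dual_exponent CARD('d) q) powr (1 - q) = post_scale q H \<beta> powr dual_exponent CARD('d) q"
    using q1 by (simp add: powr_powr)
  thus ?thesis using q1 unfolding ln_q_def prior_dual_def
    by (simp add: field_simps)
qed

text \<open>Matching the linear terms, 2 * (\<mu> \<bullet> w) / \<nu> = (q - 1) *
  \<open>Z0 powr (1 - q)\<close> * (h \<bullet> w) with h = H^T \<beta>, dictates the constant in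
  \<open>post_mean\<close>; c is what the square leaves over. As the posterior does not occur, the
  identity also serves for c \<le> 0.\<close>

lemma prior_tilt:
  assumes q1: "q > 1"
  shows "prior q w powr (1 - q) - (q - 1) * ((transpose H *v \<beta>) \<bullet> w) =
    Z0 CARD('d) q powr (q - 1) * (post_scale q H \<beta> + (norm (w - post_mean q H \<beta>))\<^sup>2 / nu CARD('d) q)"
proof -
  let ?\<nu> = "nu CARD('d) q" and ?Z = "Z0 CARD('d) q" and ?h = "transpose H *v \<beta>"
  define m where "m = post_mean q H \<beta>"
  note \<nu> = nu_pos[OF q1 q(2), simplified] and Z = Z0_pos[OF q, simplified]
  have pos: "1 + (norm w)\<^sup>2 / ?\<nu> > 0" using \<nu> by (intro add_pos_nonneg) auto
  have "prior q w powr (1 - q) = (1 / ?Z) powr (1 - q) * (1 + (norm w)\<^sup>2 / ?\<nu>) powr (- (1 / (q - 1)) * (1 - q))"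
    unfolding prior_alt[OF q1] by (simp only: powr_mult powr_powr)
  also have "- (1 / (q - 1)) * (1 - q) = 1" using q1 by (simp add: field_simps)
  also have "(1 / ?Z) powr (1 - q) = ?Z powr (q - 1)"
    using Z by (simp add: powr_divide powr_diff)
  also have "(1 + (norm w)\<^sup>2 / ?\<nu>) powr 1 = 1 + (norm w)\<^sup>2 / ?\<nu>" using pos by simp
  finally have P: "prior q w powr (1 - q) = ?Z powr (q - 1) * (1 + (norm w)\<^sup>2 / ?\<nu>)" .
  have "post_scale q H \<beta> + (norm (w - m))\<^sup>2 / ?\<nu> = 1 + (norm w)\<^sup>2 / ?\<nu> - 2 * (m \<bullet> w) / ?\<nu>"
    using q1 unfolding post_scale_def m_def[symmetric] power2_norm_eq_inner
    by (simp add: inner_commute algebra_simps diff_divide_distrib add_divide_distrib)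
  also have "2 * (m \<bullet> w) / ?\<nu> = (q - 1) * ?Z powr (1 - q) * (?h \<bullet> w)"
    using \<nu> by (simp add: m_def post_mean_alt[OF q1])
  finally have S: "post_scale q H \<beta> + (norm (w - m))\<^sup>2 / ?\<nu> = 1 + (norm w)\<^sup>2 / ?\<nu> - (q - 1) * ?Z powr (1 - q) * (?h \<bullet> w)" .
  have "?Z powr (q - 1) * ?Z powr (1 - q) = 1" using Z by (simp flip: powr_add)
  moreover have "?Z powr (q - 1) * ((q - 1) * ?Z powr (1 - q) * (?h \<bullet> w)) =
      (?Z powr (q - 1) * ?Z powr (1 - q)) * ((q - 1) * (?h \<bullet> w))" by simp
  ultimately have "?Z powr (q - 1) * ((q - 1) * ?Z powr (1 - q) * (?h \<bullet> w)) = (q - 1) * (?h \<bullet> w)" by simp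
  thus ?thesis unfolding P S m_def[symmetric] by (simp only: right_diff_distrib)
qed

text \<open>The exponent r originates here: the normalization \<open>c powr (d / 2)\<close> raised
  to 1 - q yields \<open>c powr (d / 2 * (q - 1))\<close>, and r + d / 2 * (q - 1) = 1, so
  \<open>c powr r\<close> restores one full factor c.\<close>

lemma posterior_powr:
  assumes q1: "q > 1" and c: "post_scale q H \<beta> > 0"
  shows "post_scale q H \<beta> powr dual_exponent CARD('d) q * posterior q H \<beta> w powr (1 - q) =
    Z0 CARD('d) q powr (q - 1) * (post_scale q H \<beta> + (norm (w - post_mean q H \<beta>))\<^sup>2 / nu CARD('d) q)"
proof -
  let ?\<nu> = "nu CARD('d) q" and ?Z = "Z0 CARD('d) q" and ?c = "post_scale q H \<beta>" and ?d = "real CARD('d)"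
  let ?n = "(norm (w - post_mean q H \<beta>))\<^sup>2"
  note \<nu> = nu_pos[OF q1 q(2), simplified] and Z = Z0_pos[OF q, simplified]
  have pos: "1 + ?n / (?\<nu> * ?c) > 0" using \<nu> c by (intro add_pos_nonneg) auto
  have "posterior q H \<beta> w powr (1 - q) =
     (1 / (?Z * ?c powr (?d / 2))) powr (1 - q) * (1 + ?n / (?\<nu> * ?c)) powr (- (1 / (q - 1)) * (1 - q))"
    unfolding posterior_alt[OF q1] by (simp only: powr_mult powr_powr)
  also have "- (1 / (q - 1)) * (1 - q) = 1" using q1 by (simp add: field_simps)
  also have "(1 + ?n / (?\<nu> * ?c)) powr 1 = 1 + ?n / (?\<nu> * ?c)" using pos by simp
  also have "(1 / (?Z * ?c powr (?d / 2))) powr (1 - q) = ?Z powr (q - 1) * ?c powr (?d / 2 * (q - 1))"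
  proof -
    have "(1 / X) powr (1 - q) = X powr (q - 1)" if "X > 0" for X :: real
      using that by (simp add: powr_divide powr_diff)
    from this[of "?Z * ?c powr (?d / 2)"] show ?thesis using Z c by (simp add: powr_mult powr_powr)
  qed
  finally have P: "posterior q H \<beta> w powr (1 - q) =
    ?Z powr (q - 1) * ?c powr (?d / 2 * (q - 1)) * (1 + ?n / (?\<nu> * ?c))" .
  have "dual_exponent CARD('d) q + ?d / 2 * (q - 1) = 1" by (simp add: dual_exponent_def field_simps)
  hence r: "?c powr dual_exponent CARD('d) q * ?c powr (?d / 2 * (q - 1)) = ?c" using c by (simp flip: powr_add)
  have "?c powr dual_exponent CARD('d) q * posterior q H \<beta> w powr (1 - q) =
      ?Z powr (q - 1) * ((?c powr dual_exponent CARD('d) q * ?c powr (?d / 2 * (q - 1))) * (1 + ?n / (?\<nu> * ?c)))"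
    unfolding P by (simp only: mult_ac)
  also note r
  also have "?c * (1 + ?n / (?\<nu> * ?c)) = ?c + ?n / ?\<nu>" using c by (simp add: field_simps)
  finally show ?thesis .
qed

lemma posterior_powr_q:
  assumes c: "post_scale q H \<beta> > 0"
  shows "posterior q H \<beta> w powr q * posterior q H \<beta> w powr (1 - q) = posterior q H \<beta> w"
  using posterior_pos[OF q c] by (simp add: less_imp_le flip: powr_add)

text \<open>The completed square of \<open>prior_tilt\<close> for q = 1, where the logarithm takes
  the place of the power 1 - q.\<close>

lemma posterior_1_tilt:
  assumes "q = 1"
  shows "ln (posterior q H \<beta> w) = ln (prior q w) + (transpose H *v \<beta>) \<bullet> w - (norm (transpose H *v \<beta>))\<^sup>2 / 2"
proof -
  define h where "h = transpose H *v \<beta>"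
  have "- ((norm (w - h))\<^sup>2 / 2) = - ((norm w)\<^sup>2 / 2) + h \<bullet> w - (norm h)\<^sup>2 / 2"
    unfolding power2_norm_eq_inner by (simp add: inner_commute algebra_simps field_simps)
  thus ?thesis using Z0_1_pos[of "CARD('d)"]
    unfolding assms posterior_1 h_def[symmetric] by (simp add: prior_def ln_mult_pos ln_div)
qed

text \<open>For q > 1, \<open>posterior_powr\<close> shows that the power q of the posterior times
  the quadratic weight is a multiple of the posterior itself, and this weight dominates v \<bullet>
  w. No integral beyond the normalization is computed.\<close>

lemma posterior_moment_integrable:
  assumes c: "post_scale q H \<beta> > 0"
  shows "integrable lborel (\<lambda>w. (v \<bullet> w) * posterior q H \<beta> w powr q)"
proof (cases "q = 1")
  case True
  have "integrable lborel (\<lambda>w. 1 / Z0 CARD('d) 1 * ((v \<bullet> w) * exp (- ((norm (w - transpose H *v \<beta>))\<^sup>2 / 2))))"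
    by (intro integrable_mult_right inner_gaussian_integrable)
  moreover have "(v \<bullet> w) * posterior q H \<beta> w powr q = 1 / Z0 CARD('d) 1 * ((v \<bullet> w) * exp (- ((norm (w - transpose H *v \<beta>))\<^sup>2 / 2)))" for w
    using posterior_pos[OF q c, of w] Z0_1_pos[of "CARD('d)"] unfolding True by (simp add: posterior_1)
  ultimately show ?thesis by simp
next
  case False
  hence q1: "q > 1" using q by simp
  let ?\<nu> = "nu CARD('d) q" and ?Z = "Z0 CARD('d) q" and ?c = "post_scale q H \<beta>" and ?p = "posterior q H \<beta>"
  let ?g = "\<lambda>w. ?c + (norm (w - post_mean q H \<beta>))\<^sup>2 / ?\<nu>"
  note \<nu> = nu_pos[OF q1 q(2), simplified] and Z = Z0_pos[OF q, simplified]
  obtain K where K: "K > 0" "\<And>w::real^'d. 1 + (norm w)\<^sup>2 \<le> K * ?g w"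
    using norm_sq_le_shifted[OF \<nu> c] by blast
  define L where "L = norm v * K * (?c powr dual_exponent CARD('d) q / ?Z powr (q - 1))"
  have g: "?p w powr q * ?g w = ?c powr dual_exponent CARD('d) q / ?Z powr (q - 1) * ?p w" for w
  proof -
    have "?p w powr q * ?g w = ?p w powr q * (?c powr dual_exponent CARD('d) q * ?p w powr (1 - q)) / ?Z powr (q - 1)"
      unfolding posterior_powr[OF q1 c] using Z by simp
    also have "\<dots> = ?c powr dual_exponent CARD('d) q / ?Z powr (q - 1) * (?p w powr q * ?p w powr (1 - q))" by simp
    finally show ?thesis unfolding posterior_powr_q[OF c] .
  qed
  show ?thesis
  proof (rule Bochner_Integration.integrable_bound)
    show "integrable lborel (\<lambda>w. L * ?p w)"
      using posterior_has_integral[OF q c] by (auto simp: has_bochner_integral_iff)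
    show "AE w in lborel. norm ((v \<bullet> w) * ?p w powr q) \<le> norm (L * ?p w)"
    proof (rule AE_I2)
      fix w
      have "\<bar>v \<bullet> w\<bar> \<le> norm v * norm w" by (rule Cauchy_Schwarz_ineq2)
      also have "norm w \<le> 1 + (norm w)\<^sup>2"
        using zero_le_power2[of "norm w - 1"] norm_ge_zero[of w] unfolding power2_diff one_power2 mult_1_right by linarith
      also have "\<dots> \<le> K * ?g w" by (rule K)
      finally have "\<bar>v \<bullet> w\<bar> \<le> norm v * (K * ?g w)" by (simp add: mult_left_mono)
      hence "\<bar>v \<bullet> w\<bar> * ?p w powr q \<le> norm v * (K * ?g w) * ?p w powr q" by (rule mult_right_mono) simp
      also have "\<dots> = norm v * K * (?p w powr q * ?g w)" by simp
      also have "\<dots> = L * ?p w" unfolding g L_def by simp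
      also have "\<dots> \<le> \<bar>L * ?p w\<bar>" by (rule abs_ge_self)
      finally show "norm ((v \<bullet> w) * ?p w powr q) \<le> norm (L * ?p w)" by (simp add: abs_mult)
    qed
  qed measurable
qed

text \<open>The tilt identities express the integrand of the divergence through the posterior and
  its moment along H^T \<beta>, both of which are integrable.\<close>

lemma posterior_tsallis_finite:
  assumes c: "post_scale q H \<beta> > 0"
  shows "tsallis_div q (posterior q H \<beta>) (prior q) \<noteq> \<infinity>"
proof -
  let ?p = "posterior q H \<beta>" and ?h = "transpose H *v \<beta>"
  have p: "integrable lborel ?p" using posterior_has_integral[OF q c] by (auto simp: has_bochner_integral_iff)
  note m = posterior_moment_integrable[OF c, of ?h]
  show ?thesis
  proof (cases "q = 1")
    case True
    have "?p w * ln (?p w / prior q w) = (?h \<bullet> w) * ?p w powr q - (norm ?h)\<^sup>2 / 2 * ?p w" for w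
    proof -
      have e: "ln (?p w / prior q w) = ?h \<bullet> w - (norm ?h)\<^sup>2 / 2"
        using posterior_pos[OF q c, of w] prior_pos[OF q, of w] posterior_1_tilt[OF True, of w] by (simp add: ln_div)
      show ?thesis unfolding e using posterior_pos[OF q c, of w] by (simp add: True algebra_simps)
    qed
    hence "integrable lborel (\<lambda>w. ?p w * ln (?p w / prior q w))" using p m by simp
    thus ?thesis by (simp add: tsallis_div_def True)
  next
    case False
    hence q1: "q > 1" using q by simp
    let ?k = "post_scale q H \<beta> powr dual_exponent CARD('d) q"
    have "?p w powr q * prior q w powr (1 - q) = ?k * ?p w + (q - 1) * ((?h \<bullet> w) * ?p w powr q)" for w
    proof -
      have "prior q w powr (1 - q) = ?k * ?p w powr (1 - q) + (q - 1) * (?h \<bullet> w)"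
        using prior_tilt[OF q1, of w] posterior_powr[OF q1 c, of w] by simp
      hence "?p w powr q * prior q w powr (1 - q) = ?p w powr q * (?k * ?p w powr (1 - q) + (q - 1) * (?h \<bullet> w))"
        by simp
      also have "\<dots> = ?k * (?p w powr q * ?p w powr (1 - q)) + (q - 1) * ((?h \<bullet> w) * ?p w powr q)"
        by (simp only: distrib_left mult_ac)
      also have "?p w powr q * ?p w powr (1 - q) = ?p w" by (rule posterior_powr_q[OF c])
      finally show ?thesis .
    qed
    hence "integrable lborel (\<lambda>w. ?p w powr q * prior q w powr (1 - q))" using p m by simp
    thus ?thesis using False by (simp add: tsallis_div_def)
  qed
qed

text \<open>K and \<kappa> depend on \<beta> only, and p need not be normalized. For q > 1, K =
  \<open>c powr r\<close> comes from \<open>posterior_powr\<close>, and \<kappa> = q * K / (q - 1)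
  matches the linear term - q * p / (q - 1) of K times \<open>bregman\<close>. The constants left
  over, - 1 / (q - 1) + \<kappa> - K, are \<open>prior_dual\<close>, as the posterior has mass
  1.\<close>

lemma bregman_identity:
  assumes c: "post_scale q H \<beta> > 0"
  obtains K \<kappa> where "K > 0" "\<And>p. (\<And>w. 0 \<le> p w) \<Longrightarrow> integrable lborel p \<Longrightarrow>
    integrable lborel (\<lambda>w. ((transpose H *v \<beta>) \<bullet> w) * p w powr q) \<Longrightarrow> tsallis_div q p (prior q) \<noteq> \<infinity> \<Longrightarrow>
    integrable lborel (\<lambda>w. bregman q (p w) (posterior q H \<beta> w)) \<and>
    tsallis_val q p - (\<integral>w. ((transpose H *v \<beta>) \<bullet> w) * p w powr q \<partial>lborel) + \<kappa> * (1 - (\<integral>w. p w \<partial>lborel)) =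
    prior_dual q H \<beta> + K * (\<integral>w. bregman q (p w) (posterior q H \<beta> w) \<partial>lborel)"
proof -
  let ?p = "posterior q H \<beta>" and ?h = "transpose H *v \<beta>"
  have P: "integrable lborel ?p" "(\<integral>w. ?p w \<partial>lborel) = 1"
    using posterior_has_integral[OF q c] by (auto simp: has_bochner_integral_iff)
  show thesis
  proof (cases "q = 1")
    case True
    show thesis
    proof (rule that[of 1 "1 - (norm ?h)\<^sup>2 / 2"])
      fix p :: "real^'d \<Rightarrow> real"
      assume p: "\<And>w. 0 \<le> p w" "integrable lborel p" "integrable lborel (\<lambda>w. (?h \<bullet> w) * p w powr q)"
        and fin: "tsallis_div q p (prior q) \<noteq> \<infinity>"
      have D: "integrable lborel (\<lambda>w. p w * ln (p w / prior q w))"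
        "tsallis_val q p = (\<integral>w. p w * ln (p w / prior q w) \<partial>lborel)"
        using fin True by (auto simp: tsallis_div_def split: if_splits)
      have eq: "bregman q (p w) (?p w) = p w * ln (p w / prior q w) - (?h \<bullet> w) * p w powr q +
          ((norm ?h)\<^sup>2 / 2 - 1) * p w + ?p w" for w
      proof (cases "p w = 0")
        case False
        hence "p w > 0" using p(1)[of w] by simp
        hence e: "ln (p w / ?p w) = ln (p w / prior q w) - ?h \<bullet> w + (norm ?h)\<^sup>2 / 2"
          using posterior_pos[OF q c, of w] prior_pos[OF q, of w] posterior_1_tilt[OF True, of w]
          by (simp add: ln_div)
        have "bregman q (p w) (?p w) = p w * ln (p w / ?p w) - p w + ?p w" by (simp add: bregman_def True)
        also note e
        finally show ?thesis using p(1)[of w] by (simp add: True algebra_simps)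
      qed (simp add: bregman_def True)
      have int: "integrable lborel (\<lambda>w. bregman q (p w) (?p w))"
        unfolding eq using p P D(1) by simp
      have "(\<integral>w. bregman q (p w) (?p w) \<partial>lborel) = tsallis_val q p - (\<integral>w. (?h \<bullet> w) * p w powr q \<partial>lborel) +
          ((norm ?h)\<^sup>2 / 2 - 1) * (\<integral>w. p w \<partial>lborel) + 1"
        unfolding eq D(2) using p P D(1) by simp
      with int show "integrable lborel (\<lambda>w. bregman q (p w) (?p w)) \<and>
        tsallis_val q p - (\<integral>w. (?h \<bullet> w) * p w powr q \<partial>lborel) + (1 - (norm ?h)\<^sup>2 / 2) * (1 - (\<integral>w. p w \<partial>lborel)) =
        prior_dual q H \<beta> + 1 * (\<integral>w. bregman q (p w) (?p w) \<partial>lborel)"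
        by (simp add: prior_dual_def True field_simps)
    qed simp
  next
    case False
    hence q1: "q > 1" using q by simp
    let ?k = "post_scale q H \<beta> powr dual_exponent CARD('d) q"
    show thesis
    proof (rule that[of ?k "q * ?k / (q - 1)"])
      fix p :: "real^'d \<Rightarrow> real"
      assume p: "\<And>w. 0 \<le> p w" "integrable lborel p" "integrable lborel (\<lambda>w. (?h \<bullet> w) * p w powr q)"
        and fin: "tsallis_div q p (prior q) \<noteq> \<infinity>"
      define I where "I = (\<integral>w. p w powr q * prior q w powr (1 - q) \<partial>lborel)"
      define M where "M = (\<integral>w. (?h \<bullet> w) * p w powr q \<partial>lborel)"
      have D: "integrable lborel (\<lambda>w. p w powr q * prior q w powr (1 - q))"
        "tsallis_val q p = (I - 1) / (q - 1)"
        using fin False by (auto simp: tsallis_div_def I_def split: if_splits)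
      have k: "?k > 0" using c by simp
      have eq: "bregman q (p w) (?p w) = (p w powr q * prior q w powr (1 - q) - (q - 1) * ((?h \<bullet> w) * p w powr q)) / (?k * (q - 1))
          - q / (q - 1) * p w + ?p w" for w
      proof -
        have "?k * ?p w powr (1 - q) = prior q w powr (1 - q) - (q - 1) * (?h \<bullet> w)"
          using prior_tilt[OF q1, of w] posterior_powr[OF q1 c, of w] by simp
        hence "?p w powr (1 - q) = (prior q w powr (1 - q) - (q - 1) * (?h \<bullet> w)) / ?k"
          using k by (simp add: field_simps)
        hence "bregman q (p w) (?p w) = ((p w powr q * (prior q w powr (1 - q) - (q - 1) * (?h \<bullet> w))) / ?k - q * p w + (q - 1) * ?p w) / (q - 1)"
          using q1 by (simp add: bregman_def)
        moreover have "(a / k' - b + s * t) / s = a / (k' * s) - b / s + t" if "s > 0" "k' > 0" for a k' b s t :: real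
          using that by (simp add: field_simps)
        ultimately show ?thesis using q1 k by (simp add: right_diff_distrib mult_ac)
      qed
      have int: "integrable lborel (\<lambda>w. bregman q (p w) (?p w))"
        unfolding eq using p P D(1) by simp
      have "(\<integral>w. bregman q (p w) (?p w) \<partial>lborel) = (I - (q - 1) * M) / (?k * (q - 1)) - q / (q - 1) * (\<integral>w. p w \<partial>lborel) + 1"
        unfolding eq I_def M_def using p P D(1) by simp
      show "integrable lborel (\<lambda>w. bregman q (p w) (?p w)) \<and>
        tsallis_val q p - (\<integral>w. (?h \<bullet> w) * p w powr q \<partial>lborel) + q * ?k / (q - 1) * (1 - (\<integral>w. p w \<partial>lborel)) =
        prior_dual q H \<beta> + ?k * (\<integral>w. bregman q (p w) (?p w) \<partial>lborel)"
      proof -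
        have "(I - 1) / s - M + q' * k / s * (1 - P) = (k - 1) / s + k * ((I - s * M) / (k * s) - q' / s * P + 1)"
          if "s > 0" "k > 0" "q' = s + 1" for k s q' P :: real
          using that by (simp add: field_simps)
        from this[of "q - 1" ?k q] show ?thesis
          using q1 k int \<open>(\<integral>w. bregman q (p w) (?p w) \<partial>lborel) = _\<close>
          unfolding D(2) M_def[symmetric] by (simp add: prior_dual_def)
      qed
    qed (use c in simp)
  qed
qed

end

subsection \<open>Multipliers with nonpositive scale\<close>

text \<open>
  For \<open>c < 0\<close> the radius is fixed and the height \<open>u\<close> tends to infinity; for \<open>c = 0\<close> the height
  makes the \<open>powr\<close> term half of the linear one, and the mass \<open>u * (V * \<rho> ^ d)\<close> tends to infinity
  as \<open>\<rho>\<close> tends to 0 because of \<open>2 / (q - 1) > d\<close>.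
\<close>
lemma scaled_ball_unbounded:
  fixes q \<nu> Z c \<kappa> V B :: real and d :: nat
  assumes q: "q > 1" and \<nu>: "\<nu> > 0" and Z: "Z > 0" and V: "V > 0" and d: "real d < 2 / (q - 1)"
    and c: "c < 0 \<or> c = 0 \<and> \<kappa> > 0"
  shows "\<exists>u\<ge>0. \<exists>\<rho>>0. (u powr q * (Z * (c + \<rho>\<^sup>2 / \<nu>)) * (V * \<rho> ^ d) - 1) / (q - 1) + \<kappa> * (1 - u * (V * \<rho> ^ d)) \<le> B"
    (is "\<exists>u\<ge>0. \<exists>\<rho>>0. ?F u \<rho> \<le> B")
proof (cases "c < 0")
  case True
  \<comment> \<open>Chosen with \<open>\<rho>\<^sup>2 / \<nu> = - c / 2\<close>, so that c +
    \<open>\<rho>\<^sup>2 / \<nu>\<close> is still c / 2 < 0; then \<open>u powr q\<close> beats the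
    linear term since q > 1.\<close>
  define \<rho> where "\<rho> = sqrt (- c * \<nu> / 2)"
  have neg: "- c * \<nu> / 2 > 0" using True \<nu> by (simp add: mult_neg_pos)
  have \<rho>0: "\<rho> > 0" using neg unfolding \<rho>_def by (rule real_sqrt_gt_zero)
  have "\<rho>\<^sup>2 = - c * \<nu> / 2" using neg unfolding \<rho>_def by (simp del: minus_mult_minus)
  hence \<rho>: "c + \<rho>\<^sup>2 / \<nu> = c / 2" using \<nu> by (simp add: field_simps)
  define W where "W = V * \<rho> ^ d"
  have W: "W > 0" using V \<rho>0 by (simp add: W_def)
  define A where "A = Z * (- c / 2) * W / (q - 1)"
  have A: "A > 0" using True Z W q unfolding A_def by (intro divide_pos_pos mult_pos_pos) auto
  define L where "L = \<kappa> * W"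
  have F: "?F u \<rho> = - (A * u powr q) - L * u + (\<kappa> - 1 / (q - 1))" for u
    unfolding \<rho> A_def L_def W_def[symmetric] by (simp add: diff_divide_distrib algebra_simps)
  have "filterlim (\<lambda>u. - (A * u powr q) - L * u + (\<kappa> - 1 / (q - 1))) at_bot at_top"
    using A q by real_asymp
  hence "\<forall>\<^sub>F u in at_top. - (A * u powr q) - L * u + (\<kappa> - 1 / (q - 1)) \<le> B"
    unfolding filterlim_at_bot by blast
  hence "\<forall>\<^sub>F u in at_top. u \<ge> 0 \<and> ?F u \<rho> \<le> B"
    unfolding F using eventually_ge_at_top[of "0::real"] by eventually_elim simp
  from eventually_happens'[OF _ this] obtain u where "u \<ge> 0" "?F u \<rho> \<le> B" by auto
  thus ?thesis using \<rho>0 by (intro exI conjI)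
next
  case False
  hence c0: "c = 0" and \<kappa>: "\<kappa> > 0" using c by auto
  define a where "a = 1 / (q - 1)"
  \<comment> \<open>Solves \<open>u powr (q - 1) * (Z * (\<rho>\<^sup>2 / \<nu>)) = \<kappa> / 2 *
    (q - 1)\<close> for \<open>u powr (q - 1) = b / \<rho>\<^sup>2\<close>.\<close>
  define b where "b = \<kappa> / 2 * (q - 1) * \<nu> / Z"
  define u where "u \<rho> = (b / \<rho>\<^sup>2) powr a" for \<rho>
  define L where "L = \<kappa> / 2 * b powr a * V"
  have b: "b > 0" using \<kappa> q \<nu> Z by (simp add: b_def)
  have L: "L > 0" using \<kappa> b V by (simp add: L_def)
  have ad: "2 * a > real d" using d by (simp add: a_def)
  have F: "?F (u \<rho>) \<rho> = \<kappa> - 1 / (q - 1) - L * \<rho> powr (real d - 2 * a)" if \<rho>: "\<rho> > 0" for \<rho>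
  proof -
    have "u \<rho> powr q = u \<rho> powr (q - 1) * u \<rho>"
      using b \<rho> by (simp add: u_def powr_diff)
    also have "u \<rho> powr (q - 1) = b / \<rho>\<^sup>2"
      using q b \<rho> by (simp add: u_def powr_powr a_def)
    finally have uq: "u \<rho> powr q = b / \<rho>\<^sup>2 * u \<rho>" .
    have "(\<rho>\<^sup>2) powr a = \<rho> powr (2 * a)" using \<rho> powr_powr[of \<rho> 2 a] by simp
    hence u: "u \<rho> = b powr a * \<rho> powr (- 2 * a)"
      using b \<rho> by (simp add: u_def powr_divide powr_minus) (simp add: divide_inverse)
    have "u \<rho> * \<rho> ^ d = b powr a * \<rho> powr (real d - 2 * a)"
      unfolding u using \<rho> by (simp add: powr_diff powr_minus powr_realpow field_simps)
    hence L': "\<kappa> / 2 * (u \<rho> * (V * \<rho> ^ d)) = L * \<rho> powr (real d - 2 * a)"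
      by (simp add: L_def algebra_simps)
    have e: "u \<rho> powr q * (Z * (c + \<rho>\<^sup>2 / \<nu>)) = \<kappa> / 2 * (q - 1) * u \<rho>"
      unfolding uq c0 b_def using \<rho> \<nu> Z by simp
    have "?F (u \<rho>) \<rho> = (\<kappa> / 2 * (q - 1) * u \<rho> * (V * \<rho> ^ d) - 1) / (q - 1) + \<kappa> * (1 - u \<rho> * (V * \<rho> ^ d))"
      by (simp only: e)
    also have "\<dots> = \<kappa> - 1 / (q - 1) - \<kappa> / 2 * (u \<rho> * (V * \<rho> ^ d))"
    proof -
      have "(\<kappa> / 2 * s * U * W - 1) / s + \<kappa> * (1 - U * W) = \<kappa> - 1 / s - \<kappa> / 2 * (U * W)" if "s > 0" for s U W :: real
        using that by (simp add: field_simps)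
      thus ?thesis using q by simp
    qed
    finally show ?thesis unfolding L' .
  qed
  have "filterlim (\<lambda>\<rho>. (\<kappa> - 1 / (q - 1)) - L * \<rho> powr (real d - 2 * a)) at_bot (at_right 0)"
    using L ad by real_asymp
  hence "\<forall>\<^sub>F \<rho> in at_right 0. (\<kappa> - 1 / (q - 1)) - L * \<rho> powr (real d - 2 * a) \<le> B"
    unfolding filterlim_at_bot by blast
  moreover have "\<forall>\<^sub>F \<rho>::real in at_right 0. \<rho> > 0" by (rule eventually_at_right_less)
  ultimately have "\<forall>\<^sub>F \<rho> in at_right 0. \<rho> > 0 \<and> ?F (u \<rho>) \<rho> \<le> B"
    by eventually_elim (simp only: F simp_thms)
  from eventually_happens'[OF _ this] obtain \<rho> where "\<rho> > 0" "?F (u \<rho>) \<rho> \<le> B" by auto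
  moreover have "u \<rho> \<ge> 0" by (simp add: u_def)
  ultimately show ?thesis by (intro exI conjI)
qed

context
  fixes q :: real and H :: "real^'d^'m" and \<beta> :: "real^'m"
  assumes q: "1 \<le> q" "q < (2 + real CARD('d)) / real CARD('d)"
begin

text \<open>\<open>prior_tilt\<close> multiplied by \<open>p powr q\<close> and integrated:
  divergence and moments merge into a single integral, whatever the sign of c.\<close>

lemma tsallis_val_tilt:
  assumes q1: "q > 1" and m: "integrable lborel (\<lambda>w. ((transpose H *v \<beta>) \<bullet> w) * p w powr q)"
    and fin: "tsallis_div q p (prior q) \<noteq> \<infinity>"
  defines "g \<equiv> \<lambda>w. p w powr q * (Z0 CARD('d) q powr (q - 1) * (post_scale q H \<beta> + (norm (w - post_mean q H \<beta>))\<^sup>2 / nu CARD('d) q))"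
  shows "integrable lborel g"
    and "tsallis_val q p - (\<integral>w. ((transpose H *v \<beta>) \<bullet> w) * p w powr q \<partial>lborel) =
      ((\<integral>w. g w \<partial>lborel) - 1) / (q - 1)"
proof -
  have D: "integrable lborel (\<lambda>w. p w powr q * prior q w powr (1 - q))"
    "tsallis_val q p = ((\<integral>w. p w powr q * prior q w powr (1 - q) \<partial>lborel) - 1) / (q - 1)"
    using fin q1 by (auto simp: tsallis_div_def split: if_splits)
  have g: "g w = p w powr q * prior q w powr (1 - q) - (q - 1) * (((transpose H *v \<beta>) \<bullet> w) * p w powr q)" for w
    unfolding g_def prior_tilt[OF q q1, symmetric] by (simp add: right_diff_distrib mult_ac)
  show "integrable lborel g" unfolding g using D m by simp
  show "tsallis_val q p - (\<integral>w. ((transpose H *v \<beta>) \<bullet> w) * p w powr q \<partial>lborel) =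
      ((\<integral>w. g w \<partial>lborel) - 1) / (q - 1)"
    unfolding g D(2) using D m q1 by (simp add: field_simps)
qed

text \<open>At c = 0 the weight is a multiple of |w - \<mu>|^2, hence nonnegative with a null set of
  zeros. So the bound - 1 / (q - 1) is met only by p = 0 almost everywhere, which later contradicts
  normalization.\<close>

lemma boundary_lower_bound:
  assumes q1: "q > 1" and c: "post_scale q H \<beta> = 0"
    and p: "integrable lborel p" "\<And>w. 0 \<le> p w" and m: "integrable lborel (\<lambda>w. ((transpose H *v \<beta>) \<bullet> w) * p w powr q)"
    and fin: "tsallis_div q p (prior q) \<noteq> \<infinity>"
  shows "prior_dual q H \<beta> \<le> tsallis_val q p - (\<integral>w. ((transpose H *v \<beta>) \<bullet> w) * p w powr q \<partial>lborel)"
    and "prior_dual q H \<beta> = tsallis_val q p - (\<integral>w. ((transpose H *v \<beta>) \<bullet> w) * p w powr q \<partial>lborel) \<Longrightarrow>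
      (\<integral>w. p w \<partial>lborel) = 0"
proof -
  note \<nu> = nu_pos[OF q1 q(2), simplified] and Z = Z0_pos[OF q, simplified]
  let ?g = "\<lambda>w. p w powr q * (Z0 CARD('d) q powr (q - 1) * (post_scale q H \<beta> + (norm (w - post_mean q H \<beta>))\<^sup>2 / nu CARD('d) q))"
  note G = tsallis_val_tilt[OF q1 m fin]
  have g0: "?g w \<ge> 0" for w using \<nu> c by simp
  have T: "prior_dual q H \<beta> = - (1 / (q - 1))" using q1 c by (simp add: prior_dual_def)
  show "prior_dual q H \<beta> \<le> tsallis_val q p - (\<integral>w. ((transpose H *v \<beta>) \<bullet> w) * p w powr q \<partial>lborel)"
  proof -
    have "0 \<le> (\<integral>w. ?g w \<partial>lborel)" by (rule Bochner_Integration.integral_nonneg) (rule g0)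
    hence "(0 - 1) / (q - 1) \<le> ((\<integral>w. ?g w \<partial>lborel) - 1) / (q - 1)"
      using q1 by (intro divide_right_mono) auto
    thus ?thesis unfolding T G(2) by simp
  qed
  assume "prior_dual q H \<beta> = tsallis_val q p - (\<integral>w. ((transpose H *v \<beta>) \<bullet> w) * p w powr q \<partial>lborel)"
  hence "(\<integral>w. ?g w \<partial>lborel) = 0" unfolding T G(2) using q1 by (simp add: field_simps)
  hence "AE w in lborel. ?g w = 0"
    by (subst (asm) integral_nonneg_eq_0_iff_AE[OF G(1)]) (use g0 in auto)
  moreover have "AE w in lborel. w \<noteq> post_mean q H \<beta>" by (rule AE_lborel_singleton)
  ultimately have "AE w in lborel. p w = 0"
    by eventually_elim (use \<nu> Z c in auto)
  thus "(\<integral>w. p w \<partial>lborel) = 0"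
    using integral_cong_AE[of p lborel "\<lambda>_. 0"] p by auto
qed

text \<open>All integrands are continuous on the compact ball, hence integrable, and the weight is
  largest at the rim, where it contains \<open>\<rho>\<^sup>2 / \<nu>\<close>.\<close>

lemma scaled_indicator:
  fixes u \<rho> :: real
  assumes q1: "q > 1" and u: "u \<ge> 0" and \<rho>: "\<rho> > 0"
  defines "p \<equiv> \<lambda>w. u * indicator (cball (post_mean q H \<beta>) \<rho>) w"
    and "V \<equiv> unit_ball_vol CARD('d) * \<rho> ^ CARD('d)"
  shows "integrable lborel p" and "(\<integral>w. p w \<partial>lborel) = u * V"
    and "integrable lborel (\<lambda>w. (v \<bullet> w) * p w powr q)"
    and "tsallis_div q p (prior q) \<noteq> \<infinity>"
    and "tsallis_val q p - (\<integral>w. ((transpose H *v \<beta>) \<bullet> w) * p w powr q \<partial>lborel) \<le>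
      (u powr q * (Z0 CARD('d) q powr (q - 1) * (post_scale q H \<beta> + \<rho>\<^sup>2 / nu CARD('d) q)) * V - 1) / (q - 1)"
proof -
  note \<nu> = nu_pos[OF q1 q(2), simplified] and Z = Z0_pos[OF q, simplified]
  let ?B = "cball (post_mean q H \<beta>) \<rho>"
  let ?ind = "\<lambda>w. indicator ?B w :: real"
  have V: "(\<integral>w. ?ind w \<partial>lborel) = V"
    using \<rho> by (simp add: V_def content_cball)
  have int: "integrable lborel (\<lambda>w. ?ind w * f w)" if "continuous_on ?B f" for f :: "real^'d \<Rightarrow> real"
    using borel_integrable_compact[OF compact_cball that] by simp
  have i1: "integrable lborel ?ind" using int[of "\<lambda>_. 1"] by simp
  have pq: "p w powr q = u powr q * ?ind w" for w
    using q1 by (simp add: p_def indicator_def)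
  show "integrable lborel p" "(\<integral>w. p w \<partial>lborel) = u * V"
    unfolding p_def using i1 V by simp_all
  have m: "integrable lborel (\<lambda>w. (v \<bullet> w) * p w powr q)" for v
  proof -
    have "integrable lborel (\<lambda>w. u powr q * (?ind w * (v \<bullet> w)))"
      by (intro integrable_mult_right int continuous_intros)
    thus ?thesis unfolding pq by (simp add: mult_ac)
  qed
  thus "integrable lborel (\<lambda>w. (v \<bullet> w) * p w powr q)" .
  have cp: "continuous_on S (\<lambda>w::real^'d. prior q w powr (1 - q))" for S
  proof -
    have "prior q w \<noteq> 0" "1 + (norm w)\<^sup>2 / nu CARD('d) q \<noteq> 0" for w :: "real^'d"
      using prior_pos[OF q, of w] \<nu> by (simp_all add: add_nonneg_eq_0_iff)
    hence "continuous_on S (\<lambda>w::real^'d. prior q w)"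
      unfolding prior_alt[OF q1] using \<nu> by (intro continuous_intros) auto
    thus ?thesis using \<open>\<And>w::real^'d. prior q w \<noteq> 0\<close> by (intro continuous_intros) auto
  qed
  have "integrable lborel (\<lambda>w. u powr q * (?ind w * prior q w powr (1 - q)))"
    by (intro integrable_mult_right int cp)
  hence "integrable lborel (\<lambda>w. p w powr q * prior q w powr (1 - q))"
    unfolding pq by (simp add: mult_ac)
  thus fin: "tsallis_div q p (prior q) \<noteq> \<infinity>" using q1 by (simp add: tsallis_div_def)
  let ?g = "\<lambda>w. p w powr q * (Z0 CARD('d) q powr (q - 1) * (post_scale q H \<beta> + (norm (w - post_mean q H \<beta>))\<^sup>2 / nu CARD('d) q))"
  let ?K = "u powr q * (Z0 CARD('d) q powr (q - 1) * (post_scale q H \<beta> + \<rho>\<^sup>2 / nu CARD('d) q))"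
  note G = tsallis_val_tilt[OF q1 m fin]
  have "(\<integral>w. ?g w \<partial>lborel) \<le> (\<integral>w. ?K * ?ind w \<partial>lborel)"
  proof (rule integral_mono[OF G(1)])
    show "integrable lborel (\<lambda>w. ?K * ?ind w)" using i1 by simp
    show "?g w \<le> ?K * ?ind w" for w
    proof (cases "w \<in> ?B")
      case True
      hence "(norm (w - post_mean q H \<beta>))\<^sup>2 \<le> \<rho>\<^sup>2"
        by (intro power_mono) (auto simp: dist_norm norm_minus_commute)
      hence "(norm (w - post_mean q H \<beta>))\<^sup>2 / nu CARD('d) q \<le> \<rho>\<^sup>2 / nu CARD('d) q"
        using \<nu> by (simp add: divide_right_mono)
      thus ?thesis using True unfolding pq by (simp add: mult_left_mono)
    qed (simp add: pq)
  qed
  hence "(\<integral>w. ?g w \<partial>lborel) \<le> ?K * V" using V by simp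
  thus "tsallis_val q p - (\<integral>w. ((transpose H *v \<beta>) \<bullet> w) * p w powr q \<partial>lborel) \<le> (?K * V - 1) / (q - 1)"
    unfolding G(2) using q1 by (simp add: divide_right_mono)
qed

lemma density_part_unbounded:
  fixes \<kappa> B :: real
  assumes q1: "q > 1" and c: "post_scale q H \<beta> < 0 \<or> post_scale q H \<beta> = 0 \<and> \<kappa> > 0"
  obtains p where "\<And>w. 0 \<le> p w" "integrable lborel p" "\<And>v. integrable lborel (\<lambda>w. (v \<bullet> w) * p w powr q)"
    "tsallis_div q p (prior q) \<noteq> \<infinity>"
    "tsallis_val q p - (\<integral>w. ((transpose H *v \<beta>) \<bullet> w) * p w powr q \<partial>lborel) + \<kappa> * (1 - (\<integral>w. p w \<partial>lborel)) \<le> B"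
proof -
  note \<nu> = nu_pos[OF q1 q(2), simplified] and Z = Z0_pos[OF q, simplified]
  let ?c = "post_scale q H \<beta>" and ?\<nu> = "nu CARD('d) q" and ?Z = "Z0 CARD('d) q powr (q - 1)"
  let ?V = "\<lambda>\<rho>. unit_ball_vol CARD('d) * \<rho> ^ CARD('d)"
  let ?F = "\<lambda>u \<rho>. (u powr q * (?Z * (?c + \<rho>\<^sup>2 / ?\<nu>)) * ?V \<rho> - 1) / (q - 1) + \<kappa> * (1 - u * ?V \<rho>)"
  have Zp: "?Z > 0" using Z by simp
  have "real CARD('d) < 2 / (q - 1)" using \<nu> by (simp add: nu_def)
  from scaled_ball_unbounded[OF q1 \<nu> Zp _ this c, of "unit_ball_vol CARD('d)" B]
  obtain u \<rho> where u: "u \<ge> 0" "\<rho> > 0" "?F u \<rho> \<le> B" by auto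
  note I = scaled_indicator[OF q1 u(1,2)]
  show thesis
  proof (rule that[of "\<lambda>w. u * indicator (cball (post_mean q H \<beta>) \<rho>) w"])
    show "0 \<le> u * indicator (cball (post_mean q H \<beta>) \<rho>) w" for w using u by simp
    show "tsallis_val q (\<lambda>w. u * indicator (cball (post_mean q H \<beta>) \<rho>) w) -
       (\<integral>w. ((transpose H *v \<beta>) \<bullet> w) * (u * indicator (cball (post_mean q H \<beta>) \<rho>) w) powr q \<partial>lborel) +
       \<kappa> * (1 - (\<integral>w. u * indicator (cball (post_mean q H \<beta>) \<rho>) w \<partial>lborel)) \<le> B"
      unfolding I(2) using I(5) u(3) by linarith
  qed (rule I(1) I(3) I(4))+
qed

end

subsection \<open>The conjugate of the loss\<close>

text \<open>The set of b for which \<open>C * exp_q q' (- z) + b * z\<close> is bounded below in z.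
  For q' = 0, the hinge loss, it is the box of the support vector machine.\<close>

definition conj_domain :: "real \<Rightarrow> real \<Rightarrow> real \<Rightarrow> bool" where
  "conj_domain q' C b \<longleftrightarrow> 0 \<le> b \<and> (q' = 0 \<longrightarrow> b \<le> C)"

text \<open>The infimum over z of \<open>C * exp_q q' (- z) + b * z\<close>, that is, the concave
  conjugate of the loss up to sign conventions. For q' = 0 it is attained at the kink z = 1.\<close>

definition conj_loss :: "real \<Rightarrow> real \<Rightarrow> real \<Rightarrow> real" where
  "conj_loss q' C b = (if q' = 0 then b else C - C * bregman (1 / q') (b / C) 1)"

lemma conj_loss_scale:
  assumes "C > 0"
  shows "conj_loss q' C (C * p) = C * conj_loss q' 1 p" "conj_domain q' C (C * p) \<longleftrightarrow> conj_domain q' 1 p"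
  using assms by (auto simp: conj_loss_def conj_domain_def right_diff_distrib zero_le_mult_iff)

lemma conj_loss_inner:
  assumes "0 < q'" "q' < 1"
  shows "conj_loss q' 1 p = (p - q' * p powr (1 / q')) / (1 - q')"
proof -
  have "1 - (P - 1 / q' * p + (1 / q' - 1)) / (1 / q' - 1) = (p - q' * P) / (1 - q')" for P :: real
    using assms by (simp add: divide_simps)
  thus ?thesis using assms by (simp add: conj_loss_def bregman_def)
qed

lemma conj_loss_1: "conj_loss 1 1 p = p - p * ln p"
  by (simp add: conj_loss_def bregman_def)

lemma exp_q_0: "exp_q 0 (- z) = max (1 - z) 0"
  by (simp add: exp_q_def max_def)

lemma exp_q_unit_interval:
  assumes "0 \<le> q'" "q' \<le> 1" "0 \<le> z"
  shows "0 \<le> exp_q q' (- z)" "exp_q q' (- z) \<le> 1"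
proof -
  have "max (1 - (1 - q') * z) 0 powr (1 / (1 - q')) \<le> 1" if "q' < 1"
    using assms that by (intro powr_le1) auto
  thus "0 \<le> exp_q q' (- z)" "exp_q q' (- z) \<le> 1"
    using assms by (auto simp: exp_q_def)
qed

context
  fixes q' :: real
  assumes q': "0 \<le> q'" "q' \<le> 1"
begin

text \<open>For 0 < q' < 1 this is Young's inequality with the exponents 1 / q' and 1 / (1 - q');
  truncation only enlarges u, which is harmless because p \<ge> 0. The end points are the piecewise
  linear hinge loss and exp s \<ge> 1 + s.\<close>

lemma conj_loss_le_1:
  assumes p: "conj_domain q' 1 p"
  shows "conj_loss q' 1 p \<le> exp_q q' (- z) + p * z"
proof -
  consider "q' = 0" | "q' = 1" | "0 < q'" "q' < 1" using q' by linarith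
  thus ?thesis
  proof cases
    case 1
    have "0 \<le> (1 - p) * (1 - z)" if "z \<le> 1" using that p 1 by (auto simp: conj_domain_def)
    moreover have "0 \<le> p * (z - 1)" if "z \<ge> 1" using that p by (auto simp: conj_domain_def)
    ultimately show ?thesis unfolding 1 exp_q_0 by (auto simp: conj_loss_def max_def algebra_simps)
  next
    case 2
    show ?thesis
    proof (cases "p = 0")
      case False
      hence p0: "p > 0" using p by (simp add: conj_domain_def)
      have "p * (1 + (- z - ln p)) \<le> p * exp (- z - ln p)"
        using p0 by (intro mult_left_mono exp_ge_add_one_self) auto
      also have "\<dots> = exp (- z)" using p0 by (simp add: exp_diff)
      finally show ?thesis unfolding 2 by (simp add: exp_q_def conj_loss_1 algebra_simps)
    qed (simp add: 2 exp_q_def conj_loss_1)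
  next
    case 3
    define u where "u = max (1 - (1 - q') * z) 0"
    have p0: "p \<ge> 0" using p by (simp add: conj_domain_def)
    have "p * (1 - (1 - q') * z) \<le> p * u" using p0 by (intro mult_left_mono) (auto simp: u_def)
    also have "\<dots> \<le> p powr (1 / q') / (1 / q') + u powr (1 / (1 - q')) / (1 / (1 - q'))"
      using 3 p0 by (intro Youngs_inequality) (auto simp: u_def)
    finally have "p - q' * p powr (1 / q') \<le> (u powr (1 / (1 - q')) + p * z) * (1 - q')"
      by (simp add: algebra_simps)
    hence "(p - q' * p powr (1 / q')) / (1 - q') \<le> u powr (1 / (1 - q')) + p * z"
      using 3 by (simp add: pos_divide_le_eq)
    thus ?thesis using 3 by (simp add: conj_loss_inner exp_q_def u_def)
  qed
qed

text \<open>The slack e is used for q' = 1 and p = 0, where exp (- z) only tends to 0. For 0 < q' <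
  1 the witness is the stationary point, at which 1 - (1 - q') * z =
  \<open>p powr ((1 - q') / q')\<close>.\<close>

lemma conj_loss_approx_1:
  assumes p: "conj_domain q' 1 p" and e: "e > 0"
  obtains z where "exp_q q' (- z) + p * z < conj_loss q' 1 p + e"
proof -
  consider "q' = 0" | "q' = 1" | "0 < q'" "q' < 1" using q' by linarith
  thus ?thesis
  proof cases
    case 1
    thus ?thesis using e that[of 1] by (simp add: exp_q_def conj_loss_def)
  next
    case 2
    show ?thesis
    proof (cases "p = 0")
      case True
      have "exp (- (1 - ln e)) < e" using e by (simp add: exp_diff pos_divide_less_eq)
      thus ?thesis using that[of "1 - ln e"] unfolding 2 True by (simp add: exp_q_def conj_loss_1)
    next
      case False
      hence p0: "p > 0" using p by (simp add: conj_domain_def)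
      thus ?thesis using that[of "- ln p"] e unfolding 2 by (simp add: exp_q_def conj_loss_1)
    qed
  next
    case 3
    define u where "u = p powr ((1 - q') / q')"
    define z where "z = (1 - u) / (1 - q')"
    have p0: "p \<ge> 0" using p by (simp add: conj_domain_def)
    have z: "1 - (1 - q') * z = u" using 3 by (simp add: z_def)
    have E: "exp_q q' (- z) = p powr (1 / q')"
    proof -
      have "exp_q q' (- z) = u powr (1 / (1 - q'))"
        using 3 z by (simp add: exp_q_def u_def max_def)
      also have "\<dots> = p powr (1 / q')" using 3 by (simp add: u_def powr_powr)
      finally show ?thesis .
    qed
    have pu: "p * u = p powr (1 / q')"
    proof (cases "p = 0")
      case False
      hence "p * u = p powr (1 + (1 - q') / q')" using p0 by (simp add: u_def powr_add)
      also have "1 + (1 - q') / q' = 1 / q'" using 3 by (simp add: field_simps)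
      finally show ?thesis .
    qed simp
    have pz: "p * z = (p - p * u) / (1 - q')" by (simp add: z_def right_diff_distrib)
    have "exp_q q' (- z) + p * z = conj_loss q' 1 p"
      unfolding E pz pu conj_loss_inner[OF 3] using 3 by (simp add: field_simps)
    thus ?thesis using that[of z] e by simp
  qed
qed

text \<open>p is minus a slope of the loss at z, and 0 where the truncation is active. In contrast
  to the infimum over z for fixed p, this equality case always exists.\<close>

lemma conj_loss_subgradient_1:
  obtains p where "conj_domain q' 1 p" "exp_q q' (- z) + p * z \<le> conj_loss q' 1 p"
proof -
  consider "q' = 0" | "q' = 1" | "0 < q'" "q' < 1" using q' by linarith
  thus ?thesis
  proof cases
    case 1
    thus ?thesis
      using that[of "if z < 1 then 1 else 0"] by (auto simp: exp_q_0 conj_loss_def conj_domain_def)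
  next
    case 2
    thus ?thesis using that[of "exp (- z)"] by (simp add: exp_q_def conj_loss_1 conj_domain_def)
  next
    case 3
    define u where "u = max (1 - (1 - q') * z) 0"
    define p where "p = u powr (q' / (1 - q'))"
    have "u powr (1 / (1 - q')) = p * (1 - (1 - q') * z)"
    proof (cases "u = 0")
      case False
      hence u: "u > 0" "1 - (1 - q') * z = u" by (auto simp: u_def)
      have "p * u = u powr (q' / (1 - q') + 1)" using u by (simp add: p_def powr_add)
      also have "q' / (1 - q') + 1 = 1 / (1 - q')" using 3 by (simp add: field_simps)
      finally show ?thesis using u by simp
    qed (simp add: p_def)
    hence p_eq: "u powr (1 / (1 - q')) + p * z - q' * (p * z) = p" by (simp add: algebra_simps)
    have "(u powr (1 / (1 - q')) + p * z) * (1 - q') =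
        (u powr (1 / (1 - q')) + p * z - q' * (p * z)) - q' * u powr (1 / (1 - q'))"
      by (simp add: algebra_simps)
    also note p_eq
    finally have "(u powr (1 / (1 - q')) + p * z) * (1 - q') = p - q' * u powr (1 / (1 - q'))" .
    moreover have "p powr (1 / q') = u powr (1 / (1 - q'))" using 3 by (simp add: p_def powr_powr)
    ultimately have "(u powr (1 / (1 - q')) + p * z) * (1 - q') = p - q' * p powr (1 / q')" by simp
    hence "u powr (1 / (1 - q')) + p * z = (p - q' * p powr (1 / q')) / (1 - q')"
      using 3 by (simp add: field_simps)
    thus ?thesis using that[of p] 3 by (simp add: conj_loss_inner exp_q_def u_def conj_domain_def p_def)
  qed
qed

context
  fixes C :: real
  assumes C: "C > 0"
begin

lemma conj_loss_le:
  assumes "conj_domain q' C b"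
  shows "conj_loss q' C b \<le> C * exp_q q' (- z) + b * z"
proof -
  have b: "b = C * (b / C)" using C by simp
  have "conj_domain q' 1 (b / C)" using assms conj_loss_scale(2)[OF C, of q' "b / C"] b by simp
  from conj_loss_le_1[OF this, of z] C
  have "C * conj_loss q' 1 (b / C) \<le> C * (exp_q q' (- z) + b / C * z)" by (intro mult_left_mono) auto
  thus ?thesis using C conj_loss_scale(1)[OF C, of q' "b / C"] by (simp add: distrib_left)
qed

lemma conj_loss_approx:
  assumes "conj_domain q' C b" "e > 0"
  obtains z where "C * exp_q q' (- z) + b * z < conj_loss q' C b + e"
proof -
  have b: "b = C * (b / C)" using C by simp
  have "conj_domain q' 1 (b / C)" using assms conj_loss_scale(2)[OF C, of q' "b / C"] b by simp
  from conj_loss_approx_1[OF this, of "e / C"] C assms(2)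
  obtain z where z: "exp_q q' (- z) + b / C * z < conj_loss q' 1 (b / C) + e / C" by auto
  hence "C * (exp_q q' (- z) + b / C * z) < C * (conj_loss q' 1 (b / C) + e / C)"
    using C by simp
  thus ?thesis using that[of z] C conj_loss_scale(1)[OF C, of q' "b / C"] by (simp add: distrib_left)
qed

lemma conj_loss_subgradient:
  obtains b where "conj_domain q' C b" "C * exp_q q' (- z) + b * z \<le> conj_loss q' C b"
proof -
  obtain p where p: "conj_domain q' 1 p" "exp_q q' (- z) + p * z \<le> conj_loss q' 1 p"
    by (rule conj_loss_subgradient_1)
  have "C * (exp_q q' (- z) + p * z) \<le> C * conj_loss q' 1 p" using C p(2) by simp
  thus ?thesis using that[of "C * p"] p(1) C conj_loss_scale[OF C, of q' p] by (simp add: algebra_simps)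
qed

lemma conj_loss_unbounded:
  assumes "\<not> conj_domain q' C b"
  obtains z where "C * exp_q q' (- z) + b * z \<le> M"
proof (cases "b < 0")
  case True
  \<comment> \<open>For z \<ge> 0 the loss is at most C, and z is at least the solution of C + b * z
    = M.\<close>
  define z where "z = max 0 ((M - C) / b)"
  have "b * z \<le> b * ((M - C) / b)" using True by (intro mult_left_mono_neg) (auto simp: z_def)
  moreover have "C * exp_q q' (- z) \<le> C * 1"
    using C exp_q_unit_interval(2)[OF q', of z] by (intro mult_left_mono) (auto simp: z_def)
  ultimately show ?thesis using that[of z] True by simp
next
  case False
  hence q0: "q' = 0" and b: "b > C" using assms by (auto simp: conj_domain_def)
  \<comment> \<open>On z \<le> 0 the hinge loss is 1 - z, so the sum is C + (b - C) * z with
    positive slope, and z is taken far enough to the left.\<close>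
  define z where "z = min 0 ((M - C) / (b - C))"
  have "(b - C) * z \<le> (b - C) * ((M - C) / (b - C))" using b by (intro mult_left_mono) (auto simp: z_def)
  also have "\<dots> = M - C" using b by simp
  finally have "C * (1 - z) + b * z \<le> M" by (simp add: algebra_simps)
  moreover have "exp_q q' (- z) = 1 - z" unfolding q0 exp_q_0 by (simp add: z_def)
  ultimately show ?thesis using that[of z] by simp
qed

end

end

section \<open>The divergence from the all-ones vector and its limit of infinite order\<close>

lemma vec_tsallis_div_real_eq:
  "vec_tsallis_div_real s p (\<chi> i. 1) = (\<Sum>i\<in>UNIV. bregman s (p $ i) 1)"
  by (simp add: vec_tsallis_div_real_def bregman_def sum_divide_distrib)

lemma bregman_tendsto:
  assumes "0 \<le> p"
  shows "p \<le> 1 \<Longrightarrow> ((\<lambda>s. bregman s p 1) \<longlongrightarrow> 1 - p) at_top"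
    and "p > 1 \<Longrightarrow> filterlim (\<lambda>s. bregman s p 1) at_top at_top"
proof -
  have eq: "\<forall>\<^sub>F s in at_top. p powr s / (s - 1) - s / (s - 1) * p + 1 = bregman s p 1"
    using eventually_gt_at_top[of 1] by eventually_elim (simp add: bregman_def diff_divide_distrib add_divide_distrib)
  {
    assume "p \<le> 1"
    have "((\<lambda>s. p powr s / (s - 1)) \<longlongrightarrow> 0) at_top"
    proof (rule tendsto_sandwich)
      show "\<forall>\<^sub>F s in at_top. 0 \<le> p powr s / (s - 1)"
        using eventually_gt_at_top[of 1] by eventually_elim simp
      show "\<forall>\<^sub>F s in at_top. p powr s / (s - 1) \<le> 1 / (s - 1)"
        using eventually_gt_at_top[of 1]
        by eventually_elim (use assms \<open>p \<le> 1\<close> in \<open>auto intro!: divide_right_mono powr_le1\<close>)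
      show "((\<lambda>s::real. 1 / (s - 1)) \<longlongrightarrow> 0) at_top" by real_asymp
    qed simp
    moreover have "((\<lambda>s::real. s / (s - 1)) \<longlongrightarrow> 1) at_top" by real_asymp
    ultimately have "((\<lambda>s. p powr s / (s - 1) - s / (s - 1) * p + 1) \<longlongrightarrow> 0 - 1 * p + 1) at_top"
      by (intro tendsto_intros)
    from Lim_transform_eventually[OF this eq] show "((\<lambda>s. bregman s p 1) \<longlongrightarrow> 1 - p) at_top" by simp
  }
  {
    assume "p > 1"
    hence "filterlim (\<lambda>s. p powr s / (s - 1) - s / (s - 1) * p + 1) at_top at_top" by real_asymp
    thus "filterlim (\<lambda>s. bregman s p 1) at_top at_top"
      using filterlim_cong[OF refl refl eq] by simp
  }
qed

definition conj_loss_total :: "real \<Rightarrow> real \<Rightarrow> real^'m \<Rightarrow> real" where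
  "conj_loss_total q' C \<beta> = (\<Sum>i\<in>UNIV. conj_loss q' C (\<beta> $ i))"

text \<open>For q' > 0 the sums agree term by term. For q' = 0 the summands tend to 1 - p or to
  infinity, according to whether p \<le> 1 or p > 1 for p = \<beta> $ i / C; the value infinity thus
  encodes the constraint \<beta> $ i \<le> C.\<close>

lemma dual_loss_eq:
  fixes \<beta> :: "real^'m"
  assumes q': "0 \<le> q'" "q' \<le> 1" and C: "C > 0" and \<beta>: "\<forall>i. 0 \<le> \<beta> $ i"
  shows "dual_loss q' C \<beta> = (if \<forall>i. conj_domain q' C (\<beta> $ i)
    then ereal (C * real CARD('m) - conj_loss_total q' C \<beta>) else \<infinity>)"
proof (cases "q' = 0")
  case False
  hence "1 / ereal q' = ereal (1 / q')" by (simp add: one_ereal_def)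
  hence "dual_loss q' C \<beta> = ereal (C * (\<Sum>i\<in>UNIV. bregman (1 / q') (\<beta> $ i / C) 1))"
    by (simp add: dual_loss_def vec_tsallis_div_def vec_tsallis_div_real_eq divide_inverse mult.commute)
  moreover have "C * real CARD('m) - conj_loss_total q' C \<beta> = C * (\<Sum>i\<in>UNIV. bregman (1 / q') (\<beta> $ i / C) 1)"
    using False by (simp add: conj_loss_total_def conj_loss_def sum_subtractf sum_distrib_left)
  ultimately show ?thesis using False \<beta> by (simp add: conj_domain_def)
next
  case True
  let ?p = "\<beta> /\<^sub>R C"
  have p: "?p $ i \<ge> 0" for i using \<beta> C by simp
  have lim: "dual_loss q' C \<beta> = ereal C * l"
    if "((\<lambda>s. ereal (\<Sum>i\<in>UNIV. bregman s (?p $ i) 1)) \<longlongrightarrow> l) at_top" for l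
    using tendsto_Lim[OF _ that] True by (simp add: dual_loss_def vec_tsallis_div_def vec_tsallis_div_real_eq)
  show ?thesis
  proof (cases "\<forall>i. conj_domain q' C (\<beta> $ i)")
    case dom: True
    hence "?p $ i \<le> 1" for i using True C by (auto simp: conj_domain_def field_simps)
    hence "((\<lambda>s. ereal (\<Sum>i\<in>UNIV. bregman s (?p $ i) 1)) \<longlongrightarrow> ereal (\<Sum>i\<in>UNIV. 1 - ?p $ i)) at_top"
      using p by (intro tendsto_intros bregman_tendsto(1))
    from lim[OF this] dom show ?thesis using True C
      by (simp add: conj_loss_total_def conj_loss_def sum_subtractf right_diff_distrib sum_distrib_left mult.assoc[symmetric])
  next
    case False
    then obtain i where "\<not> conj_domain q' C (\<beta> $ i)" by blast
    hence "?p $ i > 1" using True C \<beta> by (auto simp: conj_domain_def field_simps)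
    from bregman_tendsto(2)[OF p this] have "filterlim (\<lambda>s. bregman s (?p $ i) 1) at_top at_top" .
    \<comment> \<open>The remaining summands are nonnegative for orders s \<ge> 1, so they cannot
      compensate the divergent one.\<close>
    moreover have "\<forall>\<^sub>F s in at_top. bregman s (?p $ i) 1 \<le> (\<Sum>i\<in>UNIV. bregman s (?p $ i) 1)"
      using eventually_ge_at_top[of 1]
      by eventually_elim (rule member_le_sum, use p in \<open>auto intro!: bregman_nonneg_eq_0_iff(1)\<close>)
    ultimately have "filterlim (\<lambda>s. \<Sum>i\<in>UNIV. bregman s (?p $ i) 1) at_top at_top"
      by (rule filterlim_at_top_mono)
    hence "((\<lambda>s. ereal (\<Sum>i\<in>UNIV. bregman s (?p $ i) 1)) \<longlongrightarrow> \<infinity>) at_top"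
      by (simp only: tendsto_PInfty_eq_at_top)
    from lim[OF this] False C show ?thesis by simp
  qed
qed

subsection \<open>The two parts of the Lagrangian\<close>

definition loss_part :: "real \<Rightarrow> real \<Rightarrow> real^'m \<Rightarrow> real^'m \<Rightarrow> real" where
  "loss_part q' C \<beta> z = C * (\<Sum>i\<in>UNIV. exp_q q' (- (z $ i))) + \<beta> \<bullet> z"

definition density_part :: "real \<Rightarrow> ('d::finite \<Rightarrow> real^'n \<Rightarrow> real) \<Rightarrow> ('m::finite \<Rightarrow> real^'n) \<Rightarrow> ('m \<Rightarrow> real)
    \<Rightarrow> real^'m \<Rightarrow> real \<Rightarrow> (real^'d \<Rightarrow> real) \<Rightarrow> real" where
  "density_part q \<phi> x y \<beta> \<kappa> p =
    tsallis_val q p - \<beta> \<bullet> moments q \<phi> x y p + \<kappa> * (1 - (\<integral>w. p w \<partial>lborel))"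

lemma loss_part_sum: "loss_part q' C \<beta> z = (\<Sum>i\<in>UNIV. C * exp_q q' (- (z $ i)) + \<beta> $ i * z $ i)"
  by (simp add: loss_part_def inner_vec_def sum.distrib sum_distrib_left)

lemma lagrangian_eq:
  "lagrangian q q' C \<phi> x y p z \<beta> \<kappa> =
    (if tsallis_div q p (prior q) = \<infinity> then \<infinity>
     else ereal (density_part q \<phi> x y \<beta> \<kappa> p + loss_part q' C \<beta> z))"
proof (cases "tsallis_div q p (prior q)")
  case (real r)
  thus ?thesis
    by (simp add: lagrangian_def primal_objective_def density_part_def loss_part_def inner_diff_right)
next
  case PInf
  thus ?thesis by (simp add: lagrangian_def primal_objective_def)
qed (simp add: tsallis_div_def split: if_splits)

lemma admissibleI:
  assumes "\<And>w. 0 \<le> p w" "integrable lborel p" "\<And>v. integrable lborel (\<lambda>w. (v \<bullet> w) * p w powr q)"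
  shows "p \<in> admissible q \<phi> x y"
  using assms by (simp add: admissible_def moment_integrand_def[abs_def] mult.assoc)

text \<open>The zero function lies in the domain because normalization is a constraint. It is the
  competitor for c = 0 and \<kappa> \<le> 0, and the fixed density when only z is moved.\<close>

lemma zero_admissible: "(\<lambda>w. 0) \<in> admissible q \<phi> x y" "tsallis_div q (\<lambda>w::real^'d. 0) (prior q) \<noteq> \<infinity>"
  by (rule admissibleI) (simp_all add: tsallis_div_def)

lemma density_part_normalized:
  assumes "(\<integral>w. p w \<partial>lborel) = 1"
  shows "density_part q \<phi> x y \<beta> \<kappa> p = tsallis_val q p - \<beta> \<bullet> moments q \<phi> x y p"
  using assms by (simp add: density_part_def)

lemma primal_feasible_iff:
  "(p, z) \<in> primal_feasible q \<phi> x y \<longleftrightarrow>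
    p \<in> admissible q \<phi> x y \<and> z = moments q \<phi> x y p \<and> (\<integral>w. p w \<partial>lborel) = 1"
  by (auto simp: primal_feasible_def moments_def moment_integrand_def vec_eq_iff)

lemma lagrangian_feasible:
  assumes "(p, z) \<in> primal_feasible q \<phi> x y"
  shows "lagrangian q q' C \<phi> x y p z \<beta> \<kappa> = primal_objective q q' C p z"
  using assms by (simp add: primal_feasible_iff lagrangian_def zero_ereal_def[symmetric])

context
  fixes q' C :: real
  assumes q': "0 \<le> q'" "q' \<le> 1" and C: "C > 0"
begin

lemma conj_loss_total_le:
  assumes "\<And>i. conj_domain q' C (\<beta> $ i)"
  shows "conj_loss_total q' C \<beta> \<le> loss_part q' C \<beta> z"
  unfolding conj_loss_total_def loss_part_sum by (intro sum_mono conj_loss_le q' C assms)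

lemma conj_loss_total_approx:
  fixes \<beta> :: "real^'m"
  assumes "\<And>i. conj_domain q' C (\<beta> $ i)" and e: "e > 0"
  obtains z where "loss_part q' C \<beta> z \<le> conj_loss_total q' C \<beta> + e"
proof -
  have "\<exists>z. C * exp_q q' (- z) + \<beta> $ i * z < conj_loss q' C (\<beta> $ i) + e / CARD('m)" for i
    using conj_loss_approx[OF q' C assms(1), of "e / CARD('m)" i] e by fastforce
  then obtain f where f: "\<And>i. C * exp_q q' (- f i) + \<beta> $ i * f i < conj_loss q' C (\<beta> $ i) + e / CARD('m)"
    by metis
  have "loss_part q' C \<beta> (\<chi> i. f i) \<le> (\<Sum>i\<in>UNIV. conj_loss q' C (\<beta> $ i) + e / CARD('m))"
    unfolding loss_part_sum by (intro sum_mono) (use f in \<open>simp add: less_imp_le\<close>)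
  thus ?thesis using that[of "\<chi> i. f i"] by (simp add: sum.distrib conj_loss_total_def)
qed

lemma conj_loss_total_subgradient:
  obtains b where "\<And>i. conj_domain q' C (b $ i)" "loss_part q' C b z \<le> conj_loss_total q' C b"
proof -
  have "\<exists>b. conj_domain q' C b \<and> C * exp_q q' (- (z $ i)) + b * z $ i \<le> conj_loss q' C b" for i
    using conj_loss_subgradient[OF q' C, of "z $ i"] by metis
  then obtain f where f: "\<And>i. conj_domain q' C (f i)"
      "\<And>i. C * exp_q q' (- (z $ i)) + f i * z $ i \<le> conj_loss q' C (f i)"
    by metis
  thus ?thesis using that[of "\<chi> i. f i"]
    by (simp add: loss_part_sum conj_loss_total_def sum_mono)
qed

lemma loss_part_unbounded:
  fixes \<beta> :: "real^'m"
  assumes "\<not> conj_domain q' C (\<beta> $ i)"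
  obtains z where "loss_part q' C \<beta> z \<le> M"
proof -
  \<comment> \<open>All coordinates other than i are set to 0, where each loss term is C; m bounds
    their sum.\<close>
  define m where "m = C * real CARD('m)"
  obtain t where t: "C * exp_q q' (- t) + \<beta> $ i * t \<le> M - m"
    using conj_loss_unbounded[OF q' C assms] by blast
  have E0: "exp_q q' 0 = 1" by (simp add: exp_q_def)
  have "loss_part q' C \<beta> (axis i t) = C * exp_q q' (- t) + \<beta> $ i * t + (\<Sum>j\<in>UNIV - {i}. C)"
    unfolding loss_part_sum
    by (subst sum.remove[of _ i]) (auto simp: axis_def E0 intro!: sum.cong)
  also have "(\<Sum>j\<in>UNIV - {i}. C) \<le> m"
    using C by (simp add: m_def mult.commute mult_left_mono)
  finally show ?thesis using that[of "axis i t"] t by linarith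
qed

text \<open>An infimum of functions affine in \<beta> is concave; evaluating all three terms at one
  near-minimizer z for the convex combination proves it up to e.\<close>

lemma conj_loss_total_concave:
  assumes a: "\<And>i. conj_domain q' C (a $ i)" and b: "\<And>i. conj_domain q' C (b $ i)" and t: "0 \<le> t" "t \<le> 1"
  shows "(1 - t) * conj_loss_total q' C a + t * conj_loss_total q' C b \<le>
      conj_loss_total q' C ((1 - t) *\<^sub>R a + t *\<^sub>R b)"
    and "conj_domain q' C (((1 - t) *\<^sub>R a + t *\<^sub>R b) $ i)"
proof -
  have dom: "conj_domain q' C (((1 - t) *\<^sub>R a + t *\<^sub>R b) $ i)" for i
  proof -
    have "(1 - t) * (a $ i) + t * (b $ i) \<le> C" if "a $ i \<le> C" "b $ i \<le> C"
      using convex_bound_le[OF that, of "1 - t" t] t by simp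
    thus ?thesis using a[of i] b[of i] t by (auto simp: conj_domain_def)
  qed
  thus "conj_domain q' C (((1 - t) *\<^sub>R a + t *\<^sub>R b) $ i)" .
  show "(1 - t) * conj_loss_total q' C a + t * conj_loss_total q' C b \<le>
      conj_loss_total q' C ((1 - t) *\<^sub>R a + t *\<^sub>R b)"
  proof (rule field_le_epsilon)
    fix e :: real assume "e > 0"
    from conj_loss_total_approx[OF dom this] obtain z
      where z: "loss_part q' C ((1 - t) *\<^sub>R a + t *\<^sub>R b) z \<le> conj_loss_total q' C ((1 - t) *\<^sub>R a + t *\<^sub>R b) + e" by blast
    have "(1 - t) * conj_loss_total q' C a + t * conj_loss_total q' C b \<le>
        (1 - t) * loss_part q' C a z + t * loss_part q' C b z"
      using t a b by (intro add_mono mult_left_mono conj_loss_total_le) auto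
    also have "\<dots> = loss_part q' C ((1 - t) *\<^sub>R a + t *\<^sub>R b) z"
      by (simp add: loss_part_def inner_add_left algebra_simps)
    finally show "(1 - t) * conj_loss_total q' C a + t * conj_loss_total q' C b \<le>
      conj_loss_total q' C ((1 - t) *\<^sub>R a + t *\<^sub>R b) + e" using z by linarith
  qed
qed

lemma continuous_on_conj_loss: "continuous_on {0..} (conj_loss q' C)"
proof -
  consider "q' = 0" | "q' = 1" | "0 < q'" "q' < 1" using q' by linarith
  thus ?thesis
  proof cases
    case 1
    thus ?thesis by (simp add: conj_loss_def)
  next
    case 2
    have "continuous_on {0..} (\<lambda>p::real. p * ln p)"
      unfolding continuous_on_eq_continuous_within
    proof
      fix p :: real assume p: "p \<in> {0..}"
      show "continuous (at p within {0..}) (\<lambda>p. p * ln p)"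
      proof (cases "p = 0")
        case True
        \<comment> \<open>\<open>ln\<close> is discontinuous at 0, but the product has limit 0,
          which is the value \<open>0 * ln 0\<close>.\<close>
        have "((\<lambda>p::real. p * ln p) \<longlongrightarrow> 0) (at_right 0)" by real_asymp
        thus ?thesis by (simp add: True continuous_within at_within_Ici_at_right)
      next
        case False
        thus ?thesis using p by (intro continuous_intros) auto
      qed
    qed
    moreover have "continuous_on {0..} (\<lambda>b. b / C)" "(\<lambda>b. b / C) ` {0..} \<subseteq> {0..}"
      using C by (auto intro!: continuous_intros)
    ultimately have "continuous_on {0..} (\<lambda>b. b / C * ln (b / C))" by (rule continuous_on_compose2)
    thus ?thesis using C unfolding 2 by (auto simp: conj_loss_def[abs_def] bregman_def intro!: continuous_intros)
  next
    case 3
    have "continuous_on {0..} (\<lambda>b. (b / C) powr (1 / q'))"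
      using 3 C by (intro continuous_on_powr' continuous_intros) auto
    thus ?thesis using 3 C by (auto simp: conj_loss_def[abs_def] bregman_def intro!: continuous_intros)
  qed
qed

lemma continuous_on_conj_loss_total:
  "continuous_on {\<beta>. \<forall>i. 0 \<le> \<beta> $ i} (conj_loss_total q' C)"
  unfolding conj_loss_total_def
  by (intro continuous_on_sum continuous_on_compose2[OF continuous_on_conj_loss] continuous_intros) auto

lemma conj_loss_total_0: "conj_loss_total q' C 0 = 0"
  using q' by (auto simp: conj_loss_total_def conj_loss_def bregman_def)

text \<open>The test vector with entry - 1 at i and 0 elsewhere gives an upper bound decreasing in
  \<beta> $ i. This is the coercivity behind the compactness argument.\<close>

lemma conj_loss_total_neg:
  fixes \<beta> :: "real^'m"
  assumes "\<And>i. conj_domain q' C (\<beta> $ i)" and "C * real CARD('m) + C * exp_q q' 1 < \<beta> $ i"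
  shows "conj_loss_total q' C \<beta> < 0"
proof -
  have E0: "exp_q q' 0 = 1" by (simp add: exp_q_def)
  have "conj_loss_total q' C \<beta> \<le> loss_part q' C \<beta> (axis i (- 1))" by (rule conj_loss_total_le) fact
  also have "\<dots> = C * exp_q q' 1 - \<beta> $ i + (\<Sum>j\<in>UNIV - {i}. C)"
    unfolding loss_part_sum
    by (subst sum.remove[of _ i]) (auto simp: axis_def E0 intro!: sum.cong)
  also have "(\<Sum>j\<in>UNIV - {i}. C) \<le> C * real CARD('m)"
    using C by (simp add: mult.commute mult_left_mono)
  finally show ?thesis using assms(2) by linarith
qed

end

section \<open>Upper and lower bounds for the density part\<close>

context
  fixes \<phi> :: "'d::finite \<Rightarrow> real^'n \<Rightarrow> real" and x :: "'m::finite \<Rightarrow> real^'n" and y :: "'m \<Rightarrow> real"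
    and q :: real and H :: "real^'d^'m"
  assumes q: "1 \<le> q" "q < (2 + real CARD('d)) / real CARD('d)"
    and H: "H = H_matrix \<phi> x y"
begin

lemma inner_moments:
  assumes "p \<in> admissible q \<phi> x y"
  shows "\<beta> \<bullet> moments q \<phi> x y p = (\<integral>w. ((transpose H *v \<beta>) \<bullet> w) * p w powr q \<partial>lborel)"
    and "integrable lborel (\<lambda>w. ((transpose H *v \<beta>) \<bullet> w) * p w powr q)"
proof -
  have int: "integrable lborel (moment_integrand q \<phi> x y p i)" for i
    using assms by (simp add: admissible_def)
  have eq: "((transpose H *v \<beta>) \<bullet> w) * p w powr q = (\<Sum>i\<in>UNIV. \<beta> $ i * moment_integrand q \<phi> x y p i w)" for w
  proof -
    have "(transpose H *v \<beta>) \<bullet> w = \<beta> \<bullet> (H *v w)" by (simp add: dot_lmul_matrix)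
    also have "\<dots> = (\<Sum>i\<in>UNIV. \<beta> $ i * (y i * (feature \<phi> (x i) \<bullet> w)))"
      by (simp add: inner_vec_def[of \<beta>] matrix_vector_mul_component H H_matrix_def)
    finally show ?thesis by (simp add: sum_distrib_right moment_integrand_def mult.assoc)
  qed
  show "integrable lborel (\<lambda>w. ((transpose H *v \<beta>) \<bullet> w) * p w powr q)"
    unfolding eq using int by simp
  show "\<beta> \<bullet> moments q \<phi> x y p = (\<integral>w. ((transpose H *v \<beta>) \<bullet> w) * p w powr q \<partial>lborel)"
    unfolding eq using int by (simp add: inner_vec_def[of \<beta>] moments_def)
qed

lemma posterior_admissible:
  assumes c: "post_scale q H \<beta> > 0"
  shows "posterior q H \<beta> \<in> admissible q \<phi> x y" "(\<integral>w. posterior q H \<beta> w \<partial>lborel) = 1"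
    "tsallis_div q (posterior q H \<beta>) (prior q) \<noteq> \<infinity>"
  using posterior_has_integral[OF q c] posterior_pos[OF q c] posterior_moment_integrable[OF q c]
    posterior_tsallis_finite[OF q c]
  by (auto intro!: admissibleI simp: has_bochner_integral_iff less_imp_le)

lemma density_part_identity:
  assumes c: "post_scale q H \<beta> > 0"
  shows "\<exists>K>0. \<exists>\<kappa>. \<forall>p\<in>admissible q \<phi> x y. tsallis_div q p (prior q) \<noteq> \<infinity> \<longrightarrow>
    integrable lborel (\<lambda>w. bregman q (p w) (posterior q H \<beta> w)) \<and>
    density_part q \<phi> x y \<beta> \<kappa> p = prior_dual q H \<beta> + K * (\<integral>w. bregman q (p w) (posterior q H \<beta> w) \<partial>lborel)"
proof (rule bregman_identity[OF q c])
  fix K \<kappa> :: real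
  assume K: "K > 0" "\<And>p. (\<And>w. 0 \<le> p w) \<Longrightarrow> integrable lborel p \<Longrightarrow>
    integrable lborel (\<lambda>w. ((transpose H *v \<beta>) \<bullet> w) * p w powr q) \<Longrightarrow> tsallis_div q p (prior q) \<noteq> \<infinity> \<Longrightarrow>
    integrable lborel (\<lambda>w. bregman q (p w) (posterior q H \<beta> w)) \<and>
    tsallis_val q p - (\<integral>w. ((transpose H *v \<beta>) \<bullet> w) * p w powr q \<partial>lborel) + \<kappa> * (1 - (\<integral>w. p w \<partial>lborel)) =
    prior_dual q H \<beta> + K * (\<integral>w. bregman q (p w) (posterior q H \<beta> w) \<partial>lborel)"
  have "integrable lborel (\<lambda>w. bregman q (p w) (posterior q H \<beta> w)) \<and>
      density_part q \<phi> x y \<beta> \<kappa> p = prior_dual q H \<beta> + K * (\<integral>w. bregman q (p w) (posterior q H \<beta> w) \<partial>lborel)"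
    if p: "p \<in> admissible q \<phi> x y" "tsallis_div q p (prior q) \<noteq> \<infinity>" for p
    unfolding density_part_def inner_moments(1)[OF p(1)]
    using p inner_moments(2)[OF p(1)] by (intro K(2)) (auto simp: admissible_def)
  with K(1) show ?thesis by blast
qed

lemma bregman_posterior_nonneg:
  assumes c: "post_scale q H \<beta> > 0" and p: "p \<in> admissible q \<phi> x y"
  shows "0 \<le> bregman q (p w) (posterior q H \<beta> w)"
  using bregman_nonneg_eq_0_iff(1)[OF q(1) _ posterior_pos[OF q c]] p by (simp add: admissible_def)

text \<open>For c > 0 the multiplier is the one of the Bregman identity; its value q *
  \<open>c powr r\<close> / (q - 1) becomes 0 at c = 0, and \<kappa> = 0 indeed works there.\<close>

lemma density_part_lower:
  assumes c: "post_scale q H \<beta> \<ge> 0"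
  obtains \<kappa> where "\<And>p. p \<in> admissible q \<phi> x y \<Longrightarrow> tsallis_div q p (prior q) \<noteq> \<infinity> \<Longrightarrow>
    prior_dual q H \<beta> \<le> density_part q \<phi> x y \<beta> \<kappa> p"
proof (cases "post_scale q H \<beta> = 0")
  case True
  hence q1: "q > 1" using post_scale_nonpos_imp[OF q(1), of H \<beta>] by simp
  show thesis
  proof (rule that[of 0])
    fix p assume p: "p \<in> admissible q \<phi> x y" "tsallis_div q p (prior q) \<noteq> \<infinity>"
    show "prior_dual q H \<beta> \<le> density_part q \<phi> x y \<beta> 0 p"
      using boundary_lower_bound(1)[OF q q1 True _ _ inner_moments(2)[OF p(1)] p(2)] p(1)
      unfolding density_part_def inner_moments(1)[OF p(1)] by (simp add: admissible_def)
  qed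
next
  case False
  hence c: "post_scale q H \<beta> > 0" using c by simp
  obtain K \<kappa> where K: "K > 0" "\<forall>p\<in>admissible q \<phi> x y. tsallis_div q p (prior q) \<noteq> \<infinity> \<longrightarrow>
    integrable lborel (\<lambda>w. bregman q (p w) (posterior q H \<beta> w)) \<and>
    density_part q \<phi> x y \<beta> \<kappa> p = prior_dual q H \<beta> + K * (\<integral>w. bregman q (p w) (posterior q H \<beta> w) \<partial>lborel)"
    using density_part_identity[OF c] by blast
  show thesis
  proof (rule that[of \<kappa>])
    fix p assume p: "p \<in> admissible q \<phi> x y" "tsallis_div q p (prior q) \<noteq> \<infinity>"
    have "0 \<le> (\<integral>w. bregman q (p w) (posterior q H \<beta> w) \<partial>lborel)"
      by (intro Bochner_Integration.integral_nonneg bregman_posterior_nonneg c p)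
    thus "prior_dual q H \<beta> \<le> density_part q \<phi> x y \<beta> \<kappa> p" using K p by simp
  qed
qed

text \<open>The Bregman identity provides this for one multiplier only, but a density of mass 1 does
  not see \<kappa>.\<close>

lemma density_part_posterior:
  assumes c: "post_scale q H \<beta> > 0"
  shows "density_part q \<phi> x y \<beta> \<kappa> (posterior q H \<beta>) = prior_dual q H \<beta>"
proof -
  note P = posterior_admissible[OF c]
  have "bregman q (posterior q H \<beta> w) (posterior q H \<beta> w) = 0" for w
    using bregman_nonneg_eq_0_iff(2)[OF q(1) less_imp_le] posterior_pos[OF q c] by simp
  moreover obtain K \<kappa>' where "density_part q \<phi> x y \<beta> \<kappa>' (posterior q H \<beta>) =
      prior_dual q H \<beta> + K * (\<integral>w. bregman q (posterior q H \<beta> w) (posterior q H \<beta> w) \<partial>lborel)"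
    using density_part_identity[OF c] P(1,3) by blast
  ultimately have "density_part q \<phi> x y \<beta> \<kappa>' (posterior q H \<beta>) = prior_dual q H \<beta>" by simp
  thus ?thesis by (simp add: density_part_normalized[OF P(2)])
qed

text \<open>The bound must hold for every \<kappa>. At c = 0 there is no posterior to insert: for
  \<kappa> > 0 the density part is unbounded below, and for \<kappa> \<le> 0 the zero function has
  the value - 1 / (q - 1) + \<kappa>.\<close>

lemma density_part_upper:
  assumes c: "post_scale q H \<beta> \<ge> 0"
  obtains p where "p \<in> admissible q \<phi> x y" "tsallis_div q p (prior q) \<noteq> \<infinity>"
    "density_part q \<phi> x y \<beta> \<kappa> p \<le> prior_dual q H \<beta>"
proof (cases "post_scale q H \<beta> = 0")
  case False
  hence c: "post_scale q H \<beta> > 0" using c by simp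
  show thesis
    using that[OF posterior_admissible(1,3)[OF c]] density_part_posterior[OF c] by simp
next
  case c0: True
  hence q1: "q > 1" using post_scale_nonpos_imp[OF q(1), of H \<beta>] by simp
  show thesis
  proof (cases "\<kappa> > 0")
    case True
    have c': "post_scale q H \<beta> < 0 \<or> post_scale q H \<beta> = 0 \<and> \<kappa> > 0" using c0 True by simp
    obtain p where p: "\<And>w. 0 \<le> p w" "integrable lborel p" "\<And>v. integrable lborel (\<lambda>w. (v \<bullet> w) * p w powr q)"
      "tsallis_div q p (prior q) \<noteq> \<infinity>"
      "tsallis_val q p - (\<integral>w. ((transpose H *v \<beta>) \<bullet> w) * p w powr q \<partial>lborel) + \<kappa> * (1 - (\<integral>w. p w \<partial>lborel)) \<le> prior_dual q H \<beta>"
      by (rule density_part_unbounded[OF q q1 c']) blast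
    have "p \<in> admissible q \<phi> x y" by (rule admissibleI) (rule p)+
    thus thesis
      using that p(4,5) by (simp add: density_part_def inner_moments(1))
  next
    case False
    have "density_part q \<phi> x y \<beta> \<kappa> (\<lambda>w. 0) \<le> prior_dual q H \<beta>"
      using q1 c0 False
      by (simp add: density_part_def inner_moments(1)[OF zero_admissible(1)] tsallis_div_def prior_dual_def)
    thus thesis using that zero_admissible by blast
  qed
qed

lemma density_part_neg:
  assumes c: "post_scale q H \<beta> < 0"
  obtains p where "p \<in> admissible q \<phi> x y" "tsallis_div q p (prior q) \<noteq> \<infinity>"
    "density_part q \<phi> x y \<beta> \<kappa> p \<le> B"
proof -
  have q1: "q > 1" using post_scale_nonpos_imp[OF q(1), of H \<beta>] c by simp
  have c': "post_scale q H \<beta> < 0 \<or> post_scale q H \<beta> = 0 \<and> \<kappa> > 0" using c by simp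
  obtain p where p: "\<And>w. 0 \<le> p w" "integrable lborel p" "\<And>v. integrable lborel (\<lambda>w. (v \<bullet> w) * p w powr q)"
    "tsallis_div q p (prior q) \<noteq> \<infinity>"
    "tsallis_val q p - (\<integral>w. ((transpose H *v \<beta>) \<bullet> w) * p w powr q \<partial>lborel) + \<kappa> * (1 - (\<integral>w. p w \<partial>lborel)) \<le> B"
    by (rule density_part_unbounded[OF q q1 c']) blast
  have "p \<in> admissible q \<phi> x y" by (rule admissibleI) (rule p)+
    thus thesis
    using that p(4,5) by (simp add: density_part_def inner_moments(1))
qed

end

subsection \<open>The Lagrange dual problem\<close>

lemma transpose_mv_scaleR: "transpose H *v (s *\<^sub>R \<beta>) = s *\<^sub>R (transpose H *v \<beta>)"
  for H :: "real^'d^'m" and s :: real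
  by (simp only: matrix_vector_mult_scaleR)

lemma dual_arg_scaleR: "dual_arg q H (s *\<^sub>R \<beta>) = s\<^sup>2 * dual_arg q H \<beta>"
  for H :: "real^'d^'m"
  unfolding dual_arg_def transpose_mv_scaleR by (simp add: power_mult_distrib)

lemma norm_transpose_line:
  fixes H :: "real^'d^'m"
  shows "(norm (transpose H *v (\<beta> + t *\<^sub>R \<delta>)))\<^sup>2 = (norm (transpose H *v \<beta>))\<^sup>2 +
    2 * ((transpose H *v \<beta>) \<bullet> (transpose H *v \<delta>)) * t + (norm (transpose H *v \<delta>))\<^sup>2 * t\<^sup>2"
  unfolding matrix_vector_right_distrib transpose_mv_scaleR power2_norm_eq_inner
  by (simp add: inner_add_left inner_add_right inner_commute power2_eq_square algebra_simps)

lemma dual_arg_line: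
  fixes H :: "real^'d^'m"
  shows "\<exists>a b. \<forall>t. dual_arg q H (\<beta> + t *\<^sub>R \<delta>) = dual_arg q H \<beta> + a * t + b * t\<^sup>2"
proof (intro exI allI)
  fix t
  define k where "k = dual_exponent CARD('d) q / 2 * Z0 CARD('d) q powr (2 * (1 - q))"
  show "dual_arg q H (\<beta> + t *\<^sub>R \<delta>) = dual_arg q H \<beta> +
      (dual_exponent CARD('d) q / 2 * Z0 CARD('d) q powr (2 * (1 - q)) * (2 * ((transpose H *v \<beta>) \<bullet> (transpose H *v \<delta>)))) * t +
      (dual_exponent CARD('d) q / 2 * Z0 CARD('d) q powr (2 * (1 - q)) * (norm (transpose H *v \<delta>))\<^sup>2) * t\<^sup>2"
    unfolding dual_arg_def norm_transpose_line k_def[symmetric] by (simp add: algebra_simps)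
qed

section \<open>The density part of the dual as a function of the multipliers\<close>

context
  fixes q :: real and H :: "real^'d^'m"
  assumes q: "1 \<le> q" "q < (2 + real CARD('d)) / real CARD('d)"
begin

lemma dual_domain_iff: "\<beta> \<in> dual_domain q H \<longleftrightarrow> (\<forall>i. 0 \<le> \<beta> $ i) \<and> 0 \<le> post_scale q H \<beta>"
  by (simp add: dual_domain_def post_scale_eq_dual_arg[OF q])

lemma post_scale_scaleR: "post_scale q H (s *\<^sub>R \<beta>) = 1 - s\<^sup>2 * (1 - post_scale q H \<beta>)"
  unfolding post_scale_eq_dual_arg[OF q, symmetric] dual_arg_scaleR by (simp add: algebra_simps)

lemma post_scale_le_1: "post_scale q H \<beta> \<le> 1"
proof (cases "q = 1")
  case False
  hence "q > 1" using q by simp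
  from nu_pos[OF this q(2)] show ?thesis by (simp add: post_scale_def)
qed (simp add: post_scale_def)

lemma continuous_on_transpose_mv: "continuous_on S (\<lambda>\<beta>. transpose H *v \<beta>)"
  by (intro linear_continuous_on matrix_vector_mul_bounded_linear)

lemma continuous_on_dual_arg: "continuous_on S (dual_arg q H)"
  unfolding dual_arg_def by (intro continuous_intros continuous_on_transpose_mv)

lemma continuous_on_post_scale: "continuous_on S (post_scale q H)"
  unfolding post_scale_eq_dual_arg[OF q, symmetric, abs_def]
  by (intro continuous_intros continuous_on_dual_arg)

lemma continuous_on_prior_dual: "continuous_on {\<beta>. 0 \<le> post_scale q H \<beta>} (prior_dual q H)"
proof (cases "q = 1")
  case True
  have "continuous_on S (\<lambda>\<beta>. - ((norm (transpose H *v \<beta>))\<^sup>2 / 2))" for S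
    by (intro continuous_intros continuous_on_transpose_mv) simp
  thus ?thesis unfolding prior_dual_def True by simp
next
  case False
  hence "q > 1" using q by simp
  with dual_exponent_bounds(1)[OF this q(2)] show ?thesis unfolding prior_dual_def
    by (auto intro!: continuous_intros continuous_on_powr' continuous_on_post_scale)
qed

lemma prior_dual_nonpos:
  assumes "0 \<le> post_scale q H \<beta>"
  shows "prior_dual q H \<beta> \<le> 0"
proof (cases "q = 1")
  case False
  hence q1: "q > 1" using q by simp
  have "post_scale q H \<beta> powr dual_exponent CARD('d) q \<le> 1"
    using assms post_scale_le_1 dual_exponent_bounds(1)[OF q1 q(2)] by (intro powr_le1) auto
  thus ?thesis using q1 by (simp add: prior_dual_def divide_nonpos_pos)
qed (simp add: prior_dual_def)

lemma prior_dual_0: "prior_dual q H 0 = 0" "post_scale q H 0 = 1"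
proof -
  show "post_scale q H 0 = 1" using post_scale_scaleR[of 0 0] by simp
  thus "prior_dual q H 0 = 0" by (simp add: prior_dual_def)
qed

text \<open>Only existence of the derivative is stated; its value is found later by comparison with
  the supergradient, which avoids differentiating the moments.\<close>

lemma prior_dual_line_derivative:
  assumes c: "post_scale q H \<beta> > 0"
  obtains D where "((\<lambda>t. prior_dual q H (\<beta> + t *\<^sub>R \<delta>)) has_real_derivative D) (at 0)"
proof -
  obtain a b where ab: "dual_arg q H (\<beta> + t *\<^sub>R \<delta>) = dual_arg q H \<beta> + a * t + b * t\<^sup>2" for t
    using dual_arg_line[of q H \<beta> \<delta>] by blast
  show thesis
  proof (cases "q = 1")
    case True
    define k where "k = (transpose H *v \<beta>) \<bullet> (transpose H *v \<delta>)"
    define l m where "l = (norm (transpose H *v \<beta>))\<^sup>2" and "m = (norm (transpose H *v \<delta>))\<^sup>2"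
    have "((\<lambda>t. - ((l + 2 * k * t + m * t\<^sup>2) / 2)) has_real_derivative - k) (at 0)"
      by (auto intro!: derivative_eq_intros)
    moreover have "prior_dual q H (\<beta> + t *\<^sub>R \<delta>) = - ((l + 2 * k * t + m * t\<^sup>2) / 2)" for t
      unfolding prior_dual_def True norm_transpose_line k_def l_def m_def by simp
    ultimately show ?thesis using that[of "- k"] by simp
  next
    case False
    define f where "f t = 1 + (1 - q) * (dual_arg q H \<beta> + a * t + b * t\<^sup>2)" for t
    have f0: "f 0 > 0" using c by (simp add: f_def post_scale_eq_dual_arg[OF q])
    have "(f has_real_derivative (1 - q) * a) (at 0)"
      unfolding f_def by (auto intro!: derivative_eq_intros)
    from DERIV_powr[OF this f0 DERIV_const[of "dual_exponent CARD('d) q"]]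
    obtain E where "((\<lambda>t. f t powr dual_exponent CARD('d) q) has_real_derivative E) (at 0)" by blast
    hence "((\<lambda>t. (f t powr dual_exponent CARD('d) q - 1) / (q - 1)) has_real_derivative (E - 0) / (q - 1)) (at 0)"
      by (intro DERIV_cdivide DERIV_diff DERIV_const)
    moreover have "prior_dual q H (\<beta> + t *\<^sub>R \<delta>) = (f t powr dual_exponent CARD('d) q - 1) / (q - 1)" for t
    proof -
      have "post_scale q H (\<beta> + t *\<^sub>R \<delta>) = f t"
        unfolding f_def ab[symmetric] by (rule post_scale_eq_dual_arg[OF q, symmetric])
      thus ?thesis using False by (simp add: prior_dual_def)
    qed
    ultimately show ?thesis using that[of "(E - 0) / (q - 1)"] by simp
  qed
qed

lemma eventually_post_scale_line_pos:
  assumes "post_scale q H \<beta> > 0"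
  shows "\<forall>\<^sub>F t in at 0. post_scale q H (\<beta> + t *\<^sub>R \<delta>) > 0"
proof -
  have "isCont (\<lambda>t. post_scale q H (\<beta> + t *\<^sub>R \<delta>)) 0"
    by (intro continuous_on_interior[of UNIV] continuous_on_compose2[OF continuous_on_post_scale[of UNIV]] continuous_intros) auto
  hence "((\<lambda>t. post_scale q H (\<beta> + t *\<^sub>R \<delta>)) \<longlongrightarrow> post_scale q H \<beta>) (at 0)"
    by (simp add: isCont_def)
  from order_tendstoD(1)[OF this assms] show ?thesis .
qed

end

section \<open>Dual function, dual maximum and saddle point\<close>

definition dual_feasible :: "real \<Rightarrow> real \<Rightarrow> real \<Rightarrow> real^'d^'m \<Rightarrow> (real^'m) set" where
  "dual_feasible q q' C H = {\<beta>. (\<forall>i. conj_domain q' C (\<beta> $ i)) \<and> 0 \<le> post_scale q H \<beta>}"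

definition dual_value :: "real \<Rightarrow> real \<Rightarrow> real \<Rightarrow> real^'d^'m \<Rightarrow> real^'m \<Rightarrow> real" where
  "dual_value q q' C H \<beta> = prior_dual q H \<beta> + conj_loss_total q' C \<beta>"

context
  fixes \<phi> :: "'d::finite \<Rightarrow> real^'n \<Rightarrow> real" and x :: "'m::finite \<Rightarrow> real^'n" and y :: "'m \<Rightarrow> real"
    and q q' C :: real and H :: "real^'d^'m"
  assumes q: "1 \<le> q" "q < (2 + real CARD('d)) / real CARD('d)"
    and q': "0 \<le> q'" "q' \<le> 1" and C: "C > 0"
    and H: "H = H_matrix \<phi> x y"
begin

lemma dual_feasible_imp_domain: "\<beta> \<in> dual_feasible q q' C H \<Longrightarrow> \<beta> \<in> dual_domain q H"
  by (auto simp: dual_feasible_def dual_domain_iff[OF q] conj_domain_def)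

lemma dual_objective_eq:
  assumes "\<beta> \<in> dual_domain q H"
  shows "dual_objective q q' C H \<beta> =
    (if \<beta> \<in> dual_feasible q q' C H then ereal (C * real CARD('m) - dual_value q q' C H \<beta>) else \<infinity>)"
proof -
  have \<beta>: "\<forall>i. 0 \<le> \<beta> $ i" "0 \<le> post_scale q H \<beta>" using assms by (simp_all add: dual_domain_iff[OF q])
  show ?thesis
    unfolding dual_objective_def ln_q_exp_q_dual_arg[OF q \<beta>(2)] dual_loss_eq[OF q' C \<beta>(1)]
    using \<beta>(2) by (simp add: dual_feasible_def dual_value_def)
qed

lemma lagrange_dual_le:
  assumes "p \<in> admissible q \<phi> x y" "tsallis_div q p (prior q) \<noteq> \<infinity>"
    and "density_part q \<phi> x y \<beta> \<kappa> p + loss_part q' C \<beta> z \<le> M"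
  shows "lagrange_dual q q' C \<phi> x y \<beta> \<kappa> \<le> ereal M"
  unfolding lagrange_dual_def
  using assms by (intro INF_lower2[of p] INF_lower2[of z]) (auto simp: lagrangian_eq)

text \<open>The infima over p and z decouple. One \<kappa> attains the value
  (\<open>density_part_lower\<close>) and none exceeds it (\<open>density_part_upper\<close>). For
  infeasible \<beta> one part is driven to - \<infinity> while the other is frozen at p = 0 or z =
  0.\<close>

lemma SUP_lagrange_dual:
  "(SUP \<kappa>. lagrange_dual q q' C \<phi> x y \<beta> \<kappa>) = (if \<beta> \<in> dual_feasible q q' C H then ereal (dual_value q q' C H \<beta>) else - \<infinity>)"
proof -
  have unbounded: "(SUP \<kappa>. lagrange_dual q q' C \<phi> x y \<beta> \<kappa>) = - \<infinity>"
    if "\<And>\<kappa> M. \<exists>p\<in>admissible q \<phi> x y. \<exists>z. tsallis_div q p (prior q) \<noteq> \<infinity> \<and>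
      density_part q \<phi> x y \<beta> \<kappa> p + loss_part q' C \<beta> z \<le> M"
  proof -
    have "lagrange_dual q q' C \<phi> x y \<beta> \<kappa> \<le> ereal M" for \<kappa> M
      using that[of \<kappa> M] lagrange_dual_le by blast
    hence "lagrange_dual q q' C \<phi> x y \<beta> \<kappa> = - \<infinity>" for \<kappa>
      by (rule ereal_bot)
    thus ?thesis by simp
  qed
  show ?thesis
  proof (cases "\<beta> \<in> dual_feasible q q' C H")
    case True
    hence dom: "\<And>i. conj_domain q' C (\<beta> $ i)" and c: "0 \<le> post_scale q H \<beta>" by (auto simp: dual_feasible_def)
    have "(SUP \<kappa>. lagrange_dual q q' C \<phi> x y \<beta> \<kappa>) = ereal (dual_value q q' C H \<beta>)"
    proof (rule antisym)
      show "(SUP \<kappa>. lagrange_dual q q' C \<phi> x y \<beta> \<kappa>) \<le> ereal (dual_value q q' C H \<beta>)"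
      proof (rule SUP_least)
        fix \<kappa>
        have "lagrange_dual q q' C \<phi> x y \<beta> \<kappa> \<le> ereal (dual_value q q' C H \<beta>) + ereal e" if "0 < e" for e
        proof -
          from conj_loss_total_approx[OF q' C dom that]
          obtain z where z: "loss_part q' C \<beta> z \<le> conj_loss_total q' C \<beta> + e" by blast
          obtain p where p: "p \<in> admissible q \<phi> x y" "tsallis_div q p (prior q) \<noteq> \<infinity>"
              "density_part q \<phi> x y \<beta> \<kappa> p \<le> prior_dual q H \<beta>"
            by (rule density_part_upper[OF q H c])
          have "density_part q \<phi> x y \<beta> \<kappa> p + loss_part q' C \<beta> z \<le> dual_value q q' C H \<beta> + e"
            using z p(3) by (simp add: dual_value_def)
          from lagrange_dual_le[OF p(1,2) this] show ?thesis by simp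
        qed
        thus "lagrange_dual q q' C \<phi> x y \<beta> \<kappa> \<le> ereal (dual_value q q' C H \<beta>)"
          by (simp add: ereal_le_epsilon2)
      qed
      obtain \<kappa> where \<kappa>: "\<And>p. p \<in> admissible q \<phi> x y \<Longrightarrow> tsallis_div q p (prior q) \<noteq> \<infinity> \<Longrightarrow>
          prior_dual q H \<beta> \<le> density_part q \<phi> x y \<beta> \<kappa> p"
        by (rule density_part_lower[OF q H c]) blast
      have "ereal (dual_value q q' C H \<beta>) \<le> lagrange_dual q q' C \<phi> x y \<beta> \<kappa>"
        unfolding lagrange_dual_def dual_value_def lagrangian_eq
        by (intro INF_greatest) (auto intro!: add_mono \<kappa> conj_loss_total_le[OF q' C] dom)
      thus "ereal (dual_value q q' C H \<beta>) \<le> (SUP \<kappa>. lagrange_dual q q' C \<phi> x y \<beta> \<kappa>)"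
        by (rule SUP_upper2[OF UNIV_I])
    qed
    thus ?thesis using True by simp
  next
    case False
    have "(SUP \<kappa>. lagrange_dual q q' C \<phi> x y \<beta> \<kappa>) = - \<infinity>"
    proof (cases "\<forall>i. conj_domain q' C (\<beta> $ i)")
      case True
      hence c: "post_scale q H \<beta> < 0" using False by (auto simp: dual_feasible_def)
      show ?thesis
      proof (rule unbounded)
        fix \<kappa> M
        obtain p where p: "p \<in> admissible q \<phi> x y" "tsallis_div q p (prior q) \<noteq> \<infinity>"
            "density_part q \<phi> x y \<beta> \<kappa> p \<le> M - loss_part q' C \<beta> 0"
          by (rule density_part_neg[OF q H c])
        thus "\<exists>p\<in>admissible q \<phi> x y. \<exists>z. tsallis_div q p (prior q) \<noteq> \<infinity> \<and>
            density_part q \<phi> x y \<beta> \<kappa> p + loss_part q' C \<beta> z \<le> M"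
          by (intro bexI[of _ p] exI[of _ 0]) auto
      qed
    next
      case False
      then obtain i where i: "\<not> conj_domain q' C (\<beta> $ i)" by blast
      show ?thesis
      proof (rule unbounded)
        fix \<kappa> M
        obtain z where "loss_part q' C \<beta> z \<le> M - density_part q \<phi> x y \<beta> \<kappa> (\<lambda>w. 0)"
          by (rule loss_part_unbounded[OF q' C i])
        thus "\<exists>p\<in>admissible q \<phi> x y. \<exists>z. tsallis_div q p (prior q) \<noteq> \<infinity> \<and>
            density_part q \<phi> x y \<beta> \<kappa> p + loss_part q' C \<beta> z \<le> M"
          using zero_admissible(1)[of q \<phi> x y] zero_admissible(2)[where 'd = 'd, of q] by (intro bexI[of _ "\<lambda>w. 0"] exI[of _ z]) auto
      qed
    qed
    thus ?thesis using False by simp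
  qed
qed

text \<open>If a coordinate exceeds R, both parts of the dual value are at most 0 and their sum is
  negative, whereas \<beta> = 0 has the value 0. So the maximum over the compact part with
  coordinates at most R is global.\<close>

lemma dual_maximum_exists: "\<exists>\<beta>\<in>dual_feasible q q' C H. \<forall>\<beta>'\<in>dual_feasible q q' C H. dual_value q q' C H \<beta>' \<le> dual_value q q' C H \<beta>"
proof -
  define R where "R = C * real CARD('m) + C * exp_q q' 1"
  have E1: "exp_q q' 1 \<ge> 0" by (simp add: exp_q_def)
  have R: "R \<ge> 0" using C E1 by (simp add: R_def)
  define S where "S = dual_feasible q q' C H \<inter> {\<beta>. \<forall>i. \<beta> $ i \<le> R}"
  have sub: "S \<subseteq> {\<beta>. 0 \<le> post_scale q H \<beta>}" "S \<subseteq> {\<beta>. \<forall>i. 0 \<le> \<beta> $ i}"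
    by (auto simp: S_def dual_feasible_def conj_domain_def)
  have "S = cbox 0 (\<chi> i. if q' = 0 then min C R else R) \<inter> {\<beta>. 0 \<le> post_scale q H \<beta>}"
    by (auto simp: S_def dual_feasible_def conj_domain_def mem_box_cart)
  hence "compact S"
    by (simp add: compact_Int_closed closed_Collect_le continuous_on_post_scale[OF q])
  moreover have "0 \<in> S"
    using R C by (simp add: S_def dual_feasible_def conj_domain_def prior_dual_0[OF q])
  moreover have "continuous_on S (dual_value q q' C H)"
    unfolding dual_value_def using sub
    by (intro continuous_on_add continuous_on_subset[OF continuous_on_prior_dual[OF q]]
        continuous_on_subset[OF continuous_on_conj_loss_total[OF q' C]])
  ultimately obtain \<beta> where \<beta>: "\<beta> \<in> S" "\<And>\<beta>'. \<beta>' \<in> S \<Longrightarrow> dual_value q q' C H \<beta>' \<le> dual_value q q' C H \<beta>"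
    using continuous_attains_sup[of S "dual_value q q' C H"] by blast
  have "dual_value q q' C H \<beta>' \<le> dual_value q q' C H \<beta>" if f: "\<beta>' \<in> dual_feasible q q' C H" for \<beta>'
  proof (cases "\<beta>' \<in> S")
    case False
    then obtain i where "R < \<beta>' $ i" using f by (auto simp: S_def not_le)
    hence "conj_loss_total q' C \<beta>' < 0"
      using f unfolding R_def by (intro conj_loss_total_neg[OF q' C]) (auto simp: dual_feasible_def)
    moreover have "prior_dual q H \<beta>' \<le> 0" using f by (intro prior_dual_nonpos[OF q]) (simp add: dual_feasible_def)
    moreover have "0 \<le> dual_value q q' C H \<beta>"
      using \<beta>(2)[OF \<open>0 \<in> S\<close>] by (simp add: dual_value_def prior_dual_0[OF q] conj_loss_total_0[OF q' C])
    ultimately show ?thesis by (simp add: dual_value_def)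
  qed (rule \<beta>(2))
  thus ?thesis using \<beta>(1) by (auto simp: S_def)
qed

text \<open>The dual objective is infinite on the domain outside \<open>dual_feasible\<close> and
  finite on this nonempty set, so a minimizer must lie in it.\<close>

lemma dual_solution_iff:
  "dual_solution q q' C H \<beta> \<longleftrightarrow>
    \<beta> \<in> dual_feasible q q' C H \<and> (\<forall>\<beta>'\<in>dual_feasible q q' C H. dual_value q q' C H \<beta>' \<le> dual_value q q' C H \<beta>)"
proof
  assume sol: "dual_solution q q' C H \<beta>"
  hence dom: "\<beta> \<in> dual_domain q H" by (simp add: dual_solution_def)
  obtain \<beta>0 where \<beta>0: "\<beta>0 \<in> dual_feasible q q' C H" using dual_maximum_exists by blast
  have *: "dual_objective q q' C H \<beta> \<le> dual_objective q q' C H \<beta>'" if "\<beta>' \<in> dual_feasible q q' C H" for \<beta>'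
    using sol dual_feasible_imp_domain[OF that] by (simp add: dual_solution_def)
  from *[OF \<beta>0] \<beta>0 have f: "\<beta> \<in> dual_feasible q q' C H"
    by (auto simp: dual_objective_eq dom dual_feasible_imp_domain split: if_splits)
  thus "\<beta> \<in> dual_feasible q q' C H \<and> (\<forall>\<beta>'\<in>dual_feasible q q' C H. dual_value q q' C H \<beta>' \<le> dual_value q q' C H \<beta>)"
    using * by (auto simp: dual_objective_eq dual_feasible_imp_domain)
next
  assume "\<beta> \<in> dual_feasible q q' C H \<and> (\<forall>\<beta>'\<in>dual_feasible q q' C H. dual_value q q' C H \<beta>' \<le> dual_value q q' C H \<beta>)"
  thus "dual_solution q q' C H \<beta>"
    by (auto simp: dual_solution_def dual_objective_eq dual_feasible_imp_domain)
qed

text \<open>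
  On the boundary \<open>post_scale = 0\<close> shrinking \<open>\<beta>\<close> by a factor \<open>1 - t\<close> gains at least
  \<open>t powr r / (q - 1)\<close> with \<open>r < 1\<close>, but loses at most a multiple of \<open>t\<close>.
\<close>
lemma dual_maximum_interior:
  assumes f: "\<beta> \<in> dual_feasible q q' C H" and max: "\<And>\<beta>'. \<beta>' \<in> dual_feasible q q' C H \<Longrightarrow> dual_value q q' C H \<beta>' \<le> dual_value q q' C H \<beta>"
  shows "0 < post_scale q H \<beta>"
proof (rule ccontr)
  assume "\<not> 0 < post_scale q H \<beta>"
  hence c: "post_scale q H \<beta> = 0" using f by (simp add: dual_feasible_def)
  hence q1: "q > 1" using post_scale_nonpos_imp[OF q(1), of H \<beta>] by simp
  define r where "r = dual_exponent CARD('d) q"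
  define V where "V = conj_loss_total q' C \<beta>"
  have r: "0 < r" "r < 1" using dual_exponent_bounds[OF q1 q(2)] by (simp_all add: r_def)
  have le: "t powr (r - 1) \<le> V * (q - 1)" if t: "0 < t" "t \<le> 1" for t
  proof -
    \<comment> \<open>Written as a convex combination with 0, so that concavity of the loss
      conjugate bounds the loss by t * V.\<close>
    define \<beta>' where "\<beta>' = (1 - t) *\<^sub>R \<beta> + t *\<^sub>R 0"
    have dom: "\<And>i. conj_domain q' C (\<beta> $ i)" "\<And>i. conj_domain q' C ((0 :: real^'m) $ i)"
      using f C by (auto simp: dual_feasible_def conj_domain_def)
    note concave = conj_loss_total_concave[OF q' C dom, of t, folded \<beta>'_def]
    have "post_scale q H \<beta>' = 1 - (1 - t)\<^sup>2" by (simp add: \<beta>'_def post_scale_scaleR[OF q] c)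
    hence "post_scale q H \<beta>' = t + t * (1 - t)" by (simp add: power2_eq_square algebra_simps)
    moreover have "0 \<le> t * (1 - t)" using t by simp
    ultimately have c': "t \<le> post_scale q H \<beta>'" by linarith
    have "\<beta>' \<in> dual_feasible q q' C H" using concave(2) t c' by (simp add: dual_feasible_def)
    from max[OF this] have "prior_dual q H \<beta>' + (1 - t) * V \<le> prior_dual q H \<beta> + V"
      using concave(1) t by (simp add: dual_value_def V_def conj_loss_total_0[OF q' C])
    moreover have "(t powr r - 1) / (q - 1) \<le> prior_dual q H \<beta>'"
      using c' t r q1 by (simp add: prior_dual_def r_def[symmetric] divide_right_mono powr_mono2)
    moreover have "prior_dual q H \<beta> = (0 - 1) / (q - 1)" using c q1 by (simp add: prior_dual_def)
    ultimately have "t powr r / (q - 1) \<le> t * V" by (simp add: diff_divide_distrib algebra_simps)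
    hence "t powr r \<le> t * (V * (q - 1))" using q1 by (simp add: pos_divide_le_eq mult.assoc)
    thus ?thesis using t by (simp add: powr_diff pos_divide_le_eq mult.commute)
  qed
  have "filterlim (\<lambda>t. t powr (r - 1)) at_top (at_right 0)" using r by real_asymp
  hence "\<forall>\<^sub>F t in at_right 0. V * (q - 1) < t powr (r - 1)"
    unfolding filterlim_at_top_dense by blast
  moreover have "\<forall>\<^sub>F t in at_right (0::real). 0 < t" by (rule eventually_at_right_less)
  moreover have "\<forall>\<^sub>F t in at_right (0::real). t < 1"
    by (rule order_tendstoD(2)[OF tendsto_ident_at]) simp
  ultimately have "\<forall>\<^sub>F t in at_right (0::real). False"
    by eventually_elim (use le in \<open>force simp: not_le[symmetric]\<close>)
  thus False by simp
qed

text \<open>Along the segment from \<beta> to b the density part has derivative - (\<delta>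
  \<bullet> z) at \<beta>. Maximality bounds its growth by the change of the loss conjugate, which
  is estimated through concavity alone because it need not be differentiable at \<beta>.\<close>

lemma dual_maximum_subgradient:
  assumes f: "\<beta> \<in> dual_feasible q q' C H" and max: "\<And>\<beta>'. \<beta>' \<in> dual_feasible q q' C H \<Longrightarrow> dual_value q q' C H \<beta>' \<le> dual_value q q' C H \<beta>"
    and b: "\<And>i. conj_domain q' C (b $ i)"
  defines "z \<equiv> moments q \<phi> x y (posterior q H \<beta>)"
  shows "conj_loss_total q' C b - conj_loss_total q' C \<beta> \<le> (b - \<beta>) \<bullet> z"
proof -
  define \<delta> where "\<delta> = b - \<beta>"
  define T where "T t = prior_dual q H (\<beta> + t *\<^sub>R \<delta>)" for t
  have c: "0 < post_scale q H \<beta>" by (rule dual_maximum_interior[OF f max])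
  have dom: "\<And>i. conj_domain q' C (\<beta> $ i)" using f by (simp add: dual_feasible_def)
  note P = posterior_admissible[OF q H c]
  note ev = eventually_post_scale_line_pos[OF q c, of \<delta>]
  have T0: "T 0 = tsallis_val q (posterior q H \<beta>) - \<beta> \<bullet> z"
    using density_part_posterior[OF q H c, of 0] by (simp add: T_def density_part_normalized[OF P(2)] z_def)
  obtain D where D: "(T has_real_derivative D) (at 0)"
    unfolding T_def by (rule prior_dual_line_derivative[OF q c])
  have "\<forall>\<^sub>F t in at 0. T t + t * (\<delta> \<bullet> z) \<le> T 0"
    using ev
  proof eventually_elim
    case (elim t)
    obtain \<kappa> where "\<And>p. p \<in> admissible q \<phi> x y \<Longrightarrow> tsallis_div q p (prior q) \<noteq> \<infinity> \<Longrightarrow>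
        T t \<le> density_part q \<phi> x y (\<beta> + t *\<^sub>R \<delta>) \<kappa> p"
      unfolding T_def by (rule density_part_lower[OF q H less_imp_le[OF elim]]) blast
    \<comment> \<open>The posterior at \<beta> is a competitor at \<beta> + t \<delta>; its density
      part is affine in t and touches T from above at t = 0.\<close>
    from this[OF P(1,3)] have "T t \<le> tsallis_val q (posterior q H \<beta>) - (\<beta> + t *\<^sub>R \<delta>) \<bullet> z"
      by (simp add: density_part_normalized[OF P(2)] z_def)
    thus ?case by (simp add: T0 inner_add_left)
  qed
  then obtain d where d: "d > 0" "\<And>t. t \<noteq> 0 \<Longrightarrow> dist t 0 < d \<Longrightarrow> T t + t * (\<delta> \<bullet> z) \<le> T 0"
    unfolding eventually_at by blast
  have "((\<lambda>t. T t + t * (\<delta> \<bullet> z)) has_real_derivative D + \<delta> \<bullet> z) (at 0)"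
    using D by (auto intro!: derivative_eq_intros)
  hence "D + \<delta> \<bullet> z = 0"
  proof (rule DERIV_local_max[OF _ d(1)])
    show "\<forall>t. \<bar>0 - t\<bar> < d \<longrightarrow> T t + t * (\<delta> \<bullet> z) \<le> T 0 + 0 * (\<delta> \<bullet> z)"
    proof (intro allI impI)
      fix t assume "\<bar>0 - t\<bar> < d"
      thus "T t + t * (\<delta> \<bullet> z) \<le> T 0 + 0 * (\<delta> \<bullet> z)"
        using d(2)[of t] by (cases "t = 0") (simp_all add: dist_real_def)
    qed
  qed
  hence D_eq: "D = - (\<delta> \<bullet> z)" by simp
  \<comment> \<open>Only t > 0 is used: for small t the points stay between \<beta> and b, hence
    dual feasible, whereas backward steps may leave the domain.\<close>
  have "D \<le> conj_loss_total q' C \<beta> - conj_loss_total q' C b"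
  proof (rule tendsto_upperbound)
    have "((\<lambda>t. (T (0 + t) - T 0) / t) \<longlongrightarrow> D) (at 0)" using D by (simp only: DERIV_def)
    thus "((\<lambda>t. (T t - T 0) / t) \<longlongrightarrow> D) (at_right 0)" by (simp add: filterlim_at_split)
    have "\<forall>\<^sub>F t in at_right 0. 0 < post_scale q H (\<beta> + t *\<^sub>R \<delta>)"
      using ev by (simp add: eventually_at_split)
    moreover have "\<forall>\<^sub>F t in at_right (0::real). 0 < t" by (rule eventually_at_right_less)
    moreover have "\<forall>\<^sub>F t in at_right (0::real). t < 1"
      by (rule order_tendstoD(2)[OF tendsto_ident_at]) simp
    ultimately show "\<forall>\<^sub>F t in at_right 0. (T t - T 0) / t \<le> conj_loss_total q' C \<beta> - conj_loss_total q' C b"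
    proof eventually_elim
      case (elim t)
      have eq: "\<beta> + t *\<^sub>R \<delta> = (1 - t) *\<^sub>R \<beta> + t *\<^sub>R b" by (simp add: \<delta>_def algebra_simps)
      note concave = conj_loss_total_concave[OF q' C dom b, of t, folded eq]
      have "\<beta> + t *\<^sub>R \<delta> \<in> dual_feasible q q' C H" using elim concave(2) by (simp add: dual_feasible_def)
      from max[OF this] concave(1) elim
      have "T t + ((1 - t) * conj_loss_total q' C \<beta> + t * conj_loss_total q' C b) \<le> T 0 + conj_loss_total q' C \<beta>"
        by (simp add: dual_value_def T_def)
      hence "T t - T 0 \<le> (conj_loss_total q' C \<beta> - conj_loss_total q' C b) * t"
        by (simp add: algebra_simps)
      thus ?case using elim by (simp add: pos_divide_le_eq)
    qed
  qed simp
  thus ?thesis by (simp add: D_eq \<delta>_def)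
qed

text \<open>Some b attains equality in the conjugacy inequality at the moments z. The subgradient
  inequality between b and \<beta> transfers this equality to \<beta>, so z minimizes the loss
  part.\<close>

lemma dual_maximum_saddle_point:
  assumes f: "\<beta> \<in> dual_feasible q q' C H" and max: "\<And>\<beta>'. \<beta>' \<in> dual_feasible q q' C H \<Longrightarrow> dual_value q q' C H \<beta>' \<le> dual_value q q' C H \<beta>"
  defines "p \<equiv> posterior q H \<beta>" and "z \<equiv> moments q \<phi> x y (posterior q H \<beta>)"
  shows "\<exists>\<kappa>. lagrangian q q' C \<phi> x y p z \<beta> \<kappa> = ereal (dual_value q q' C H \<beta>) \<and>
    (\<forall>p'\<in>admissible q \<phi> x y. \<forall>z'. ereal (dual_value q q' C H \<beta>) \<le> lagrangian q q' C \<phi> x y p' z' \<beta> \<kappa>)"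
proof -
  have c: "0 < post_scale q H \<beta>" by (rule dual_maximum_interior[OF f max])
  have dom: "\<And>i. conj_domain q' C (\<beta> $ i)" using f by (simp add: dual_feasible_def)
  obtain b where b: "\<And>i. conj_domain q' C (b $ i)" "loss_part q' C b z \<le> conj_loss_total q' C b"
    by (rule conj_loss_total_subgradient[OF q' C]) blast
  have "conj_loss_total q' C b - conj_loss_total q' C \<beta> \<le> (b - \<beta>) \<bullet> z"
    unfolding z_def by (rule dual_maximum_subgradient[OF f max b(1)])
  hence "loss_part q' C \<beta> z \<le> conj_loss_total q' C \<beta>"
    using b(2) by (simp add: loss_part_def inner_diff_left)
  hence loss: "loss_part q' C \<beta> z = conj_loss_total q' C \<beta>"
    using conj_loss_total_le[OF q' C dom, of z] by simp
  obtain \<kappa> where \<kappa>: "\<And>p. p \<in> admissible q \<phi> x y \<Longrightarrow> tsallis_div q p (prior q) \<noteq> \<infinity> \<Longrightarrow>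
      prior_dual q H \<beta> \<le> density_part q \<phi> x y \<beta> \<kappa> p"
    by (rule density_part_lower[OF q H less_imp_le[OF c]]) blast
  have "lagrangian q q' C \<phi> x y p z \<beta> \<kappa> = ereal (dual_value q q' C H \<beta>)"
    using posterior_admissible(3)[OF q H c]
    by (simp add: lagrangian_eq p_def density_part_posterior[OF q H c] loss dual_value_def)
  moreover have "ereal (dual_value q q' C H \<beta>) \<le> lagrangian q q' C \<phi> x y p' z' \<beta> \<kappa>"
    if "p' \<in> admissible q \<phi> x y" for p' z'
    unfolding lagrangian_eq dual_value_def
    using \<kappa>[OF that] conj_loss_total_le[OF q' C dom, of z'] by (auto intro: add_mono)
  ultimately show ?thesis by blast
qed

text \<open>On feasible pairs the Lagrangian is the objective, so the saddle value bounds the primal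
  problem from below. Any other solution has the same objective value, hence shares the multiplier
  \<beta>.\<close>

lemma dual_maximum_primal_solution:
  assumes f: "\<beta> \<in> dual_feasible q q' C H" and max: "\<And>\<beta>'. \<beta>' \<in> dual_feasible q q' C H \<Longrightarrow> dual_value q q' C H \<beta>' \<le> dual_value q q' C H \<beta>"
  defines "p \<equiv> posterior q H \<beta>" and "z \<equiv> moments q \<phi> x y (posterior q H \<beta>)"
  shows "primal_solution q q' C \<phi> x y p z" "primal_objective q q' C p z = ereal (dual_value q q' C H \<beta>)"
    and "primal_solution q q' C \<phi> x y p' z' \<Longrightarrow> lagrange_multiplier q q' C \<phi> x y p' z' \<beta>"
proof -
  have c: "0 < post_scale q H \<beta>" by (rule dual_maximum_interior[OF f max])
  have feas: "(p, z) \<in> primal_feasible q \<phi> x y"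
    using posterior_admissible[OF q H c] by (simp add: primal_feasible_iff p_def z_def)
  obtain \<kappa> where \<kappa>: "lagrangian q q' C \<phi> x y p z \<beta> \<kappa> = ereal (dual_value q q' C H \<beta>)"
    "\<And>p' z'. p' \<in> admissible q \<phi> x y \<Longrightarrow> ereal (dual_value q q' C H \<beta>) \<le> lagrangian q q' C \<phi> x y p' z' \<beta> \<kappa>"
    using dual_maximum_saddle_point[OF f max] unfolding p_def z_def by blast
  show obj: "primal_objective q q' C p z = ereal (dual_value q q' C H \<beta>)"
    using \<kappa>(1) lagrangian_feasible[OF feas] by simp
  have low: "ereal (dual_value q q' C H \<beta>) \<le> primal_objective q q' C p' z'"
    if "(p', z') \<in> primal_feasible q \<phi> x y" for p' z'
    using \<kappa>(2)[of p' z'] that lagrangian_feasible[OF that] by (simp add: primal_feasible_iff)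
  show "primal_solution q q' C \<phi> x y p z"
    using feas low by (auto simp: primal_solution_def obj)
  assume sol: "primal_solution q q' C \<phi> x y p' z'"
  hence feas': "(p', z') \<in> primal_feasible q \<phi> x y" by (simp add: primal_solution_def)
  have "primal_objective q q' C p' z' \<le> ereal (dual_value q q' C H \<beta>)"
    using sol feas obj by (auto simp: primal_solution_def)
  thus "lagrange_multiplier q q' C \<phi> x y p' z' \<beta>"
    unfolding lagrange_multiplier_def lagrangian_feasible[OF feas'] using \<kappa>(2) order_trans by blast
qed

text \<open>A multiplier makes the primal value at most the dual function at \<beta>, so the bounds
  on both parts are equalities. For c = 0 this forces mass 0; for c > 0 it makes the Bregman
  integral vanish.\<close>

lemma primal_solution_multiplier:
  assumes sol: "primal_solution q q' C \<phi> x y p z" and mult: "lagrange_multiplier q q' C \<phi> x y p z \<beta>"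
  shows "0 < post_scale q H \<beta>" "AE w in lborel. p w = posterior q H \<beta> w"
proof -
  have feas: "(p, z) \<in> primal_feasible q \<phi> x y" using sol by (simp add: primal_solution_def)
  hence p: "p \<in> admissible q \<phi> x y" "(\<integral>w. p w \<partial>lborel) = 1" by (simp_all add: primal_feasible_iff)
  obtain \<kappa>0 where "\<And>p' z'. p' \<in> admissible q \<phi> x y \<Longrightarrow>
      primal_objective q q' C p z \<le> lagrangian q q' C \<phi> x y p' z' \<beta> \<kappa>0"
    using mult unfolding lagrange_multiplier_def lagrangian_feasible[OF feas] by blast
  hence "primal_objective q q' C p z \<le> lagrange_dual q q' C \<phi> x y \<beta> \<kappa>0"
    unfolding lagrange_dual_def by (intro INF_greatest)
  also have "\<dots> \<le> (SUP \<kappa>. lagrange_dual q q' C \<phi> x y \<beta> \<kappa>)" by (rule SUP_upper) simp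
  finally have le: "primal_objective q q' C p z \<le> (if \<beta> \<in> dual_feasible q q' C H then ereal (dual_value q q' C H \<beta>) else - \<infinity>)"
    unfolding SUP_lagrange_dual .
  \<comment> \<open>At a feasible pair the Lagrangian is independent of \<kappa>. Hence \<kappa> may
    later be 0 or the constant of the Bregman identity, even if it differs from \<kappa>0.\<close>
  have obj: "primal_objective q q' C p z = (if tsallis_div q p (prior q) = \<infinity> then \<infinity>
     else ereal (density_part q \<phi> x y \<beta> \<kappa> p + loss_part q' C \<beta> z))" for \<kappa>
    unfolding lagrangian_feasible[OF feas, where \<beta> = \<beta> and \<kappa> = \<kappa>, symmetric] by (rule lagrangian_eq)
  from le have f: "\<beta> \<in> dual_feasible q q' C H" and fin: "tsallis_div q p (prior q) \<noteq> \<infinity>"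
    by (auto simp: obj[of 0] split: if_splits)
  have dom: "\<And>i. conj_domain q' C (\<beta> $ i)" and c: "0 \<le> post_scale q H \<beta>"
    using f by (simp_all add: dual_feasible_def)
  have dens: "density_part q \<phi> x y \<beta> \<kappa> p \<le> prior_dual q H \<beta>" for \<kappa>
    using le f fin conj_loss_total_le[OF q' C dom, of z] by (simp add: obj[of \<kappa>] dual_value_def)
  show c_pos: "0 < post_scale q H \<beta>"
  proof (rule ccontr)
    assume "\<not> 0 < post_scale q H \<beta>"
    hence c0: "post_scale q H \<beta> = 0" using c by simp
    hence q1: "q > 1" using post_scale_nonpos_imp[OF q(1), of H \<beta>] by simp
    have "prior_dual q H \<beta> = tsallis_val q p - (\<integral>w. ((transpose H *v \<beta>) \<bullet> w) * p w powr q \<partial>lborel)"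
      using dens[of 0] boundary_lower_bound(1)[OF q q1 c0 _ _ inner_moments(2)[OF q H p(1)] fin] p(1)
      by (simp add: density_part_def inner_moments(1)[OF q H p(1)] admissible_def)
    from boundary_lower_bound(2)[OF q q1 c0 _ _ inner_moments(2)[OF q H p(1)] fin this] p
    show False by (simp add: admissible_def)
  qed
  from density_part_identity[OF q H c_pos] obtain K \<kappa> where "K > 0"
    and id: "\<forall>p\<in>admissible q \<phi> x y. tsallis_div q p (prior q) \<noteq> \<infinity> \<longrightarrow>
      integrable lborel (\<lambda>w. bregman q (p w) (posterior q H \<beta> w)) \<and>
      density_part q \<phi> x y \<beta> \<kappa> p = prior_dual q H \<beta> + K * (\<integral>w. bregman q (p w) (posterior q H \<beta> w) \<partial>lborel)"
    by (elim exE conjE)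
  note K = \<open>K > 0\<close> conjunct1[OF id[rule_format, OF p(1) fin]] conjunct2[OF id[rule_format, OF p(1) fin]]
  have nonneg: "0 \<le> bregman q (p w) (posterior q H \<beta> w)" for w
    by (rule bregman_posterior_nonneg[OF q H c_pos p(1)])
  have "K * (\<integral>w. bregman q (p w) (posterior q H \<beta> w) \<partial>lborel) \<le> 0"
    using K(3) dens[of \<kappa>] by simp
  moreover have "0 \<le> (\<integral>w. bregman q (p w) (posterior q H \<beta> w) \<partial>lborel)"
    by (intro Bochner_Integration.integral_nonneg nonneg)
  ultimately have "(\<integral>w. bregman q (p w) (posterior q H \<beta> w) \<partial>lborel) = 0"
    using K(1) by (simp add: mult_le_0_iff)
  moreover have "bregman q (p w) (posterior q H \<beta> w) = 0 \<longleftrightarrow> p w = posterior q H \<beta> w" for w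
    using bregman_nonneg_eq_0_iff(2)[OF q(1) _ posterior_pos[OF q c_pos], of "p w" w] p(1) by (simp add: admissible_def)
  ultimately show "AE w in lborel. p w = posterior q H \<beta> w"
    using integral_nonneg_eq_0_iff_AE[of lborel "\<lambda>w. bregman q (p w) (posterior q H \<beta> w)"] K(2) nonneg
    by simp
qed

end

theorem theorem3:
  fixes \<phi> :: "'d::finite \<Rightarrow> real^'n \<Rightarrow> real"
    and x :: "'m::finite \<Rightarrow> real^'n"
    and y :: "'m \<Rightarrow> real"
    and C q q' :: real
    and H :: "real^'d^'m"
  assumes "\<forall>i. y i \<in> {-1, 1}"
    and "C > 0"
    and "1 \<le> q" "q < (2 + real CARD('d)) / real CARD('d)"
    and "0 \<le> q'" "q' \<le> 1"
    and "H = H_matrix \<phi> x y"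
  shows
    "(\<exists>p z. primal_solution q q' C \<phi> x y p z) \<and>
     (\<forall>p z. primal_solution q q' C \<phi> x y p z \<longrightarrow>
       (\<exists>\<beta>. lagrange_multiplier q q' C \<phi> x y p z \<beta>) \<and>
       (\<forall>\<beta>. lagrange_multiplier q q' C \<phi> x y p z \<beta> \<longrightarrow>
          0 < post_scale q H \<beta> \<and> (AE w in lborel. p w = posterior q H \<beta> w)))
     \<comment> \<open>the Lagrange dual, with the multiplier \<open>\<kappa>\<close> of the normalization maximized out\<close>
     \<and> (\<forall>\<beta>. (SUP \<kappa>. lagrange_dual q q' C \<phi> x y \<beta> \<kappa>) =
          (if \<beta> \<in> dual_domain q H
           then ereal (C * real CARD('m)) - dual_objective q q' C H \<beta> else - \<infinity>))
     \<and> (\<exists>\<beta>. dual_solution q q' C H \<beta>)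
     \<and> (\<forall>\<beta>. dual_solution q q' C H \<beta> \<longrightarrow>
          (let p = posterior q H \<beta>; z = moments q \<phi> x y p in
           primal_solution q q' C \<phi> x y p z \<and>
           lagrange_multiplier q q' C \<phi> x y p z \<beta> \<and>
           primal_objective q q' C p z =
             ereal (C * real CARD('m)) - dual_objective q q' C H \<beta>))
     \<and> (q = 1 \<longrightarrow>
          (\<forall>\<beta>. (\<beta> \<in> dual_domain q H \<longleftrightarrow> (\<forall>i. 0 \<le> \<beta> $ i)) \<and>
               dual_objective q q' C H \<beta> =
                 ereal (1/2 * (norm (transpose H *v \<beta>))\<^sup>2) + dual_loss q' C \<beta>))"
proof -
  note q = assms(3,4) and q' = assms(5,6) and C = assms(2) and H = assms(7)
  note solution = dual_maximum_primal_solution[OF q q' C H]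
    and iff = dual_solution_iff[OF q q' C H]
  \<comment> \<open>On the part of \<open>dual_domain\<close> where the dual loss is infinite, the
    difference is - \<infinity>, in agreement with the dual function there.\<close>
  have objective: "ereal (C * real CARD('m)) - dual_objective q q' C H \<beta> =
      (if \<beta> \<in> dual_feasible q q' C H then ereal (dual_value q q' C H \<beta>) else - \<infinity>)"
    if "\<beta> \<in> dual_domain q H" for \<beta>
    unfolding dual_objective_eq[OF q q' C H that] by simp
  obtain \<beta>0 where \<beta>0: "\<beta>0 \<in> dual_feasible q q' C H"
      "\<And>\<beta>'. \<beta>' \<in> dual_feasible q q' C H \<Longrightarrow> dual_value q q' C H \<beta>' \<le> dual_value q q' C H \<beta>0"
    using dual_maximum_exists[OF q q' C H] by blast
  have dual_fun: "(SUP \<kappa>. lagrange_dual q q' C \<phi> x y \<beta> \<kappa>) =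
      (if \<beta> \<in> dual_domain q H then ereal (C * real CARD('m)) - dual_objective q q' C H \<beta> else - \<infinity>)" for \<beta>
  proof (cases "\<beta> \<in> dual_domain q H")
    case True
    show ?thesis unfolding SUP_lagrange_dual[OF q q' C H] objective[OF True] using True by (simp only: if_True)
  next
    case False
    hence "\<beta> \<notin> dual_feasible q q' C H" using dual_feasible_imp_domain[OF q q' C H] by blast
    thus ?thesis unfolding SUP_lagrange_dual[OF q q' C H] using False by (simp only: if_False)
  qed
  have dual_sol: "let p = posterior q H \<beta>; z = moments q \<phi> x y p in
       primal_solution q q' C \<phi> x y p z \<and>
       lagrange_multiplier q q' C \<phi> x y p z \<beta> \<and>
       primal_objective q q' C p z = ereal (C * real CARD('m)) - dual_objective q q' C H \<beta>"
    if "dual_solution q q' C H \<beta>" for \<beta>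
  proof -
    have \<beta>: "\<beta> \<in> dual_feasible q q' C H"
        "\<And>\<beta>'. \<beta>' \<in> dual_feasible q q' C H \<Longrightarrow> dual_value q q' C H \<beta>' \<le> dual_value q q' C H \<beta>"
      using that unfolding iff by simp_all
    show ?thesis
      unfolding Let_def objective[OF dual_feasible_imp_domain[OF q q' C H \<beta>(1)]] if_P[OF \<beta>(1)]
      by (intro conjI solution(1,2)[OF \<beta>] solution(3)[OF \<beta> solution(1)[OF \<beta>]])
  qed
  have q_eq_1: "(\<beta> \<in> dual_domain q H \<longleftrightarrow> (\<forall>i. 0 \<le> \<beta> $ i)) \<and>
      dual_objective q q' C H \<beta> = ereal (1/2 * (norm (transpose H *v \<beta>))\<^sup>2) + dual_loss q' C \<beta>"
    if "q = 1" for \<beta>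
  proof -
    have "post_scale q H \<beta> = 1" using that by (simp add: post_scale_def)
    hence "ln_q q (exp_q q (dual_arg q H \<beta>) powr dual_exponent CARD('d) q) = 1/2 * (norm (transpose H *v \<beta>))\<^sup>2"
      using ln_q_exp_q_dual_arg[OF q, of H \<beta>] that by (simp add: prior_dual_def)
    thus ?thesis using that unfolding dual_objective_def by (simp only: dual_domain_def) simp
  qed
  show ?thesis
  proof (intro conjI)
    show "\<exists>p z. primal_solution q q' C \<phi> x y p z" using solution(1)[OF \<beta>0] by blast
    show "\<exists>\<beta>. dual_solution q q' C H \<beta>" using \<beta>0 by (auto simp: iff)
    show "\<forall>p z. primal_solution q q' C \<phi> x y p z \<longrightarrow>
       (\<exists>\<beta>. lagrange_multiplier q q' C \<phi> x y p z \<beta>) \<and>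
       (\<forall>\<beta>. lagrange_multiplier q q' C \<phi> x y p z \<beta> \<longrightarrow>
          0 < post_scale q H \<beta> \<and> (AE w in lborel. p w = posterior q H \<beta> w))"
      using solution(3)[OF \<beta>0] primal_solution_multiplier[OF q q' C H] by blast
  qed (use dual_fun dual_sol q_eq_1 in blast)+
qed

end
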